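(* There is a $\mathcal C^1$ diffeomorphism onto its image $T:U\to U$, where $U\subset\mathbb R^3$ is open and bounded, having a compact uniformly hyperbolic attractor $\Lambda=\bigcap_{k\ge0}T^k(U)$ with unstable dimension $1$, supporting exactly one physical measure $\mu_T$, but supporting no SRB measure.
   Context: Physical measure: a $T$-invariant probability measure $\mu$ such that the set of $x\in U$ with $\frac1n\sum_{k=0}^{n-1}\delta_{T^kx}\to\mu$ (weak-$*$) has positive Lebesgue measure. Uniformly hyperbolic attractor: let $U$ be an open bounded set of a manifold $M$ and $T:U\to U$ a diffeomorphism onto its image, with attractor $\Lambda=\bigcap_nT^n(U)$ (compact when $\overline{T(U)}\subset U$). $\Lambda$ is a strongly partially hyperbolic attractor if there are continuous sub-bundles $E^u,E^s$ of $T_\Lambda M$ (the restriction of the tangent bundle to $\Lambda$), of respective dimensions $d_u,d_s$, $DT$-invariant and with $T_\Lambda M=E^u\oplus E^s$, and numbers $C$ and $\lambda_+>\lambda_->0$ such that for all $x\in\Lambda$ and $n\in\mathbb N$: $\|DT^n_x(u)\|\le C\lambda_-^n\|u\|$ for all $u\in E^s_x$ and $\|DT^n_x(u)\|\ge C^{-1}\lambda_+^n\|u\|$ for all $u\in E^u_x$. If moreover $\lambda_-<1<\lambda_+$, $\Lambda$ is a uniformly hyperbolic attractor. The unstable dimension is $d_u$. SRB measure: for a uniformly hyperbolic attractor there is an invariant stable foliation $W^s$ of $U$ (the leaf through $x\in\Lambda$ is the set of points whose orbit converges to the orbit of $x$) and an invariant unstable lamination $W^u$ of $\Lambda$ (the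 leaf through $x$ is the set of points whose backward orbit converges to the backward orbit of $x$), with $\mathcal C^1$ leaves tangent to $E^s$, $E^u$ on $\Lambda$. Locally $\Lambda$ is a product of an unstable and a stable direction. Given a $T$-invariant probability $\mu$ (necessarily supported on $\Lambda$), disintegrate the restriction of $\mu$ to a small open set of $\Lambda$ with respect to the local projection $\pi^s$ on the stable direction, obtaining a family $(\mu_L)_L$ of measures on the local unstable leaves $L$ and the projected measure $\nu=\pi^s_*\mu$. $\mu$ is an SRB measure when in this local disintegration $\mu_L$ is absolutely continuous with respect to the Riemannian volume induced on $L$, for $\nu$-almost all $L$. *)

theory Defs
  imports "HOL-Analysis.Analysis" "HOL-Probability.Probability"
begin

section \<open>Diffeomorphisms onto their image and attractors\<close>

definition C1_on :: "('a::real_normed_vector \<Rightarrow> 'b::real_normed_vector) \<Rightarrow> 'a set \<Rightarrow> bool" where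
  "C1_on f S \<longleftrightarrow>
     (\<exists>f' :: 'a \<Rightarrow> 'a \<Rightarrow>\<^sub>L 'b.
        (\<forall>x\<in>S. (f has_derivative blinfun_apply (f' x)) (at x)) \<and> continuous_on S f')"

definition C1_diffeo_onto_image :: "('a::real_normed_vector \<Rightarrow> 'a) \<Rightarrow> 'a set \<Rightarrow> bool" where
  "C1_diffeo_onto_image T U \<longleftrightarrow>
     inj_on T U \<and> open (T ` U) \<and> C1_on T U \<and> C1_on (inv_into U T) (T ` U)"

definition attractor :: "('a \<Rightarrow> 'a) \<Rightarrow> 'a set \<Rightarrow> 'a set" where
  "attractor T U = (\<Inter>k. (T ^^ k) ` U)"

section \<open>Hyperbolicity\<close>

text \<open>A rank-\<open>d\<close> continuous sub-bundle \<open>E\<close> of the trivial bundle over \<open>L\<close>, given by continuous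
  local frames.\<close>

definition continuous_subbundle ::
    "'a::euclidean_space set \<Rightarrow> nat \<Rightarrow> ('a \<Rightarrow> 'a set) \<Rightarrow> bool" where
  "continuous_subbundle L d E \<longleftrightarrow>
     (\<forall>x\<in>L. \<exists>V (v :: nat \<Rightarrow> 'a \<Rightarrow> 'a).
        open V \<and> x \<in> V \<and>
        (\<forall>i<d. continuous_on (V \<inter> L) (v i)) \<and>
        (\<forall>y\<in>V \<inter> L. inj_on (\<lambda>i. v i y) {..<d} \<and>
                    independent ((\<lambda>i. v i y) ` {..<d}) \<and>
                    span ((\<lambda>i. v i y) ` {..<d}) = E y))"

definition partially_hyperbolic_splitting ::
    "('a::euclidean_space \<Rightarrow> 'a) \<Rightarrow> 'a set \<Rightarrow> nat \<Rightarrow> nat \<Rightarrow> ('a \<Rightarrow> 'a set) \<Rightarrow> ('a \<Rightarrow> 'a set)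
       \<Rightarrow> real \<Rightarrow> real \<Rightarrow> real \<Rightarrow> bool" where
  "partially_hyperbolic_splitting T L du ds Eu Es C lplus lminus \<longleftrightarrow>
     continuous_subbundle L du Eu \<and> continuous_subbundle L ds Es \<and>
     (\<forall>x\<in>L. frechet_derivative T (at x) ` Eu x = Eu (T x) \<and>
            frechet_derivative T (at x) ` Es x = Es (T x)) \<and>
     (\<forall>x\<in>L. Eu x \<inter> Es x = {0} \<and> {u + v | u v. u \<in> Eu x \<and> v \<in> Es x} = UNIV) \<and>
     C > 0 \<and> lplus > lminus \<and> lminus > 0 \<and>
     (\<forall>x\<in>L. \<forall>n. \<forall>u\<in>Es x. norm (frechet_derivative (T ^^ n) (at x) u) \<le> C * lminus ^ n * norm u) \<and>
     (\<forall>x\<in>L. \<forall>n. \<forall>u\<in>Eu x. norm (frechet_derivative (T ^^ n) (at x) u) \<ge> inverse C * lplus ^ n * norm u)"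

text \<open>The argument \<open>du\<close> is the unstable dimension.\<close>

definition uniformly_hyperbolic_attractor ::
    "('a::euclidean_space \<Rightarrow> 'a) \<Rightarrow> 'a set \<Rightarrow> nat \<Rightarrow> bool" where
  "uniformly_hyperbolic_attractor T U du \<longleftrightarrow>
     (\<exists>ds Eu Es C lplus lminus.
        partially_hyperbolic_splitting T (attractor T U) du ds Eu Es C lplus lminus \<and>
        lminus < 1 \<and> 1 < lplus)"

section \<open>Invariant and physical measures\<close>

definition invariant_probability ::
    "('a::topological_space \<Rightarrow> 'a) \<Rightarrow> 'a set \<Rightarrow> 'a measure \<Rightarrow> bool" where
  "invariant_probability T U \<mu> \<longleftrightarrow>
     prob_space \<mu> \<and> space \<mu> = U \<and> sets \<mu> = sets (restrict_space borel U) \<and>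
     T \<in> measurable \<mu> \<mu> \<and> distr \<mu> \<mu> T = \<mu>"

text \<open>\<open>(1/n) \<Sum>k<n. \<delta>(T\<^sup>k x)\<close>, as the image of the uniform probability on \<open>{0..<n}\<close>
  (for \<open>n = 0\<close> it is the zero measure).\<close>

definition empirical_measure ::
    "('a::topological_space \<Rightarrow> 'a) \<Rightarrow> 'a set \<Rightarrow> 'a \<Rightarrow> nat \<Rightarrow> 'a measure" where
  "empirical_measure T U x n =
     distr (uniform_count_measure {..<n}) (restrict_space borel U) (\<lambda>k. (T ^^ k) x)"

definition weak_star_converges ::
    "'a::topological_space set \<Rightarrow> (nat \<Rightarrow> 'a measure) \<Rightarrow> 'a measure \<Rightarrow> bool" where
  "weak_star_converges U M \<mu> \<longleftrightarrow>
     (\<forall>f :: 'a \<Rightarrow> real. continuous_on U f \<and> bounded (f ` U) \<longrightarrow>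
        (\<lambda>n. integral\<^sup>L (M n) f) \<longlonglongrightarrow> integral\<^sup>L \<mu> f)"

definition physical_measure ::
    "('a::euclidean_space \<Rightarrow> 'a) \<Rightarrow> 'a set \<Rightarrow> 'a measure \<Rightarrow> bool" where
  "physical_measure T U \<mu> \<longleftrightarrow>
     invariant_probability T U \<mu> \<and>
     emeasure lebesgue {x\<in>U. weak_star_converges U (empirical_measure T U x) \<mu>} > 0"

section \<open>Stable and unstable leaves, local product structure\<close>

definition stable_leaf :: "('a::metric_space \<Rightarrow> 'a) \<Rightarrow> 'a set \<Rightarrow> 'a \<Rightarrow> 'a set" where
  "stable_leaf T U x = {y\<in>U. (\<lambda>n. dist ((T ^^ n) y) ((T ^^ n) x)) \<longlonglongrightarrow> 0}"

text \<open>On the attractor, \<open>inv_into U T\<close> is the inverse of \<open>T\<close> and preserves the attractor.\<close>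

definition unstable_leaf :: "('a::metric_space \<Rightarrow> 'a) \<Rightarrow> 'a set \<Rightarrow> 'a \<Rightarrow> 'a set" where
  "unstable_leaf T U x =
     {y\<in>attractor T U. (\<lambda>n. dist ((inv_into U T ^^ n) y) ((inv_into U T ^^ n) x)) \<longlonglongrightarrow> 0}"

text \<open>A product box: a relatively open piece \<open>Q\<close> of the attractor, homeomorphic through \<open>h\<close> (with
  inverse \<open>g\<close>) to \<open>A \<times> B\<close>, where \<open>A\<close> is a connected open set of dimension \<open>CARD('d)\<close> (the unstable
  dimension), horizontal slices lie in unstable leaves and vertical slices in stable leaves.  As
  \<open>A\<close> is connected, the slices \<open>h ` (A \<times> {b})\<close> are the local unstable leaves in the box, and
  \<open>snd \<circ> g\<close> is the local projection \<open>\<pi>\<^sup>s\<close> on the stable direction, here parametrized by \<open>B\<close>.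
  The slices \<open>h (\<cdot>, b)\<close> are only required to be continuous: stable holonomies need not be \<open>C\<^sup>1\<close>,
  so a chart straightening both families is in general not smooth along the leaves.\<close>

definition product_box ::
    "(real^'n \<Rightarrow> real^'n) \<Rightarrow> (real^'n) set \<Rightarrow> (real^'d) set \<Rightarrow> (real^'n) set \<Rightarrow> (real^'n) set
       \<Rightarrow> ((real^'d) \<times> (real^'n) \<Rightarrow> real^'n) \<Rightarrow> (real^'n \<Rightarrow> (real^'d) \<times> (real^'n)) \<Rightarrow> bool" where
  "product_box T U A B Q h g \<longleftrightarrow>
     open A \<and> connected A \<and> A \<noteq> {} \<and>
     openin (top_of_set (attractor T U)) Q \<and>
     homeomorphism (A \<times> B) Q h g \<and>
     (\<forall>b\<in>B. \<forall>a\<in>A. \<forall>a'\<in>A. h (a', b) \<in> unstable_leaf T U (h (a, b))) \<and>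
     (\<forall>a\<in>A. \<forall>b\<in>B. \<forall>b'\<in>B. h (a, b') \<in> stable_leaf T U (h (a, b)))"

section \<open>SRB measures\<close>

definition C1_parametrization ::
    "(real^'d) set \<Rightarrow> (real^'d \<Rightarrow> real^'n) \<Rightarrow> (real^'n) set \<Rightarrow> bool" where
  "C1_parametrization V \<gamma> L \<longleftrightarrow>
     open V \<and> C1_on \<gamma> V \<and> (\<forall>v\<in>V. inj (frechet_derivative \<gamma> (at v))) \<and>
     (\<exists>\<gamma>'. homeomorphism V L \<gamma> \<gamma>')"

text \<open>The Riemannian volume induced by the Euclidean metric on \<open>L = \<gamma> ` V\<close> (as a Borel measure of
  the ambient space carried by \<open>L\<close>): it has density \<open>sqrt (det (D\<gamma>\<^sup>t D\<gamma>))\<close> in the coordinates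
  \<open>\<gamma>\<close>.  By change of variables it depends only on \<open>L\<close>.\<close>

definition riemannian_volume ::
    "(real^'d) set \<Rightarrow> (real^'d \<Rightarrow> real^'n) \<Rightarrow> (real^'n) measure" where
  "riemannian_volume V \<gamma> =
     distr
       (density (restrict_space lborel V)
          (\<lambda>v. let J = matrix (frechet_derivative \<gamma> (at v))
               in ennreal (sqrt (det (transpose J ** J)))))
       borel \<gamma>"

definition abs_cont_on_leaf ::
    "'d::finite itself \<Rightarrow> (real^'n) set \<Rightarrow> (real^'n) measure \<Rightarrow> bool" where
  "abs_cont_on_leaf _ L m \<longleftrightarrow>
     (\<exists>(V :: (real^'d) set) \<gamma>.
        C1_parametrization V \<gamma> L \<and> absolutely_continuous (riemannian_volume V \<gamma>) m)"

text \<open>\<open>\<kappa>\<close> is a disintegration of the restriction of \<open>\<mu>\<close> to \<open>Q\<close> with respect to \<open>p : Q \<rightarrow> B\<close>, over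
  \<open>\<nu> = p\<^sub>* (\<mu>|Q)\<close>; the conditional measures are Borel probabilities of the ambient space, carried
  by the fibres of \<open>p\<close>.\<close>

definition transverse_measure ::
    "'a::topological_space measure \<Rightarrow> 'a set \<Rightarrow> 'b::topological_space set \<Rightarrow> ('a \<Rightarrow> 'b) \<Rightarrow> 'b measure" where
  "transverse_measure \<mu> Q B p = distr (restrict_space \<mu> Q) (restrict_space borel B) p"

definition disintegration ::
    "'a::topological_space measure \<Rightarrow> 'a set \<Rightarrow> 'b::topological_space set \<Rightarrow> ('a \<Rightarrow> 'b)
       \<Rightarrow> ('b \<Rightarrow> 'a measure) \<Rightarrow> bool" where
  "disintegration \<mu> Q B p \<kappa> \<longleftrightarrow>
     \<kappa> \<in> measurable (restrict_space borel B) (prob_algebra borel) \<and>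
     (\<forall>S\<in>sets borel. emeasure \<mu> (S \<inter> Q) = (\<integral>\<^sup>+ b. emeasure (\<kappa> b) S \<partial>transverse_measure \<mu> Q B p)) \<and>
     (AE b in transverse_measure \<mu> Q B p. emeasure (\<kappa> b) (- {x\<in>Q. p x = b}) = 0)"

text \<open>The type argument fixes the dimension \<open>CARD('d)\<close> of the unstable leaves.\<close>

definition SRB_measure ::
    "'d::finite itself \<Rightarrow> (real^'n \<Rightarrow> real^'n) \<Rightarrow> (real^'n) set \<Rightarrow> (real^'n) measure \<Rightarrow> bool" where
  "SRB_measure d T U \<mu> \<longleftrightarrow>
     invariant_probability T U \<mu> \<and>
     (\<forall>(A :: (real^'d) set) B Q h g. product_box T U A B Q h g \<longrightarrow>
        (\<exists>\<kappa>. disintegration \<mu> Q B (snd \<circ> g) \<kappa> \<and>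
             (AE b in transverse_measure \<mu> Q B (snd \<circ> g).
                abs_cont_on_leaf d (h ` (A \<times> {b})) (\<kappa> b))))"

end

theory Submission
  imports Defs
begin


text \<open>
  The example is a solenoid over an expanding circle map that is \<open>C\<^sup>1\<close> but has a derivative too rough for
  the distortion estimates behind SRB measures.

  The circle map. For the amplitudes \<open>a k = 1 / (10 * sqrt (k + 1))\<close> the Riesz product
  \<open>\<Prod>k. 1 + a k * cos (2 * pi * 3 ^ k * x)\<close> defines a probability measure \<open>m\<close> on the circle. Let \<open>H\<close> be its
  distribution function, \<open>X\<close> the inverse of \<open>H\<close>, and \<open>F = H \<circ> (\<lambda>x. 3 * x) \<circ> X\<close>. The Jacobian of \<open>x \<mapsto> 3 * x\<close> with
  respect to \<open>m\<close> is a product in which the factors of two consecutive levels are compared at the same point, so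
  it is governed by the differences \<open>a k - a (k + 1)\<close>. These are summable; hence the Jacobian is continuous,
  and \<open>F\<close> is \<open>C\<^sup>1\<close> with slope between two and four (\<open>riesz_lim_jacobian\<close>, \<open>amp_cdf_tripling_deriv\<close>).
  Singularity of \<open>m\<close>, on the other hand, is governed by the squares \<open>(a k)\<^sup>2\<close>, whose sum diverges
  (\<open>amp_cdf_singular\<close>).

  Typical orbits. The map \<open>X\<close> carries the Lebesgue measure to \<open>m\<close>. Because \<open>a k\<close> tends to zero, correlations
  of fluctuations along the orbit of \<open>x\<close> under \<open>x \<mapsto> 3 * x\<close> are nearly those for the Lebesgue measure, and a
  second moment bound shows that \<open>m\<close>-almost every \<open>x\<close> has an orbit equidistributed for the Lebesgue measure
  (\<open>AE_equidistributed\<close>). In the coordinate \<open>t = H x\<close>: for Lebesgue-almost every \<open>t\<close> the orbit under \<open>F\<close> is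
  distributed according to the image of the Lebesgue measure under \<open>H\<close>, and this image is singular.

  The solenoid. On the solid torus let \<open>T (t, w) = (F t, w / 8 + cis (2 * pi * t) / 2)\<close>, where \<open>t\<close> is an angle in turns and
  \<open>w\<close> a point of the unit disc. It is a \<open>C\<^sup>1\<close> diffeomorphism onto its image, contracts the discs and expands the
  angle, so its attractor is uniformly hyperbolic with unstable dimension one. Since the discs are
  contracted, the statistics of the orbit of \<open>(t, w)\<close> depend on \<open>t\<close> alone: for almost every point the
  empirical measures converge to one measure \<open>phys\<close>, the lift of the singular measure above to the natural
  extension. It is therefore the only physical measure (\<open>unique_physical\<close>).

  No SRB measure. The unstable leaves are Lipschitz graphs over the angle \<open>t\<close> (\<open>flow_lipschitz\<close>), so a null set of
  angles meets every leaf in a set of volume zero (\<open>leaf_null\<close>), and consequently has measure zero for every SRB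
  measure (\<open>SRB_angle_null\<close>). Apply this twice. The set of angles without the equidistribution property is null; so
  almost every point for an SRB measure is typical, and the SRB measure equals \<open>phys\<close> (\<open>invariant_eq_phys\<close>). But
  the angles of \<open>phys\<close> lie in a null set with probability one, a contradiction (\<open>no_SRB\<close>).
\<close>

section \<open>Periodic functions\<close>

lemma periodic_shift_int:
  fixes f :: "real \<Rightarrow> 'a"
  assumes "\<And>x. f (x + 1) = f x"
  shows "f (x + of_int k) = f x"
proof (induction k rule: int_induct[where k = 0])
  case (step1 i)
  then show ?case using assms[of "x + of_int i"] by (simp add: add.assoc)
next
  case (step2 i)
  then show ?case using assms[of "x + of_int (i - 1)"] by simp
qed simp

lemma periodic_frac:
  fixes f :: "real \<Rightarrow> 'a"
  assumes "\<And>x. f (x + 1) = f x"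
  shows "f (frac x) = f x"
  using periodic_shift_int[of f "frac x" "\<lfloor>x\<rfloor>", OF assms] by (simp add: frac_def)

lemma periodic_bound:
  fixes f :: "real \<Rightarrow> real"
  assumes "\<And>x. f (x + 1) = f x" "\<And>x. 0 \<le> x \<Longrightarrow> x \<le> 1 \<Longrightarrow> \<bar>f x\<bar> \<le> M"
  shows "\<bar>f x\<bar> \<le> M"
  using assms(2)[of "frac x"] periodic_frac[of f x, OF assms(1)] frac_lt_1[of x]
  by (simp add: less_imp_le)

lemma lift_shift_int:
  fixes f :: "real \<Rightarrow> real"
  assumes "\<And>x. f (x + 1) = f x + c"
  shows "f (x + of_int k) = f x + c * of_int k"
  using periodic_shift_int[of "\<lambda>x. f x - c * x" x k] assms by (simp add: algebra_simps)

lemma ex_antiderivative: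
  fixes f :: "real \<Rightarrow> real"
  assumes "continuous_on UNIV f"
  shows "\<exists>g. g 0 = 0 \<and> (\<forall>x. (g has_real_derivative f x) (at x))"
proof -
  let ?g = "\<lambda>u::real. LBINT y=0..u. f y"
  have d: "(?g has_real_derivative f x) (at x)" for x
  proof -
    let ?b = "\<bar>x\<bar> + 1"
    have "(?g has_vector_derivative f x) (at x within {- ?b..?b})"
      using interval_integral_FTC2[of "- ?b" 0 ?b f x] continuous_on_subset[OF assms]
      by (auto simp: zero_ereal_def)
    then have "(?g has_vector_derivative f x) (at x within {- ?b<..<?b})"
      by (rule has_vector_derivative_within_subset) auto
    moreover have "at x within {- ?b<..<?b} = at x"
      by (rule at_within_open) auto
    ultimately show ?thesis
      by (simp add: has_real_derivative_iff_has_vector_derivative)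
  qed
  have g0: "?g 0 = 0" by (simp add: zero_ereal_def)
  show ?thesis by (intro exI[where x = ?g] conjI allI d g0)
qed

lemma eq_of_same_derivative:
  fixes f g :: "real \<Rightarrow> real"
  assumes "\<And>x. (f has_real_derivative d x) (at x)" "\<And>x. (g has_real_derivative d x) (at x)" "f 0 = g 0"
  shows "f x = g x"
proof -
  have "((\<lambda>x. f x - g x) has_real_derivative 0) (at x)" for x
    using DERIV_diff[OF assms(1)[of x] assms(2)[of x]] by simp
  from DERIV_isconst_all[of "\<lambda>x. f x - g x" x 0] this assms(3) show ?thesis by force
qed

section \<open>Riesz products\<close>

definition psi :: "real \<Rightarrow> real" where "psi x = cos (2 * pi * x)"

lemma psi_periodic: "psi (x + 1) = psi x"
  using cos_periodic[of "2 * pi * x"] by (simp add: psi_def algebra_simps)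

lemma abs_psi_le: "\<bar>psi x\<bar> \<le> 1"
  by (simp add: psi_def)

lemma continuous_psi [continuous_intros]:
  fixes f :: "'a::t2_space \<Rightarrow> real"
  shows "continuous_on S f \<Longrightarrow> continuous_on S (\<lambda>x. psi (f x))"
  unfolding psi_def by (intro continuous_on_cos continuous_on_mult_left)

lemma psi_thirds:
  "psi (x / 3) + psi ((x + 1) / 3) + psi ((x + 2) / 3) = 0"
  "(psi (x / 3))\<^sup>2 + (psi ((x + 1) / 3))\<^sup>2 + (psi ((x + 2) / 3))\<^sup>2 = 3 / 2"
proof -
  define t where "t = 2 * pi * (x / 3)"
  have sq: "u\<^sup>2 + (u * - (1 / 2) - v * (q / 2))\<^sup>2 + (u * - (1 / 2) - v * (- q / 2))\<^sup>2 = (3 / 2) * (u\<^sup>2 + v\<^sup>2)"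
    if "q * q = 3" for u v q :: real
  proof -
    have "u\<^sup>2 + (u * - (1 / 2) - v * (q / 2))\<^sup>2 + (u * - (1 / 2) - v * (- q / 2))\<^sup>2
      = (3 / 2) * u\<^sup>2 + v\<^sup>2 * (q * q) / 2" by (simp add: power2_eq_square field_simps)
    then show ?thesis unfolding that by simp
  qed
  have c: "cos (2 * pi / 3) = - (1 / 2)" "sin (2 * pi / 3) = sqrt 3 / 2"
    using cos_120 sin_120 by (simp_all add: mult.commute)
  have c4: "cos (4 * pi / 3) = - (1 / 2)" "sin (4 * pi / 3) = - sqrt 3 / 2"
    using cos_add[of "pi" "pi / 3"] sin_add[of "pi" "pi / 3"] cos_60 sin_60
    by (simp_all add: add_divide_distrib[symmetric])
  have e: "psi (x / 3) = cos t" "psi ((x + 1) / 3) = cos (t + 2 * pi / 3)"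
    "psi ((x + 2) / 3) = cos (t + 4 * pi / 3)"
    unfolding psi_def t_def by (simp_all add: field_simps)
  show "psi (x / 3) + psi ((x + 1) / 3) + psi ((x + 2) / 3) = 0"
    unfolding e cos_add c c4 by simp
  have "(psi (x / 3))\<^sup>2 + (psi ((x + 1) / 3))\<^sup>2 + (psi ((x + 2) / 3))\<^sup>2
        = (3 / 2) * ((cos t)\<^sup>2 + (sin t)\<^sup>2)"
    unfolding e cos_add c c4 by (rule sq) simp
  then show "(psi (x / 3))\<^sup>2 + (psi ((x + 1) / 3))\<^sup>2 + (psi ((x + 2) / 3))\<^sup>2 = 3 / 2" by simp
qed

definition riesz :: "(nat \<Rightarrow> real) \<Rightarrow> nat \<Rightarrow> real \<Rightarrow> real" where
  "riesz a N x = (\<Prod>k<N. 1 + a k * psi (3 ^ k * x))"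

lemma riesz_0 [simp]: "riesz a 0 x = 1"
  by (simp add: riesz_def)

lemma riesz_Suc: "riesz a (Suc N) x = riesz a N x * (1 + a N * psi (3 ^ N * x))"
  by (simp add: riesz_def)

lemma riesz_Suc_shift:
  "riesz a (Suc N) x = (1 + a 0 * psi x) * riesz (\<lambda>k. a (Suc k)) N (3 * x)"
  unfolding riesz_def prod.lessThan_Suc_shift by (simp add: mult.assoc mult.left_commute[of 3])

lemma continuous_riesz [continuous_intros]:
  fixes f :: "'a::t2_space \<Rightarrow> real"
  shows "continuous_on S f \<Longrightarrow> continuous_on S (\<lambda>x. riesz a N (f x))"
  unfolding riesz_def
  by (intro continuous_on_prod continuous_on_add continuous_on_mult continuous_on_const continuous_psi)

lemma psi_pow3_periodic: "psi (3 ^ k * (x + 1)) = psi (3 ^ k * x)"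
  using periodic_shift_int[of psi "3 ^ k * x" "3 ^ k", OF psi_periodic] by (simp add: distrib_left)

lemma riesz_periodic: "riesz a N (x + 1) = riesz a N x"
  by (simp add: riesz_def psi_pow3_periodic)

definition small_coeffs :: "(nat \<Rightarrow> real) \<Rightarrow> bool" where
  "small_coeffs a \<longleftrightarrow> (\<forall>k. 0 \<le> a k \<and> a k \<le> 1 / 10)"

lemma small_coeffs_shift: "small_coeffs a \<Longrightarrow> small_coeffs (\<lambda>k. a (Suc k))"
  by (simp add: small_coeffs_def)

lemma riesz_factor_bounds:
  assumes "small_coeffs a"
  shows "9 / 10 \<le> 1 + a k * psi x" "1 + a k * psi x \<le> 11 / 10"
proof -
  have "\<bar>a k * psi x\<bar> \<le> 1 / 10 * 1"
    unfolding abs_mult using assms abs_psi_le[of x]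
    by (intro mult_mono) (auto simp: small_coeffs_def)
  then show "9 / 10 \<le> 1 + a k * psi x" "1 + a k * psi x \<le> 11 / 10" by auto
qed

lemma riesz_pos: "small_coeffs a \<Longrightarrow> riesz a N x > 0"
  unfolding riesz_def by (intro prod_pos ballI less_le_trans[OF _ riesz_factor_bounds(1)]) simp_all

text \<open>The distribution function of the measure with density \<open>riesz a N\<close>; the normalization at \<open>0\<close> makes the
  choice of the primitive unique.\<close>

definition riesz_cdf :: "(nat \<Rightarrow> real) \<Rightarrow> nat \<Rightarrow> real \<Rightarrow> real" where
  "riesz_cdf a N = (SOME g. g 0 = 0 \<and> (\<forall>x. (g has_real_derivative riesz a N x) (at x)))"

lemma riesz_cdf_0 [simp]: "riesz_cdf a N 0 = 0"
  and riesz_cdf_deriv: "(riesz_cdf a N has_real_derivative riesz a N x) (at x)"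
proof -
  have "riesz_cdf a N 0 = 0 \<and> (\<forall>x. (riesz_cdf a N has_real_derivative riesz a N x) (at x))"
    unfolding riesz_cdf_def
    by (rule someI_ex[OF ex_antiderivative]) (intro continuous_intros)
  then show "riesz_cdf a N 0 = 0" "(riesz_cdf a N has_real_derivative riesz a N x) (at x)" by auto
qed

lemma riesz_cdf_triple_deriv:
  "((\<lambda>x. riesz_cdf a N (3 * x)) has_real_derivative 3 * riesz a N (3 * x)) (at x)"
proof -
  have "((\<lambda>x. 3 * x) has_real_derivative 3) (at x)"
    by (auto intro!: derivative_eq_intros)
  from DERIV_chain2[OF riesz_cdf_deriv this] show ?thesis by (simp add: mult.commute)
qed

lemma riesz_cdf_zero: "riesz_cdf a 0 x = x"
  using eq_of_same_derivative[of "riesz_cdf a 0" "\<lambda>_. 1" "\<lambda>x. x" x] riesz_cdf_deriv[of a 0] by simp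

text \<open>Each new factor has mean one over every fibre of \<open>x \<mapsto> 3 * x\<close>, because the three
  values of \<open>psi\<close> over a fibre cancel. The sum of the distribution function over the three points
  \<open>x\<close>, \<open>x + 1/3\<close>, \<open>x + 2/3\<close> is therefore the previous one at \<open>3 * x\<close>, up to a constant, and the
  increment over a period telescopes out of that sum.\<close>

lemma riesz_cdf_shift: "riesz_cdf a N (x + 1) = riesz_cdf a N x + 1"
proof (induction N arbitrary: a x)
  case 0
  then show ?case by (simp add: riesz_cdf_zero)
next
  case (Suc N)
  let ?b = "\<lambda>k. a (Suc k)"
  let ?H = "riesz_cdf a (Suc N)"
  let ?S = "\<lambda>x. ?H x + ?H (x + 1/3) + ?H (x + 2/3)"
  have r: "riesz ?b N (3 * (x + 1/3)) = riesz ?b N (3 * x)"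
    "riesz ?b N (3 * (x + 2/3)) = riesz ?b N (3 * x)" for x
    using riesz_periodic[of ?b N "3 * x"] riesz_periodic[of ?b N "3 * x + 1"]
    by (simp_all add: algebra_simps)
  have "riesz a (Suc N) x + riesz a (Suc N) (x + 1/3) + riesz a (Suc N) (x + 2/3)
     = 3 * riesz ?b N (3 * x)" for x
  proof -
    have "psi x + psi (x + 1/3) + psi (x + 2/3) = 0"
      using psi_thirds(1)[of "3 * x"] by (simp add: field_simps)
    then have "a 0 * (psi x + psi (x + 1/3) + psi (x + 2/3)) = 0" by simp
    moreover have "(1 + a 0 * p) * R + (1 + a 0 * q) * R + (1 + a 0 * s) * R
      = 3 * R + a 0 * (p + q + s) * R" for p q s R :: real
      by (simp add: algebra_simps)
    ultimately show ?thesis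
      unfolding riesz_Suc_shift r by simp
  qed
  then have d1: "(?S has_real_derivative 3 * riesz ?b N (3 * x)) (at x)" for x
    by (auto intro!: derivative_eq_intros DERIV_chain2[OF riesz_cdf_deriv])
  define s0 where "s0 = ?S 0"
  have d2: "((\<lambda>x. riesz_cdf ?b N (3 * x) + s0) has_real_derivative 3 * riesz ?b N (3 * x)) (at x)" for x
    by (auto intro!: derivative_eq_intros DERIV_chain2[OF riesz_cdf_deriv])
  have S: "?S x = riesz_cdf ?b N (3 * x) + s0" for x
    by (rule eq_of_same_derivative[OF d1 d2]) (simp add: s0_def)
  have "?S (x + 1/3) - ?S x = 1"
    unfolding S using Suc.IH[of ?b "3 * x"] by (simp add: algebra_simps)
  then show ?case by (simp add: algebra_simps)
qed

text \<open>Integration by parts shows that passing from \<open>(N, \<lambda>k. a (Suc k))\<close> to \<open>(Suc N, a)\<close>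
  contracts the difference of consecutive distribution functions: the factor is
  \<open>11/30 + 2 * pi/30 < 3/5\<close>, the first term coming from the boundary and the second from the derivative
  of \<open>psi\<close>.\<close>

lemma riesz_cdf_step:
  assumes "small_coeffs a"
  shows "\<bar>riesz_cdf a (Suc N) x - riesz_cdf a N x\<bar> \<le> (3 / 5) ^ N"
  using assms
proof (induction N arbitrary: a x)
  case 0
  have "riesz_cdf a (Suc 0) x = x + a 0 * sin (2 * pi * x) / (2 * pi)" for x
    by (rule eq_of_same_derivative[OF riesz_cdf_deriv])
       (auto intro!: derivative_eq_intros simp: riesz_Suc psi_def)
  moreover have "\<bar>a 0 * sin (2 * pi * x) / (2 * pi)\<bar> \<le> 1"
  proof -
    have "\<bar>a 0 * sin (2 * pi * x)\<bar> \<le> 1 * 1"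
      unfolding abs_mult using 0
      by (intro mult_mono) (auto simp: small_coeffs_def abs_le_iff intro: order_trans[of _ "1/10"])
    also have "1 * 1 \<le> 2 * pi" using pi_gt3 by simp
    finally show ?thesis by (simp add: abs_divide)
  qed
  ultimately show ?case by (simp add: riesz_cdf_zero)
next
  case (Suc N)
  let ?b = "\<lambda>k. a (Suc k)"
  let ?M = "(3 / 5) ^ N :: real"
  define D where "D x = riesz_cdf ?b (Suc N) x - riesz_cdf ?b N x" for x
  define D1 where "D1 x = riesz_cdf a (Suc (Suc N)) x - riesz_cdf a (Suc N) x" for x
  define E where "E x = D1 x - (1 + a 0 * psi x) * D (3 * x) / 3" for x
  have DM: "\<bar>D x\<bar> \<le> ?M" for x
    unfolding D_def using Suc.IH[of ?b x] small_coeffs_shift[OF Suc.prems] by simp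
  have a0: "0 \<le> a 0" "a 0 \<le> 1 / 10" using Suc.prems by (auto simp: small_coeffs_def)
  have dE: "(E has_real_derivative a 0 * (2 * pi * sin (2 * pi * x)) * D (3 * x) / 3) (at x)" for x
    unfolding E_def D1_def D_def psi_def
    by (rule derivative_eq_intros DERIV_chain2[OF riesz_cdf_deriv] refl | simp)+
       (simp add: riesz_Suc_shift psi_def field_simps)
  have dEb: "\<bar>a 0 * (2 * pi * sin (2 * pi * x)) * D (3 * x) / 3\<bar> \<le> 7 / 30 * ?M" for x
  proof -
    have "\<bar>a 0 * (2 * pi * sin (2 * pi * x)) * D (3 * x)\<bar> \<le> 1 / 10 * (7 * 1) * ?M"
      unfolding abs_mult using a0 DM[of "3 * x"] pi_approx
      by (intro mult_mono) (auto simp: abs_le_iff)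
    then show ?thesis by (simp add: abs_divide)
  qed
  have E0: "E 0 = 0" by (simp add: E_def D1_def D_def)
  have Eb: "\<bar>E x\<bar> \<le> 7 / 30 * ?M" if "0 \<le> x" "x \<le> 1" for x
  proof -
    have "norm (E x - E 0) \<le> 7 / 30 * ?M * norm (x - 0)"
      by (rule field_differentiable_bound[where S = UNIV])
         (use dE dEb in \<open>auto simp: has_field_derivative_at_within\<close>)
    also have "\<dots> \<le> 7 / 30 * ?M * 1" using that by (intro mult_left_mono) auto
    finally show ?thesis using E0 by simp
  qed
  have "\<bar>D1 x\<bar> \<le> 3 / 5 * ?M"
  proof (rule periodic_bound[where f = D1])
    show "D1 (x + 1) = D1 x" for x by (simp add: D1_def riesz_cdf_shift)
    fix x :: real assume x: "0 \<le> x" "x \<le> 1"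
    have "\<bar>(1 + a 0 * psi x) * D (3 * x)\<bar> \<le> 11 / 10 * ?M"
      unfolding abs_mult using riesz_factor_bounds[OF Suc.prems, of 0 x] DM[of "3 * x"]
      by (intro mult_mono) auto
    moreover have "D1 x = E x + (1 + a 0 * psi x) * D (3 * x) / 3" by (simp add: E_def)
    moreover have "\<bar>v + u / 3\<bar> \<le> 3 / 5 * m" if "\<bar>u\<bar> \<le> 11 / 10 * m" "\<bar>v\<bar> \<le> 7 / 30 * m" for u v m :: real
      using that by linarith
    ultimately show "\<bar>D1 x\<bar> \<le> 3 / 5 * ?M" using Eb[OF x] by metis
  qed
  then show ?case by (simp add: D1_def)
qed

definition riesz_lim :: "(nat \<Rightarrow> real) \<Rightarrow> real \<Rightarrow> real" where
  "riesz_lim a x = lim (\<lambda>N. riesz_cdf a N x)"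

lemma riesz_cdf_uniform_limit:
  assumes "small_coeffs a"
  shows "uniform_limit UNIV (riesz_cdf a) (riesz_lim a) sequentially"
proof -
  let ?f = "\<lambda>N x. riesz_cdf a (Suc N) x - riesz_cdf a N x"
  have u: "uniform_limit UNIV (\<lambda>n x. \<Sum>i<n. ?f i x) (\<lambda>x. \<Sum>i. ?f i x) sequentially"
    by (rule Weierstrass_m_test[where M = "\<lambda>n. (3/5) ^ n"])
       (use riesz_cdf_step[OF assms] in \<open>auto intro: summable_geometric\<close>)
  have e: "(\<Sum>i<n. ?f i x) = riesz_cdf a n x - x" for n x
    using sum_lessThan_telescope[of "\<lambda>i. riesz_cdf a i x" n] by (simp add: riesz_cdf_zero)
  have "uniform_limit UNIV (\<lambda>n x. (\<Sum>i<n. ?f i x) + x) (\<lambda>x. (\<Sum>i. ?f i x) + x) sequentially"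
    by (intro uniform_limit_intros u)
  then have v: "uniform_limit UNIV (riesz_cdf a) (\<lambda>x. (\<Sum>i. ?f i x) + x) sequentially"
    unfolding e by simp
  have "(\<Sum>i. ?f i x) + x = riesz_lim a x" for x
    unfolding riesz_lim_def by (rule sym, rule limI, rule tendsto_uniform_limitI[OF v]) auto
  with v show ?thesis by simp
qed

lemma riesz_cdf_tendsto: "small_coeffs a \<Longrightarrow> (\<lambda>N. riesz_cdf a N x) \<longlonglongrightarrow> riesz_lim a x"
  using tendsto_uniform_limitI[OF riesz_cdf_uniform_limit] by auto

lemma riesz_lim_0: "riesz_lim a 0 = 0"
  by (simp add: riesz_lim_def)

lemma riesz_lim_shift:
  assumes "small_coeffs a" shows "riesz_lim a (x + 1) = riesz_lim a x + 1"
proof (rule LIMSEQ_unique[OF riesz_cdf_tendsto[OF assms]])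
  show "(\<lambda>N. riesz_cdf a N (x + 1)) \<longlonglongrightarrow> riesz_lim a x + 1"
    unfolding riesz_cdf_shift by (intro tendsto_intros riesz_cdf_tendsto assms)
qed

lemma continuous_riesz_lim: "small_coeffs a \<Longrightarrow> continuous_on UNIV (riesz_lim a)"
  by (rule uniform_limit_theorem[OF _ riesz_cdf_uniform_limit])
     (auto intro!: always_eventually DERIV_continuous_on has_field_derivative_at_within[OF riesz_cdf_deriv])

section \<open>The Jacobian of the tripling map\<close>

text \<open>This is the Jacobian of \<open>x \<mapsto> 3 * x\<close> from the density \<open>riesz a (Suc N)\<close> to the density \<open>riesz a N\<close>. Apart from
  \<open>3 / (1 + a 0 * psi x)\<close> it is a product of ratios of the factors of levels \<open>k\<close> and \<open>Suc k\<close>, both taken at the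
  point \<open>3 ^ Suc k * x\<close>. Such a ratio deviates from one by a multiple of \<open>a k - a (Suc k)\<close>, and for a
  sequence decreasing to zero these differences are summable, whatever the sum of its squares.\<close>

definition riesz_jac :: "(nat \<Rightarrow> real) \<Rightarrow> nat \<Rightarrow> real \<Rightarrow> real" where
  "riesz_jac a N x = 3 * riesz a N (3 * x) / riesz a (Suc N) x"

definition null_coeffs :: "(nat \<Rightarrow> real) \<Rightarrow> bool" where
  "null_coeffs a \<longleftrightarrow> small_coeffs a \<and> decseq a \<and> a \<longlonglongrightarrow> 0"

lemma null_coeffs_small: "null_coeffs a \<Longrightarrow> small_coeffs a"
  by (simp add: null_coeffs_def)

lemma null_coeffs_Suc: "null_coeffs a \<Longrightarrow> a (Suc k) \<le> a k"
  by (simp add: null_coeffs_def decseq_SucD)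

lemma riesz_jac_Suc:
  assumes "small_coeffs a"
  shows "riesz_jac a (Suc N) x = riesz_jac a N x *
    ((1 + a N * psi (3 ^ Suc N * x)) / (1 + a (Suc N) * psi (3 ^ Suc N * x)))"
proof -
  have *: "3 * (p * u) / (q * v) = 3 * p / q * (u / v)" for p q u v :: real by simp
  have "3 ^ N * (3 * x) = 3 ^ Suc N * x" by simp
  then show ?thesis
    unfolding riesz_jac_def riesz_Suc[of a N "3 * x"] riesz_Suc[of a "Suc N" x] by (simp only: *)
qed

lemma riesz_jac_ratio:
  assumes "null_coeffs a"
  shows "\<bar>(1 + a N * psi y) / (1 + a (Suc N) * psi y) - 1\<bar> \<le> 10 / 9 * (a N - a (Suc N))"
proof -
  have p: "9 / 10 \<le> 1 + a (Suc N) * psi y"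
    by (rule riesz_factor_bounds(1)[OF null_coeffs_small[OF assms]])
  have "(1 + a N * psi y) / (1 + a (Suc N) * psi y) - 1
      = (a N - a (Suc N)) * psi y / (1 + a (Suc N) * psi y)"
    using p by (simp add: field_simps)
  moreover have "\<bar>(a N - a (Suc N)) * psi y\<bar> \<le> (a N - a (Suc N)) * 1"
    unfolding abs_mult using null_coeffs_Suc[OF assms, of N] abs_psi_le[of y]
    by (intro mult_mono) auto
  then have "\<bar>(a N - a (Suc N)) * psi y\<bar> / (1 + a (Suc N) * psi y) \<le> (a N - a (Suc N)) / (9 / 10)"
    using p by (intro frac_le) auto
  ultimately show ?thesis using p by (simp add: abs_divide)
qed

text \<open>The leading factor \<open>3 / (1 + a 0 * psi x)\<close> lies between \<open>30/11\<close> and \<open>10/3\<close>, and the deviations of the later ratios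
  from one add up to at most \<open>10/9 * a 0 \<le> 1/9\<close>.\<close>

lemma riesz_jac_bounds:
  assumes "null_coeffs a"
  shows "2 \<le> riesz_jac a N x" "riesz_jac a N x \<le> 4"
proof -
  have s: "small_coeffs a" using assms by (rule null_coeffs_small)
  let ?s = "\<lambda>N. 10 / 9 * (a 0 - a N)"
  have sb: "0 \<le> ?s N" "?s N \<le> 1 / 9" for N
  proof -
    have "a N \<le> a 0" "0 \<le> a N" "a 0 \<le> 1 / 10"
      using assms decseqD[of a 0 N] by (auto simp: null_coeffs_def small_coeffs_def)
    then show "0 \<le> ?s N" "?s N \<le> 1 / 9" by auto
  qed
  have aux1: "1 - (s + b) \<le> (1 - s) * (1 - b)" if "0 \<le> s" "0 \<le> b" for s b :: real
    using mult_nonneg_nonneg[OF that] by (simp add: algebra_simps)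
  have aux2: "(1 + b) * (1 - (s + b)) \<le> 1 - s" if "0 \<le> s" "0 \<le> b" for s b :: real
    using mult_nonneg_nonneg[OF that] mult_nonneg_nonneg[OF that(2) that(2)] by (simp add: algebra_simps)
  have "30 / 11 * (1 - ?s N) \<le> riesz_jac a N x \<and> riesz_jac a N x * (1 - ?s N) \<le> 10 / 3"
  proof (induction N)
    case 0
    show ?case using riesz_factor_bounds[OF s, of 0 x]
      by (simp add: riesz_jac_def riesz_Suc field_simps)
  next
    case (Suc N)
    define r where "r = (1 + a N * psi (3 ^ Suc N * x)) / (1 + a (Suc N) * psi (3 ^ Suc N * x))"
    define b where "b = 10 / 9 * (a N - a (Suc N))"
    have r: "\<bar>r - 1\<bar> \<le> b" unfolding r_def b_def by (rule riesz_jac_ratio[OF assms])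
    have J: "riesz_jac a (Suc N) x = riesz_jac a N x * r"
      unfolding r_def by (rule riesz_jac_Suc[OF s])
    have sS: "?s (Suc N) = ?s N + b" by (simp add: b_def field_simps)
    have b: "0 \<le> b" "b \<le> 1 / 9" using r sb[of "Suc N"] sb[of N] sS by linarith+
    have Jp: "0 \<le> riesz_jac a N x" using order_trans[OF _ conjunct1[OF Suc]] sb[of N] by simp
    have "30 / 11 * (1 - ?s (Suc N)) \<le> 30 / 11 * ((1 - ?s N) * (1 - b))"
      using aux1[OF sb(1)[of N] b(1)] unfolding sS by (intro mult_left_mono) auto
    also have "\<dots> \<le> riesz_jac a N x * r"
      unfolding mult.assoc[symmetric] using Suc r sb[of N] b Jp by (intro mult_mono) auto
    finally have 1: "30 / 11 * (1 - ?s (Suc N)) \<le> riesz_jac a (Suc N) x" by (simp add: J)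
    have "r * (1 - ?s (Suc N)) \<le> (1 + b) * (1 - ?s (Suc N))"
      using r sb[of "Suc N"] by (intro mult_right_mono) auto
    also have "\<dots> \<le> 1 - ?s N"
      unfolding sS by (rule aux2[OF sb(1)[of N] b(1)])
    finally have "riesz_jac a N x * (r * (1 - ?s (Suc N))) \<le> riesz_jac a N x * (1 - ?s N)"
      using Jp by (intro mult_left_mono) auto
    then have 2: "riesz_jac a (Suc N) x * (1 - ?s (Suc N)) \<le> 10 / 3"
      unfolding J mult.assoc using conjunct2[OF Suc] by (rule order_trans)
    from 1 2 show ?case by blast
  qed
  then have 1: "30 / 11 * (1 - ?s N) \<le> riesz_jac a N x" "riesz_jac a N x * (1 - ?s N) \<le> 10 / 3"
    by auto
  show "2 \<le> riesz_jac a N x" using 1(1) sb[of N] by argo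
  have "riesz_jac a N x * (8 / 9) \<le> riesz_jac a N x * (1 - ?s N)"
    using \<open>2 \<le> riesz_jac a N x\<close> sb[of N] by (intro mult_left_mono) auto
  with 1(2) show "riesz_jac a N x \<le> 4" by argo
qed

definition riesz_jac_lim :: "(nat \<Rightarrow> real) \<Rightarrow> real \<Rightarrow> real" where
  "riesz_jac_lim a x = lim (\<lambda>N. riesz_jac a N x)"

lemma riesz_jac_uniform_limit:
  assumes "null_coeffs a"
  shows "uniform_limit UNIV (riesz_jac a) (riesz_jac_lim a) sequentially"
proof -
  let ?f = "\<lambda>N x. riesz_jac a (Suc N) x - riesz_jac a N x"
  have b: "norm (?f N x) \<le> 5 * (a N - a (Suc N))" for N x
  proof -
    let ?r = "(1 + a N * psi (3 ^ Suc N * x)) / (1 + a (Suc N) * psi (3 ^ Suc N * x))"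
    have "?f N x = riesz_jac a N x * (?r - 1)"
      unfolding riesz_jac_Suc[OF null_coeffs_small[OF assms]] by (simp add: algebra_simps)
    then have "norm (?f N x) = \<bar>riesz_jac a N x\<bar> * \<bar>?r - 1\<bar>" by (simp add: abs_mult)
    also have "\<dots> \<le> 4 * (10 / 9 * (a N - a (Suc N)))"
      using riesz_jac_ratio[OF assms, of N "3 ^ Suc N * x"] riesz_jac_bounds[OF assms, of N x]
      by (intro mult_mono) auto
    also have "\<dots> \<le> 5 * (a N - a (Suc N))" using null_coeffs_Suc[OF assms, of N] by simp
    finally show ?thesis .
  qed
  have "summable (\<lambda>N. a N - a (Suc N))"
    using assms by (intro telescope_summable') (auto simp: null_coeffs_def)
  then have u: "uniform_limit UNIV (\<lambda>n x. \<Sum>i<n. ?f i x) (\<lambda>x. \<Sum>i. ?f i x) sequentially"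
    by (intro Weierstrass_m_test[where M = "\<lambda>n. 5 * (a n - a (Suc n))"] b summable_mult)
  have e: "(\<Sum>i<n. ?f i x) = riesz_jac a n x - riesz_jac a 0 x" for n x
    using sum_lessThan_telescope[of "\<lambda>i. riesz_jac a i x" n] by simp
  have "uniform_limit UNIV (\<lambda>n x. (\<Sum>i<n. ?f i x) + riesz_jac a 0 x)
      (\<lambda>x. (\<Sum>i. ?f i x) + riesz_jac a 0 x) sequentially"
    by (intro uniform_limit_intros u)
  then have v: "uniform_limit UNIV (riesz_jac a) (\<lambda>x. (\<Sum>i. ?f i x) + riesz_jac a 0 x) sequentially"
    unfolding e by simp
  have "(\<Sum>i. ?f i x) + riesz_jac a 0 x = riesz_jac_lim a x" for x
    unfolding riesz_jac_lim_def by (rule sym, rule limI, rule tendsto_uniform_limitI[OF v]) auto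
  with v show ?thesis by simp
qed

lemma riesz_jac_lim_bounds:
  assumes "null_coeffs a" shows "2 \<le> riesz_jac_lim a x" "riesz_jac_lim a x \<le> 4"
proof -
  have t: "(\<lambda>N. riesz_jac a N x) \<longlonglongrightarrow> riesz_jac_lim a x"
    using tendsto_uniform_limitI[OF riesz_jac_uniform_limit[OF assms]] by auto
  show "2 \<le> riesz_jac_lim a x"
    by (rule LIMSEQ_le_const[OF t]) (use riesz_jac_bounds[OF assms] in blast)
  show "riesz_jac_lim a x \<le> 4"
    by (rule LIMSEQ_le_const2[OF t]) (use riesz_jac_bounds[OF assms] in blast)
qed

lemma continuous_riesz_jac_lim:
  assumes "null_coeffs a" shows "continuous_on UNIV (riesz_jac_lim a)"
proof (rule uniform_limit_theorem[OF _ riesz_jac_uniform_limit[OF assms]])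
  have "riesz a (Suc N) x \<noteq> 0" for N x
    using riesz_pos[OF null_coeffs_small[OF assms], of "Suc N" x] by simp
  then show "\<forall>\<^sub>F N in sequentially. continuous_on UNIV (riesz_jac a N)"
    unfolding riesz_jac_def
    by (intro always_eventually allI continuous_on_divide continuous_on_mult_left continuous_riesz
          continuous_on_id ballI) blast
qed simp

lemma riesz_jac_lim_periodic: "riesz_jac_lim a (x + 1) = riesz_jac_lim a x"
proof -
  have "riesz a N (3 * (x + 1)) = riesz a N (3 * x)" for N
    using periodic_shift_int[of "riesz a N" "3 * x" 3, OF riesz_periodic] by (simp add: algebra_simps)
  then show ?thesis by (simp add: riesz_jac_lim_def riesz_jac_def riesz_periodic)
qed

lemma riesz_cdf_mean_value:
  assumes "null_coeffs a" "x < y"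
  obtains z where "x < z" "z < y"
    "riesz_cdf a N (3 * y) - riesz_cdf a N (3 * x)
     = riesz_jac a N z * (riesz_cdf a (Suc N) y - riesz_cdf a (Suc N) x)"
proof -
  obtain z where z: "x < z" "z < y"
    "(riesz_cdf a N (3 * y) - riesz_cdf a N (3 * x)) * riesz a (Suc N) z
     = (riesz_cdf a (Suc N) y - riesz_cdf a (Suc N) x) * (3 * riesz a N (3 * z))"
    using GMVT'[of x y "\<lambda>x. riesz_cdf a N (3 * x)" "riesz_cdf a (Suc N)"
        "riesz a (Suc N)" "\<lambda>z. 3 * riesz a N (3 * z)", OF assms(2)
        DERIV_isCont[OF riesz_cdf_triple_deriv] DERIV_isCont[OF riesz_cdf_deriv]
        riesz_cdf_deriv riesz_cdf_triple_deriv] by blast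
  then show ?thesis
    using riesz_pos[OF null_coeffs_small[OF assms(1)], of "Suc N" z]
    by (intro that[of z]) (auto simp: riesz_jac_def field_simps)
qed

text \<open>The generalized mean value theorem gives this with a Jacobian of finite level, and the estimate survives the
  uniform limit, although the limiting distribution function has no derivative to which the mean value theorem
  would apply.\<close>

lemma riesz_lim_jacobian:
  assumes "null_coeffs a" "x \<le> y" and c: "\<And>z. x \<le> z \<Longrightarrow> z \<le> y \<Longrightarrow> \<bar>riesz_jac_lim a z - c\<bar> \<le> e"
  shows "riesz_lim a x \<le> riesz_lim a y"
    "\<bar>(riesz_lim a (3 * y) - riesz_lim a (3 * x)) - c * (riesz_lim a y - riesz_lim a x)\<bar>
     \<le> e * (riesz_lim a y - riesz_lim a x)"
proof -
  have s: "small_coeffs a" by (rule null_coeffs_small[OF assms(1)])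
  have mono: "riesz_cdf a N x \<le> riesz_cdf a N y" for N
    using DERIV_nonneg_imp_nondecreasing[of x y "riesz_cdf a N"] riesz_cdf_deriv riesz_pos[OF s]
      assms(2) less_imp_le by metis
  show "riesz_lim a x \<le> riesz_lim a y"
    by (rule LIMSEQ_le[OF riesz_cdf_tendsto[OF s] riesz_cdf_tendsto[OF s]]) (use mono in blast)
  let ?d = "\<lambda>N. riesz_cdf a (Suc N) y - riesz_cdf a (Suc N) x"
  have S: "(\<lambda>N. riesz_cdf a (Suc N) z) \<longlonglongrightarrow> riesz_lim a z" for z
    by (rule LIMSEQ_Suc[OF riesz_cdf_tendsto[OF s]])
  have "\<bar>(riesz_lim a (3 * y) - riesz_lim a (3 * x)) - c * (riesz_lim a y - riesz_lim a x)\<bar>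
     \<le> (e + h) * (riesz_lim a y - riesz_lim a x)" if "h > 0" for h
  proof (rule tendsto_le[OF sequentially_bot])
    show "(\<lambda>N. (e + h) * ?d N) \<longlonglongrightarrow> (e + h) * (riesz_lim a y - riesz_lim a x)"
      by (intro tendsto_intros S)
    show "(\<lambda>N. \<bar>(riesz_cdf a N (3 * y) - riesz_cdf a N (3 * x)) - c * ?d N\<bar>) \<longlonglongrightarrow>
       \<bar>(riesz_lim a (3 * y) - riesz_lim a (3 * x)) - c * (riesz_lim a y - riesz_lim a x)\<bar>"
      by (intro tendsto_intros S riesz_cdf_tendsto s)
    have "\<forall>\<^sub>F N in sequentially. \<forall>z\<in>UNIV. dist (riesz_jac a N z) (riesz_jac_lim a z) < h"
      using uniform_limitD[OF riesz_jac_uniform_limit[OF assms(1)] that] .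
    then show "\<forall>\<^sub>F N in sequentially.
      \<bar>(riesz_cdf a N (3 * y) - riesz_cdf a N (3 * x)) - c * ?d N\<bar> \<le> (e + h) * ?d N"
    proof eventually_elim
      case (elim N)
      show ?case
      proof (cases "x = y")
        case False
        then obtain z where z: "x < z" "z < y"
          "riesz_cdf a N (3 * y) - riesz_cdf a N (3 * x) = riesz_jac a N z * ?d N"
          using riesz_cdf_mean_value[OF assms(1), of x y N] assms(2) by auto
        have "\<bar>riesz_jac a N z - riesz_jac_lim a z\<bar> < h" using elim by (simp add: dist_real_def)
        with c[of z] z have "\<bar>riesz_jac a N z - c\<bar> \<le> e + h" by linarith
        then have "\<bar>riesz_jac a N z - c\<bar> * ?d N \<le> (e + h) * ?d N"
          using mono[of "Suc N"] by (intro mult_right_mono) auto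
        then show ?thesis
          unfolding z(3) using mono[of "Suc N"] by (simp add: abs_mult left_diff_distrib[symmetric])
      qed simp
    qed
  qed
  moreover have "A \<le> e * d" if "\<And>h. h > 0 \<Longrightarrow> A \<le> (e + h) * d" "d \<ge> 0" for A d :: real
  proof (rule field_le_epsilon)
    fix k :: real assume "k > 0"
    show "A \<le> e * d + k"
    proof -
      have "k / (d + 1) * d \<le> k" using \<open>k > 0\<close> that(2) by (simp add: field_simps)
      then show ?thesis
        using that(1)[of "k / (d + 1)"] that(2) \<open>k > 0\<close> by (simp add: distrib_right)
    qed
  qed
  ultimately show "\<bar>(riesz_lim a (3 * y) - riesz_lim a (3 * x)) - c * (riesz_lim a y - riesz_lim a x)\<bar>
     \<le> e * (riesz_lim a y - riesz_lim a x)"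
    using \<open>riesz_lim a x \<le> riesz_lim a y\<close> by simp
qed

lemma riesz_lim_mono: "null_coeffs a \<Longrightarrow> x \<le> y \<Longrightarrow> riesz_lim a x \<le> riesz_lim a y"
  using riesz_lim_jacobian(1)[of a x y 3 1] riesz_jac_lim_bounds[of a] by (auto simp: abs_le_iff)

lemma riesz_lim_expands:
  assumes "null_coeffs a" "x \<le> y"
  shows "2 * (riesz_lim a y - riesz_lim a x) \<le> riesz_lim a (3 * y) - riesz_lim a (3 * x)"
    "riesz_lim a (3 * y) - riesz_lim a (3 * x) \<le> 4 * (riesz_lim a y - riesz_lim a x)"
  using riesz_lim_jacobian(2)[OF assms, of 3 1] riesz_jac_lim_bounds[OF assms(1)]
  by (auto simp: abs_le_iff algebra_simps)

text \<open>Tripling an interval \<open>k\<close> times multiplies its increment by at most \<open>4 ^ k\<close>. Once the enlarged interval contains a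
  period, its increment is at least one, so the original increment was positive.\<close>

lemma riesz_lim_strict_mono:
  assumes "null_coeffs a" shows "strict_mono (riesz_lim a)"
proof (rule strict_monoI)
  fix x y :: real assume xy: "x < y"
  have it: "riesz_lim a (3 ^ k * y) - riesz_lim a (3 ^ k * x) \<le> 4 ^ k * (riesz_lim a y - riesz_lim a x)" for k
  proof (induction k)
    case (Suc k)
    have "riesz_lim a (3 * (3 ^ k * y)) - riesz_lim a (3 * (3 ^ k * x))
      \<le> 4 * (riesz_lim a (3 ^ k * y) - riesz_lim a (3 ^ k * x))"
      using xy by (intro riesz_lim_expands(2)[OF assms]) auto
    with Suc show ?case by (simp add: mult.assoc)
  qed simp
  obtain k where k: "1 / (y - x) < 3 ^ k" using real_arch_pow[of 3 "1 / (y - x)"] by auto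
  with xy have "3 ^ k * x + 1 \<le> 3 ^ k * y" by (simp add: field_simps)
  then have "riesz_lim a (3 ^ k * x + 1) \<le> riesz_lim a (3 ^ k * y)"
    by (rule riesz_lim_mono[OF assms])
  then have "1 \<le> 4 ^ k * (riesz_lim a y - riesz_lim a x)"
    using it[of k] riesz_lim_shift[OF null_coeffs_small[OF assms], of "3 ^ k * x"] by simp
  then have "0 < 4 ^ k * (riesz_lim a y - riesz_lim a x)" by linarith
  then show "riesz_lim a x < riesz_lim a y" by (simp add: zero_less_mult_iff)
qed

section \<open>Averaging over the fibres of the tripling map\<close>

text \<open>The Lebesgue probability on a fundamental domain of the circle.\<close>

definition ui :: "real measure" where "ui = restrict_space lborel {0..<1}"

lemma space_ui [simp]: "space ui = {0..<1}"
  by (simp add: ui_def space_restrict_space)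

interpretation ui: prob_space ui
  by (rule prob_spaceI) (simp add: ui_def emeasure_restrict_space space_restrict_space)

lemma measurable_ui: "f \<in> borel_measurable borel \<Longrightarrow> f \<in> borel_measurable ui"
  unfolding ui_def by (intro measurable_restrict_space1) simp

lemma integral_ui: "integral\<^sup>L ui f = (\<integral>x. indicator {0..<1} x * f x \<partial>lborel)" for f :: "real \<Rightarrow> real"
  by (simp add: ui_def integral_restrict_space)

lemma AE_ui: "(AE x in ui. P x) \<longleftrightarrow> (AE x in lborel. x \<in> {0..<1} \<longrightarrow> P x)"
  unfolding ui_def by (subst AE_restrict_space_iff) auto

text \<open>A class of integrands that are integrable for all the finite measures below and is closed under the operations
  applied to them.\<close>

definition bdd_borel :: "(real \<Rightarrow> real) \<Rightarrow> bool" where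
  "bdd_borel f \<longleftrightarrow> f \<in> borel_measurable borel \<and> (\<exists>B. \<forall>x. \<bar>f x\<bar> \<le> B)"

lemma bdd_borel_const: "bdd_borel (\<lambda>_. c)"
  by (auto simp: bdd_borel_def)

lemma bdd_borel_add:
  assumes "bdd_borel f" "bdd_borel g" shows "bdd_borel (\<lambda>x. f x + g x)"
proof -
  obtain A B where "\<And>x. \<bar>f x\<bar> \<le> A" "\<And>x. \<bar>g x\<bar> \<le> B" using assms by (auto simp: bdd_borel_def)
  then have "\<bar>f x + g x\<bar> \<le> A + B" for x by (meson abs_triangle_ineq add_mono order_trans)
  then show ?thesis using assms by (auto simp: bdd_borel_def)
qed

lemma bdd_borel_mult:
  assumes "bdd_borel f" "bdd_borel g" shows "bdd_borel (\<lambda>x. f x * g x)"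
proof -
  obtain A B where "\<And>x. \<bar>f x\<bar> \<le> A" "\<And>x. \<bar>g x\<bar> \<le> B" using assms by (auto simp: bdd_borel_def)
  then have "\<bar>f x * g x\<bar> \<le> A * B" for x
    unfolding abs_mult by (intro mult_mono) (auto intro: order_trans[OF abs_ge_zero])
  then show ?thesis using assms by (auto simp: bdd_borel_def)
qed

lemma bdd_borel_diff:
  "bdd_borel f \<Longrightarrow> bdd_borel g \<Longrightarrow> bdd_borel (\<lambda>x. f x - g x)"
  using bdd_borel_add[of f "\<lambda>x. (- 1) * g x"] bdd_borel_mult[OF bdd_borel_const, of g "- 1"] by simp

lemma bdd_borel_sum: "(\<And>i. i \<in> I \<Longrightarrow> bdd_borel (f i)) \<Longrightarrow> bdd_borel (\<lambda>x. \<Sum>i\<in>I. f i x)"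
  by (induction I rule: infinite_finite_induct) (auto intro: bdd_borel_const bdd_borel_add)

lemma bdd_borel_prod: "(\<And>i. i \<in> I \<Longrightarrow> bdd_borel (f i)) \<Longrightarrow> bdd_borel (\<lambda>x. \<Prod>i\<in>I. f i x)"
  by (induction I rule: infinite_finite_induct) (auto intro: bdd_borel_const bdd_borel_mult)

lemma bdd_borel_power: "bdd_borel f \<Longrightarrow> bdd_borel (\<lambda>x. f x ^ n)"
  by (induction n) (auto intro: bdd_borel_const bdd_borel_mult)

lemma bdd_borel_compose: "bdd_borel f \<Longrightarrow> h \<in> borel_measurable borel \<Longrightarrow> bdd_borel (\<lambda>x. f (h x))"
  by (auto simp: bdd_borel_def)

lemma bdd_borel_scale: "bdd_borel f \<Longrightarrow> bdd_borel (\<lambda>x. f (c * x))"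
  by (rule bdd_borel_compose) auto

lemma bdd_borel_psi: "bdd_borel psi"
  unfolding bdd_borel_def psi_def by (auto intro!: exI[of _ 1])

lemma bdd_borel_psi_scale: "bdd_borel (\<lambda>x. psi (c * x))"
  by (rule bdd_borel_scale[OF bdd_borel_psi])

lemma bdd_borel_riesz: "bdd_borel (riesz a N)"
  unfolding riesz_def[abs_def]
  by (intro bdd_borel_prod bdd_borel_add bdd_borel_mult bdd_borel_const bdd_borel_psi_scale)

lemma bdd_borel_riesz_scale: "bdd_borel (\<lambda>x. riesz a N (c * x))"
  by (rule bdd_borel_scale[OF bdd_borel_riesz])

lemmas bdd_borel_intros = bdd_borel_const bdd_borel_add bdd_borel_diff bdd_borel_mult bdd_borel_sum
  bdd_borel_power bdd_borel_psi bdd_borel_psi_scale bdd_borel_riesz bdd_borel_riesz_scale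

lemma integrable_ui: "bdd_borel f \<Longrightarrow> integrable ui f"
  unfolding bdd_borel_def by (metis AE_I2 measurable_ui real_norm_def ui.integrable_const_bound)

text \<open>The transfer operator of \<open>x \<mapsto> 3 * x\<close> for the Lebesgue measure.\<close>

definition tri_avg :: "(real \<Rightarrow> real) \<Rightarrow> real \<Rightarrow> real" where
  "tri_avg f x = (f (x / 3) + f ((x + 1) / 3) + f ((x + 2) / 3)) / 3"

lemma bdd_borel_tri_avg: "bdd_borel f \<Longrightarrow> bdd_borel (tri_avg f)"
proof -
  assume f: "bdd_borel f"
  have "bdd_borel (\<lambda>x. (1/3) * (f (x / 3) + f ((x + 1) / 3) + f ((x + 2) / 3)))"
    by (intro bdd_borel_mult bdd_borel_add bdd_borel_const bdd_borel_compose[OF f]) auto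
  then show ?thesis by (simp add: tri_avg_def[abs_def])
qed

lemma integral_tri_avg:
  assumes "bdd_borel f"
  shows "integral\<^sup>L ui (tri_avg f) = integral\<^sup>L ui f"
proof -
  have int: "integrable lborel (\<lambda>x. indicator {a..<b} x * f x)" for a b
  proof -
    obtain B where "\<And>x. \<bar>f x\<bar> \<le> B" "f \<in> borel_measurable borel" using assms by (auto simp: bdd_borel_def)
    then have "integrable lborel (\<lambda>x. indicator {a..<b} x *\<^sub>R f x)"
      by (intro integrableI_bounded_set_indicator[where B = B]) (cases "a \<le> b"; auto)+
    then show ?thesis by simp
  qed
  have piece: "(\<integral>x. indicator {c / 3..<(c + 1) / 3} x * f x \<partial>lborel) = (\<integral>x. f ((x + c) / 3) \<partial>ui) / 3" for c
  proof -
    have "(\<integral>x. indicator {c / 3..<(c + 1) / 3} x * f x \<partial>lborel)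
      = \<bar>1 / 3\<bar> *\<^sub>R (\<integral>x. indicator {c / 3..<(c + 1) / 3} (c / 3 + 1 / 3 * x) * f (c / 3 + 1 / 3 * x) \<partial>lborel)"
      by (rule lborel_integral_real_affine) simp
    also have "(\<lambda>x. indicator {c / 3..<(c + 1) / 3} (c / 3 + 1 / 3 * x) * f (c / 3 + 1 / 3 * x))
      = (\<lambda>x. indicator {0..<1} x * f ((x + c) / 3))"
      by (auto simp: fun_eq_iff indicator_def field_simps)
    finally show ?thesis by (simp add: integral_ui)
  qed
  have split: "indicator {0..<1} x * f x = indicator {0 / 3..<(0 + 1) / 3} x * f x
     + indicator {1 / 3..<(1 + 1) / 3} x * f x + indicator {2 / 3..<(2 + 1) / 3} x * f x" for x :: real
    by (auto simp: indicator_def)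
  have "integral\<^sup>L ui f = (\<integral>x. f ((x + 0) / 3) \<partial>ui) / 3 + (\<integral>x. f ((x + 1) / 3) \<partial>ui) / 3 + (\<integral>x. f ((x + 2) / 3) \<partial>ui) / 3"
    unfolding piece[symmetric] unfolding integral_ui split using int
    by (simp only: Bochner_Integration.integral_add Bochner_Integration.integrable_add)
  also have "\<dots> = integral\<^sup>L ui (tri_avg f)"
  proof -
    have i: "integrable ui (\<lambda>x. f ((x + c) / 3))" for c
      by (intro integrable_ui bdd_borel_compose[OF assms]) auto
    show ?thesis using i[of 0] i[of 1] i[of 2] by (simp add: tri_avg_def[abs_def] add_divide_distrib)
  qed
  finally show ?thesis by simp
qed

lemma tri_avg_mult_triple:
  assumes "\<And>x. f (x + 1) = f x"
  shows "tri_avg (\<lambda>x. g x * f (3 * x)) x = tri_avg g x * f x"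
proof -
  have "f (x + 1) = f x" "f (x + 2) = f x" using assms[of x] assms[of "x + 1"] by (simp_all add: add.assoc)
  then show ?thesis by (simp add: tri_avg_def algebra_simps add_divide_distrib)
qed

lemma tri_avg_psi: "tri_avg psi x = 0" "tri_avg (\<lambda>x. psi x * psi x) x = 1 / 2"
  using psi_thirds[of x] by (simp_all add: tri_avg_def power2_eq_square)

lemma tri_avg_linear:
  "tri_avg (\<lambda>x. f x + g x) x = tri_avg f x + tri_avg g x"
  "tri_avg (\<lambda>x. c * f x) x = c * tri_avg f x"
  "tri_avg (\<lambda>x. c) x = c"
  by (simp_all add: tri_avg_def field_simps)

lemma tri_avg_bound: "(\<And>x. \<bar>f x\<bar> \<le> B) \<Longrightarrow> \<bar>tri_avg f x\<bar> \<le> B"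
proof -
  assume *: "\<And>x. \<bar>f x\<bar> \<le> B"
  show ?thesis
    using *[of "x / 3"] *[of "(x + 1) / 3"] *[of "(x + 2) / 3"] 
    by (simp add: tri_avg_def abs_le_iff)
qed

section \<open>Correlations for Riesz products\<close>

definition rint :: "(nat \<Rightarrow> real) \<Rightarrow> nat \<Rightarrow> (real \<Rightarrow> real) \<Rightarrow> real" where
  "rint a N f = (\<integral>x. f x * riesz a N x \<partial>ui)"

text \<open>One step of the transfer operator moves the integral from level \<open>Suc N\<close> to level \<open>N\<close>. All
  correlation estimates below are inductions on this identity.\<close>

lemma rint_transfer:
  assumes "bdd_borel g" "bdd_borel f" "\<And>x. f (x + 1) = f x"
  shows "rint a (Suc N) (\<lambda>x. g x * f (3 * x))
    = rint (\<lambda>k. a (Suc k)) N (\<lambda>x. tri_avg (\<lambda>y. g y * (1 + a 0 * psi y)) x * f x)"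
proof -
  let ?R = "riesz (\<lambda>k. a (Suc k)) N"
  let ?A = "\<lambda>y. g y * (1 + a 0 * psi y)"
  have "rint a (Suc N) (\<lambda>x. g x * f (3 * x)) = (\<integral>x. ?A x * (f (3 * x) * ?R (3 * x)) \<partial>ui)"
    by (simp add: rint_def riesz_Suc_shift mult_ac)
  also have "\<dots> = (\<integral>x. tri_avg (\<lambda>x. ?A x * (f (3 * x) * ?R (3 * x))) x \<partial>ui)"
    by (subst integral_tri_avg)
       (intro bdd_borel_intros assms bdd_borel_scale[OF assms(2)], simp)
  also have "tri_avg (\<lambda>x. ?A x * (f (3 * x) * ?R (3 * x))) = (\<lambda>x. tri_avg ?A x * (f x * ?R x))"
    by (rule ext, rule tri_avg_mult_triple) (simp add: assms(3) riesz_periodic)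
  finally show ?thesis by (simp add: rint_def mult_ac)
qed

lemma rint_add: "bdd_borel f \<Longrightarrow> bdd_borel g \<Longrightarrow> rint a N (\<lambda>x. f x + g x) = rint a N f + rint a N g"
  unfolding rint_def distrib_right
  by (intro Bochner_Integration.integral_add integrable_ui bdd_borel_mult bdd_borel_riesz)

lemma rint_cmult: "rint a N (\<lambda>x. c * f x) = c * rint a N f"
  by (simp add: rint_def mult.assoc)

lemma rint_sum:
  "(\<And>i. i \<in> I \<Longrightarrow> bdd_borel (f i)) \<Longrightarrow> rint a N (\<lambda>x. \<Sum>i\<in>I. f i x) = (\<Sum>i\<in>I. rint a N (f i))"
  unfolding rint_def sum_distrib_right
  by (intro Bochner_Integration.integral_sum integrable_ui bdd_borel_mult bdd_borel_riesz)

lemma rint_mono: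
  assumes "small_coeffs a" "bdd_borel f" "bdd_borel g" "\<And>x. f x \<le> g x"
  shows "rint a N f \<le> rint a N g"
  unfolding rint_def using riesz_pos[OF assms(1)] assms
  by (intro integral_mono integrable_ui bdd_borel_mult bdd_borel_riesz mult_right_mono)
     (auto intro: less_imp_le)

lemma rint_one: "rint a N (\<lambda>_. 1) = 1"
proof (induction N arbitrary: a)
  case 0
  show ?case using ui.prob_space by (simp add: rint_def)
next
  case (Suc N)
  have "tri_avg (\<lambda>y. 1 + a 0 * psi y) x = 1" for x by (simp add: tri_avg_linear tri_avg_psi)
  with rint_transfer[of "\<lambda>_. 1" "\<lambda>_. 1" a N] Suc show ?case by (simp add: bdd_borel_const)
qed

lemma rint_const: "rint a N (\<lambda>_. c) = c"
  using rint_cmult[of a N c "\<lambda>_. 1"] by (simp add: rint_one)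

lemma rint_abs_le:
  assumes "small_coeffs a" "bdd_borel f" "\<And>x. \<bar>f x\<bar> \<le> B"
  shows "\<bar>rint a N f\<bar> \<le> B"
proof -
  have "- B \<le> f x" "f x \<le> B" for x using assms(3)[of x] by auto
  then show ?thesis
    using rint_mono[OF assms(1) bdd_borel_const assms(2), of "- B" N]
      rint_mono[OF assms(1,2) bdd_borel_const, of B N] by (auto simp: rint_const abs_le_iff)
qed

lemma rint_triple:
  assumes "bdd_borel f" "\<And>x. f (x + 1) = f x"
  shows "rint a (Suc N) (\<lambda>x. f (3 * x)) = rint (\<lambda>k. a (Suc k)) N f"
proof -
  have "tri_avg (\<lambda>y. 1 + a 0 * psi y) x = 1" for x by (simp add: tri_avg_linear tri_avg_psi)
  with rint_transfer[of "\<lambda>_. 1" f a N] assms show ?thesis by (simp add: bdd_borel_const)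
qed

lemma pow3_periodic:
  fixes f :: "real \<Rightarrow> 'a"
  assumes "\<And>x. f (x + 1) = f x" shows "f (3 ^ k * (x + 1)) = f (3 ^ k * x)"
  using periodic_shift_int[of f "3 ^ k * x" "3 ^ k", OF assms] by (simp add: distrib_left)

lemma pow3_Suc_mult: "3 ^ Suc k * x = 3 ^ k * (3 * x)" for x :: real
  by simp

text \<open>A fluctuation of mean zero over the fibres of \<open>x \<mapsto> 3 * x\<close> is orthogonal to all functions of
  \<open>3 * x\<close> for the Lebesgue measure, and nearly so for the Riesz product: the defect is at most the
  coefficient of the corresponding level.\<close>

lemma rint_correlation:
  assumes "small_coeffs a" "bdd_borel g" "\<And>x. g (x + 1) = g x" "\<And>x. tri_avg g x = 0" "\<And>x. \<bar>g x\<bar> \<le> 1"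
    and "j < k" "j < N"
  shows "\<bar>rint a N (\<lambda>x. g (3 ^ j * x) * g (3 ^ k * x))\<bar> \<le> a j"
  using assms(1,6,7)
proof (induction j arbitrary: a k N)
  case 0
  obtain k' N' where kN: "k = Suc k'" "N = Suc N'" using 0 by (metis not0_implies_Suc not_less_zero)
  have "tri_avg (\<lambda>y. g y * (1 + a 0 * psi y)) x = a 0 * tri_avg (\<lambda>y. g y * psi y) x" for x
    using assms(4)[of x] by (simp add: tri_avg_linear distrib_left mult.left_commute[of _ "a 0"])
  then have "rint a N (\<lambda>x. g (3 ^ 0 * x) * g (3 ^ k * x))
    = rint (\<lambda>k. a (Suc k)) N' (\<lambda>x. a 0 * tri_avg (\<lambda>y. g y * psi y) x * g (3 ^ k' * x))"
    unfolding kN pow3_Suc_mult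
    using rint_transfer[of g "\<lambda>x. g (3 ^ k' * x)" a N'] assms(2,3) pow3_periodic[of g]
    by (simp add: bdd_borel_scale)
  also have "\<bar>\<dots>\<bar> \<le> a 0"
  proof (rule rint_abs_le[OF small_coeffs_shift[OF 0(1)]])
    fix x
    have "\<bar>tri_avg (\<lambda>y. g y * psi y) x\<bar> \<le> 1"
      by (rule tri_avg_bound) (use assms(5) abs_psi_le in \<open>auto simp: abs_mult intro!: mult_le_one\<close>)
    then have "\<bar>a 0 * tri_avg (\<lambda>y. g y * psi y) x * g (3 ^ k' * x)\<bar> \<le> a 0 * 1 * 1"
      unfolding abs_mult using 0(1) assms(5) by (intro mult_mono) (auto simp: small_coeffs_def)
    then show "\<bar>a 0 * tri_avg (\<lambda>y. g y * psi y) x * g (3 ^ k' * x)\<bar> \<le> a 0" by simp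
  qed (intro bdd_borel_intros bdd_borel_tri_avg assms(2) bdd_borel_scale[OF assms(2)])
  finally show ?case .
next
  case (Suc j)
  obtain k' N' where kN: "k = Suc k'" "N = Suc N'"
    using Suc.prems by (metis Suc_lessE)
  have "rint a N (\<lambda>x. g (3 ^ Suc j * x) * g (3 ^ k * x))
    = rint (\<lambda>k. a (Suc k)) N' (\<lambda>x. g (3 ^ j * x) * g (3 ^ k' * x))"
    unfolding kN pow3_Suc_mult
    by (rule rint_triple[where f = "\<lambda>x. g (3 ^ j * x) * g (3 ^ k' * x)"])
       (intro bdd_borel_mult bdd_borel_scale assms(2), simp only: pow3_periodic[of g, OF assms(3)])
  then show ?case
    using Suc.IH[of "\<lambda>k. a (Suc k)" k' N'] Suc.prems small_coeffs_shift kN by auto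
qed

lemma rint_psi: "j < N \<Longrightarrow> rint a N (\<lambda>x. psi (3 ^ j * x)) = a j / 2"
proof (induction j arbitrary: a N)
  case 0
  then obtain N' where N: "N = Suc N'" by (metis not0_implies_Suc not_less_zero)
  have "tri_avg (\<lambda>y. psi y * (1 + a 0 * psi y)) = (\<lambda>_. a 0 / 2)"
    by (simp add: fun_eq_iff distrib_left mult.left_commute[of _ "a 0"] tri_avg_linear tri_avg_psi)
  then show ?case
    using rint_transfer[OF bdd_borel_psi bdd_borel_const[of 1], of a N'] by (simp add: N rint_const)
next
  case (Suc j)
  then obtain N' where N: "N = Suc N'" by (metis Suc_lessE)
  show ?case
    unfolding N pow3_Suc_mult using rint_triple[OF bdd_borel_psi_scale[of "3 ^ j"], of a N'] Suc N
    by (simp add: psi_pow3_periodic)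
qed

lemma rint_psi_psi: "j < k \<Longrightarrow> k < N \<Longrightarrow> rint a N (\<lambda>x. psi (3 ^ j * x) * psi (3 ^ k * x)) = a j * a k / 4"
proof (induction j arbitrary: a k N)
  case 0
  obtain k' N' where kN: "k = Suc k'" "N = Suc N'" using 0 by (metis not0_implies_Suc not_less_zero)
  have "tri_avg (\<lambda>y. psi y * (1 + a 0 * psi y)) = (\<lambda>_. a 0 / 2)"
    by (simp add: fun_eq_iff distrib_left mult.left_commute[of _ "a 0"] tri_avg_linear tri_avg_psi)
  then have "rint a N (\<lambda>x. psi (3 ^ 0 * x) * psi (3 ^ k * x))
     = rint (\<lambda>k. a (Suc k)) N' (\<lambda>x. a 0 / 2 * psi (3 ^ k' * x))"
    unfolding kN pow3_Suc_mult
    using rint_transfer[OF bdd_borel_psi bdd_borel_psi_scale[of "3 ^ k'"], of a N']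
    by (simp add: psi_pow3_periodic)
  also have "\<dots> = a 0 / 2 * (a k / 2)"
    unfolding rint_cmult using rint_psi[of k' N' "\<lambda>k. a (Suc k)"] 0 kN by simp
  finally show ?case by simp
next
  case (Suc j)
  obtain k' N' where kN: "k = Suc k'" "N = Suc N'"
    using Suc.prems by (metis Suc_lessE)
  have "rint a N (\<lambda>x. psi (3 ^ Suc j * x) * psi (3 ^ k * x))
    = rint (\<lambda>k. a (Suc k)) N' (\<lambda>x. psi (3 ^ j * x) * psi (3 ^ k' * x))"
    unfolding kN pow3_Suc_mult
    by (rule rint_triple[where f = "\<lambda>x. psi (3 ^ j * x) * psi (3 ^ k' * x)"])
       (intro bdd_borel_intros, simp only: psi_pow3_periodic)
  then show ?case using Suc kN by auto
qed

lemma rint_square_sum: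
  fixes u :: "nat \<Rightarrow> real \<Rightarrow> real" and n :: nat
  assumes "\<And>k. bdd_borel (u k)" "\<And>j k. j < k \<Longrightarrow> k < n \<Longrightarrow> rint a N (\<lambda>x. u j x * u k x) \<le> c j k"
    "\<And>k. k < n \<Longrightarrow> rint a N (\<lambda>x. (u k x)\<^sup>2) \<le> d k"
  shows "rint a N (\<lambda>x. (\<Sum>k<n. u k x)\<^sup>2) \<le> (\<Sum>k<n. d k + 2 * (\<Sum>j<k. c j k))"
  using assms(2-)
proof (induction n)
  case 0
  show ?case using rint_const[of a N 0] by simp
next
  case (Suc n)
  let ?S = "\<lambda>x. \<Sum>k<n. u k x"
  have b: "bdd_borel ?S" "bdd_borel (u n)" by (intro bdd_borel_sum assms(1))+
  have "rint a N (\<lambda>x. (\<Sum>k<Suc n. u k x)\<^sup>2)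
      = rint a N (\<lambda>x. (?S x)\<^sup>2 + ((u n x)\<^sup>2 + 2 * (\<Sum>j<n. u j x * u n x)))"
    by (simp add: power2_eq_square algebra_simps sum_distrib_right sum_distrib_left)
  also have "\<dots> = rint a N (\<lambda>x. (?S x)\<^sup>2) + (rint a N (\<lambda>x. (u n x)\<^sup>2)
      + 2 * (\<Sum>j<n. rint a N (\<lambda>x. u j x * u n x)))"
    using b assms(1)
    by (simp add: rint_add rint_cmult rint_sum bdd_borel_intros)
  also have "\<dots> \<le> (\<Sum>k<n. d k + 2 * (\<Sum>j<k. c j k)) + (d n + 2 * (\<Sum>j<n. c j n))"
    using Suc by (intro add_mono mult_left_mono sum_mono) auto
  finally show ?case by simp
qed

text \<open>The correlation of the terms \<open>j < k\<close> is at most \<open>a j\<close>, whatever \<open>k\<close> is; with coefficients tending to zero the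
  second moment is therefore of smaller order than \<open>n\<^sup>2\<close>.\<close>

lemma rint_birkhoff_square:
  assumes "small_coeffs a" "bdd_borel g" "\<And>x. g (x + 1) = g x" "\<And>x. tri_avg g x = 0" "\<And>x. \<bar>g x\<bar> \<le> 1"
    and "n \<le> N"
  shows "rint a N (\<lambda>x. (\<Sum>k<n. g (3 ^ k * x))\<^sup>2) \<le> (\<Sum>k<n. 1 + 2 * (\<Sum>j<k. a j))"
proof (rule rint_square_sum)
  show "rint a N (\<lambda>x. g (3 ^ j * x) * g (3 ^ k * x)) \<le> a j" if "j < k" "k < n" for j k
    using rint_correlation[OF assms(1-5) that(1), of N] that assms(6) by simp
  show "rint a N (\<lambda>x. (g (3 ^ k * x))\<^sup>2) \<le> 1" for k
  proof -
    have "\<bar>(g (3 ^ k * x))\<^sup>2\<bar> \<le> 1" for x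
      using assms(5)[of "3 ^ k * x"] by (simp add: abs_square_le_1)
    then show ?thesis
      using rint_abs_le[of a "\<lambda>x. (g (3 ^ k * x))\<^sup>2" 1 N] assms(1)
        bdd_borel_power[OF bdd_borel_scale[OF assms(2)], of "3 ^ k" 2] by (simp add: abs_le_iff)
  qed
qed (intro bdd_borel_scale assms(2))

text \<open>The centred functions \<open>psi (3 ^ k * x) - a k / 2\<close> are exactly orthogonal for the Riesz product, and for
  coefficients zero this is the orthogonality of the cosines.\<close>

lemma rint_psi_square:
  assumes "small_coeffs a" "n \<le> N"
  shows "rint a N (\<lambda>x. (\<Sum>k<n. w k * (psi (3 ^ k * x) - a k / 2))\<^sup>2) \<le> 2 * (\<Sum>k<n. (w k)\<^sup>2)"
proof -
  let ?u = "\<lambda>k x. w k * (psi (3 ^ k * x) - a k / 2)"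
  have L: "rint a N (\<lambda>x. A * (p x * q x + (B * p x + (C * q x + D))))
      = A * (rint a N (\<lambda>x. p x * q x) + (B * rint a N p + (C * rint a N q + D)))"
    if "bdd_borel p" "bdd_borel q" for A B C D p q
    using that by (simp add: rint_cmult rint_add bdd_borel_intros rint_const)
  have "rint a N (\<lambda>x. (\<Sum>k<n. ?u k x)\<^sup>2) \<le> (\<Sum>k<n. 2 * (w k)\<^sup>2 + 2 * (\<Sum>j<k. 0))"
  proof (rule rint_square_sum)
    show "bdd_borel (?u k)" for k by (intro bdd_borel_intros)
    show "rint a N (\<lambda>x. ?u j x * ?u k x) \<le> 0" if "j < k" "k < n" for j k
    proof -
      have "rint a N (\<lambda>x. ?u j x * ?u k x) = rint a N (\<lambda>x. w j * w k * (psi (3 ^ j * x) * psi (3 ^ k * x)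
          + ((- a k / 2) * psi (3 ^ j * x) + ((- a j / 2) * psi (3 ^ k * x) + a j * a k / 4))))"
        by (simp add: algebra_simps)
      also have "\<dots> = w j * w k * (a j * a k / 4 + ((- a k / 2) * (a j / 2) + ((- a j / 2) * (a k / 2) + a j * a k / 4)))"
        using that assms(2) by (subst L) (auto intro: bdd_borel_intros simp: rint_psi rint_psi_psi)
      also have "\<dots> = 0" by (simp add: algebra_simps)
      finally show ?thesis by simp
    qed
    show "rint a N (\<lambda>x. (?u k x)\<^sup>2) \<le> 2 * (w k)\<^sup>2" for k
    proof -
      have "\<bar>(?u k x)\<^sup>2\<bar> \<le> 2 * (w k)\<^sup>2" for x
      proof -
        have "\<bar>psi (3 ^ k * x) - a k / 2\<bar> \<le> 21 / 20"
        proof -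
          have "0 \<le> a k" "a k \<le> 1 / 10" using assms(1) by (auto simp: small_coeffs_def)
          with abs_psi_le[of "3 ^ k * x"] show ?thesis by linarith
        qed
        then have "(psi (3 ^ k * x) - a k / 2)\<^sup>2 \<le> (21 / 20)\<^sup>2" by (rule power2_le_iff_abs_le[THEN iffD2, rotated]) simp
        also have "\<dots> \<le> 2" by (simp add: power2_eq_square)
        finally have "(w k)\<^sup>2 * (psi (3 ^ k * x) - a k / 2)\<^sup>2 \<le> (w k)\<^sup>2 * 2" by (intro mult_left_mono) auto
        then show ?thesis by (simp add: power_mult_distrib mult.commute)
      qed
      moreover have "bdd_borel (\<lambda>x. (?u k x)\<^sup>2)" by (intro bdd_borel_intros)
      ultimately show ?thesis using rint_abs_le[of a "\<lambda>x. (?u k x)\<^sup>2" "2 * (w k)\<^sup>2" N] assms(1) by auto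
    qed
  qed
  then show ?thesis by (simp add: sum_distrib_left)
qed

section \<open>Inverting the distribution functions\<close>

text \<open>Lifts to the line of orientation preserving homeomorphisms of the circle, normalized at \<open>0\<close>. The inverse of the
  distribution function of a measure on the circle pushes the Lebesgue measure forward to that measure.\<close>

definition circle_lift :: "(real \<Rightarrow> real) \<Rightarrow> bool" where
  "circle_lift h \<longleftrightarrow> strict_mono h \<and> continuous_on UNIV h \<and> h 0 = 0 \<and> (\<forall>x. h (x + 1) = h x + 1)"

lemma circle_lift_int: "circle_lift h \<Longrightarrow> h (x + of_int k) = h x + of_int k"
  using lift_shift_int[of h 1] by (simp add: circle_lift_def)

lemma circle_lift_bij:
  assumes "circle_lift h" shows "bij h"
proof (rule bijI)
  show "inj h" using assms strict_mono_imp_inj_on by (auto simp: circle_lift_def)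
  have "\<exists>x. h x = y" for y
  proof -
    let ?k = "\<lfloor>y\<rfloor>"
    have "h (of_int ?k) = of_int ?k" "h (of_int (?k + 1)) = of_int (?k + 1)"
      using circle_lift_int[OF assms, of 0 ?k] circle_lift_int[OF assms, of 0 "?k + 1"] assms
      by (simp_all add: circle_lift_def)
    then have "\<exists>x. of_int ?k \<le> x \<and> x \<le> of_int (?k + 1) \<and> h x = y"
      using assms by (intro IVT') (auto simp: circle_lift_def intro: continuous_on_subset)
    then show ?thesis by blast
  qed
  then show "surj h" by (metis surjI)
qed

lemma circle_lift_inv:
  assumes "circle_lift h" shows "h (inv h t) = t" "inv h (h x) = x"
  using circle_lift_bij[OF assms] by (simp_all add: bij_is_surj surj_f_inv_f bij_is_inj)

lemma circle_lift_inv_lift: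
  assumes "circle_lift h" shows "circle_lift (inv h)"
proof -
  have sm: "strict_mono h" using assms by (simp add: circle_lift_def)
  have s: "strict_mono (inv h)"
  proof (rule strict_monoI)
    fix x y :: real assume "x < y"
    then show "inv h x < inv h y"
      using strict_mono_less[OF sm, of "inv h x" "inv h y"] circle_lift_inv(1)[OF assms] by simp
  qed
  moreover have "surj (inv h)" using circle_lift_bij[OF assms] by (simp add: bij_is_inj inj_imp_surj_inv)
  then have "continuous_on UNIV (inv h)"
    by (intro continuous_onI_mono) (auto simp: strict_mono_less_eq[OF s])
  moreover have "inv h 0 = 0" using circle_lift_inv(2)[OF assms, of 0] assms by (simp add: circle_lift_def)
  moreover have "inv h (x + 1) = inv h x + 1" for x
    using circle_lift_inv(2)[OF assms, of "inv h x + 1"] circle_lift_inv(1)[OF assms, of x] assms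
    by (simp add: circle_lift_def)
  ultimately show ?thesis by (simp add: circle_lift_def)
qed

lemma circle_lift_riesz_cdf: "small_coeffs a \<Longrightarrow> circle_lift (riesz_cdf a N)"
  unfolding circle_lift_def
  by (auto simp: riesz_cdf_shift intro!: strict_monoI DERIV_pos_imp_increasing[of _ _ "riesz_cdf a N"]
      DERIV_continuous_on exI has_field_derivative_at_within[OF riesz_cdf_deriv] riesz_cdf_deriv riesz_pos)

lemma circle_lift_riesz_lim: "null_coeffs a \<Longrightarrow> circle_lift (riesz_lim a)"
  by (simp add: circle_lift_def riesz_lim_strict_mono riesz_lim_0 riesz_lim_shift continuous_riesz_lim null_coeffs_small)

text \<open>The value \<open>inv (h n) t\<close> is trapped between \<open>x - e\<close> and \<open>x + e\<close> as soon as \<open>t\<close> lies strictly between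
  the values of \<open>h n\<close> at these two points.\<close>

lemma circle_lift_inv_tendsto:
  assumes "\<And>n. circle_lift (h n)" "circle_lift g" "\<And>x. (\<lambda>n. h n x) \<longlonglongrightarrow> g x"
  shows "(\<lambda>n. inv (h n) t) \<longlonglongrightarrow> inv g t"
proof (rule LIMSEQ_I)
  fix e :: real assume e: "e > 0"
  let ?x = "inv g t"
  have sg: "strict_mono g" using assms(2) by (simp add: circle_lift_def)
  have "g (?x - e) < t" "t < g (?x + e)"
    using strict_mono_less[OF sg, of "?x - e" ?x] strict_mono_less[OF sg, of ?x "?x + e"] e
    by (simp_all add: circle_lift_inv[OF assms(2)])
  then have "\<forall>\<^sub>F n in sequentially. h n (?x - e) < t \<and> t < h n (?x + e)"
    by (intro eventually_conj order_tendstoD[OF assms(3)])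
  then obtain N where N: "\<And>n. n \<ge> N \<Longrightarrow> h n (?x - e) < t \<and> t < h n (?x + e)"
    by (auto simp: eventually_sequentially)
  have "norm (inv (h n) t - ?x) < e" if "n \<ge> N" for n
  proof -
    have s: "strict_mono (h n)" using assms(1) by (simp add: circle_lift_def)
    have "h n (?x - e) < h n (inv (h n) t)" "h n (inv (h n) t) < h n (?x + e)"
      using N[OF that] by (simp_all add: circle_lift_inv[OF assms(1)])
    then show ?thesis using strict_mono_less[OF s] by (auto simp: abs_less_iff)
  qed
  then show "\<exists>no. \<forall>n\<ge>no. norm (inv (h n) t - ?x) < e" by blast
qed

lemma borel_measurable_circle_lift: "circle_lift h \<Longrightarrow> h \<in> borel_measurable borel"
  by (intro borel_measurable_continuous_onI) (simp add: circle_lift_def)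

text \<open>Functions continuous off the rationals: the ternary step functions and their combinations
  with the cosines are of this kind, and weak convergence of the Riesz products applies to them.\<close>

definition irr_cont :: "(real \<Rightarrow> real) \<Rightarrow> bool" where
  "irr_cont f \<longleftrightarrow> (\<forall>x. x \<notin> \<rat> \<longrightarrow> isCont f x)"

lemma integral_riesz_cdf:
  assumes "small_coeffs a" "bdd_borel f"
  shows "(\<integral>t. f (inv (riesz_cdf a N) t) \<partial>ui) = rint a N f"
proof -
  let ?h = "riesz_cdf a N"
  have cl: "circle_lift ?h" by (rule circle_lift_riesz_cdf[OF assms(1)])
  have h1: "?h 1 = 1" using riesz_cdf_shift[of a N 0] by simp
  have bb: "bdd_borel (\<lambda>t. f (inv ?h t))"
    by (rule bdd_borel_compose[OF assms(2) borel_measurable_circle_lift[OF circle_lift_inv_lift[OF cl]]])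
  have ae: "AE x in lborel. x \<noteq> (1::real)" by (rule AE_lborel_singleton)
  have closed: "(\<integral>x. indicator {0..<1} x * u x \<partial>lborel) = (\<integral>x. u x * indicator {0..1} x \<partial>lborel)"
    if "u \<in> borel_measurable borel" for u :: "real \<Rightarrow> real"
    by (rule integral_cong_AE) (use ae that in \<open>auto simp: indicator_def elim!: eventually_mono\<close>)
  obtain B where B: "\<And>x. \<bar>f (inv ?h x)\<bar> \<le> B" using bb by (auto simp: bdd_borel_def)
  have "set_integrable lborel {?h 0..?h 1} (\<lambda>t. f (inv ?h t))"
    unfolding set_integrable_def using bb B h1
    by (intro integrableI_bounded_set_indicator[where B = B]) (auto simp: bdd_borel_def)
  from integral_substitution(2)[of ?h 0 1 "\<lambda>t. f (inv ?h t)" "riesz a N", OF this] h1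
  have "(\<integral>x. f (inv ?h x) * indicator {0..1} x \<partial>lborel)
     = (\<integral>x. f (inv ?h (?h x)) * riesz a N x * indicator {0..1} x \<partial>lborel)"
    using riesz_cdf_deriv riesz_pos[OF assms(1), THEN less_imp_le] continuous_riesz[OF continuous_on_id]
    by simp
  then show ?thesis
    unfolding rint_def integral_ui
    using closed[of "\<lambda>t. f (inv ?h t)"] closed[of "\<lambda>x. f x * riesz a N x"] bb
      bdd_borel_mult[OF assms(2) bdd_borel_riesz, of a N]
    by (simp add: circle_lift_inv[OF cl] bdd_borel_def)
qed

text \<open>All the integrals are read on one probability space through the inverses of the distribution functions, where weak
  convergence becomes pointwise convergence. The integrand is continuous at the limit unless that limit is
  rational, which happens for countably many \<open>t\<close> only.\<close>

lemma rint_tendsto: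
  assumes "null_coeffs a" "bdd_borel f" "irr_cont f"
  shows "(\<lambda>N. rint a N f) \<longlonglongrightarrow> (\<integral>t. f (inv (riesz_lim a) t) \<partial>ui)"
proof -
  have s: "small_coeffs a" by (rule null_coeffs_small[OF assms(1)])
  have L: "circle_lift (riesz_lim a)" by (rule circle_lift_riesz_lim[OF assms(1)])
  have m: "(\<lambda>t. f (inv h t)) \<in> borel_measurable ui" if "circle_lift h" for h
    using bdd_borel_compose[OF assms(2) borel_measurable_circle_lift[OF circle_lift_inv_lift[OF that]]]
    by (intro measurable_ui) (simp add: bdd_borel_def)
  obtain B where B: "\<And>x. \<bar>f x\<bar> \<le> B" using assms(2) by (auto simp: bdd_borel_def)
  have "countable (riesz_lim a ` \<rat>)" by (simp add: countable_rat)
  then have "AE t in lborel. t \<notin> riesz_lim a ` \<rat>" by (intro AE_not_in countable_imp_null_set_lborel)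
  then have irr: "AE t in ui. inv (riesz_lim a) t \<notin> \<rat>"
    unfolding AE_ui by eventually_elim (metis circle_lift_inv(1)[OF L] imageI)
  have "(\<lambda>N. \<integral>t. f (inv (riesz_cdf a N) t) \<partial>ui) \<longlonglongrightarrow> (\<integral>t. f (inv (riesz_lim a) t) \<partial>ui)"
  proof (rule integral_dominated_convergence[where w = "\<lambda>_. B"])
    show "AE t in ui. (\<lambda>N. f (inv (riesz_cdf a N) t)) \<longlonglongrightarrow> f (inv (riesz_lim a) t)"
      using irr
    proof eventually_elim
      case (elim t)
      then have "isCont f (inv (riesz_lim a) t)" using assms(3) by (simp add: irr_cont_def)
      then show ?case
        by (rule isCont_tendsto_compose)
           (rule circle_lift_inv_tendsto[OF circle_lift_riesz_cdf[OF s] L riesz_cdf_tendsto[OF s]])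
    qed
  qed (use m[OF L] m[OF circle_lift_riesz_cdf[OF s]] B in auto)
  then show ?thesis by (simp only: integral_riesz_cdf[OF s assms(2)])
qed

lemma integral_riesz_lim_le:
  assumes "null_coeffs a" "bdd_borel f" "irr_cont f" "\<And>N. N \<ge> M \<Longrightarrow> rint a N f \<le> c"
  shows "(\<integral>t. f (inv (riesz_lim a) t) \<partial>ui) \<le> c"
  by (rule LIMSEQ_le_const2[OF rint_tendsto[OF assms(1-3)]]) (use assms(4) in blast)

lemma irr_cont_sum: "(\<And>i. i \<in> I \<Longrightarrow> irr_cont (f i)) \<Longrightarrow> irr_cont (\<lambda>x. \<Sum>i\<in>I. f i x)"
  by (auto simp: irr_cont_def intro!: continuous_intros)

lemma irr_cont_power: "irr_cont f \<Longrightarrow> irr_cont (\<lambda>x. f x ^ n)"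
  by (auto simp: irr_cont_def intro!: continuous_intros)

lemma irr_cont_scale:
  assumes "irr_cont f" shows "irr_cont (\<lambda>x. f (3 ^ k * x))"
  unfolding irr_cont_def
proof (intro allI impI)
  fix x :: real assume "x \<notin> \<rat>"
  then have "3 ^ k * x \<notin> \<rat>" using Rats_divide[of "3 ^ k * x" "3 ^ k"] by auto
  then have "isCont f (3 ^ k * x)" using assms by (simp add: irr_cont_def)
  then show "isCont (\<lambda>x. f (3 ^ k * x)) x"
    by (rule isCont_o2[where f = "\<lambda>x. 3 ^ k * x" and g = f, rotated])
       (intro continuous_mult continuous_const continuous_ident)
qed

lemma irr_cont_psi: "irr_cont (\<lambda>x. w * (psi (3 ^ k * x) - c))"
  unfolding irr_cont_def psi_def by (auto intro!: continuous_intros)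

lemma irr_cont_floor: "irr_cont (\<lambda>x. q \<lfloor>3 ^ s * x\<rfloor>)" for q :: "int \<Rightarrow> real"
  unfolding irr_cont_def
proof (intro allI impI)
  fix x :: real assume "x \<notin> \<rat>"
  then have "3 ^ s * x \<notin> \<int>" using Rats_divide[of "3 ^ s * x" "3 ^ s"] Ints_subset_Rats by auto
  moreover have "((\<lambda>y. 3 ^ s * y) \<longlongrightarrow> 3 ^ s * x) (at x)" by (intro tendsto_intros)
  ultimately have "\<forall>\<^sub>F y in at x. \<lfloor>3 ^ s * y\<rfloor> = \<lfloor>3 ^ s * x\<rfloor>" by (intro eventually_floor_eq)
  then have "\<forall>\<^sub>F y in at x. q \<lfloor>3 ^ s * y\<rfloor> = q \<lfloor>3 ^ s * x\<rfloor>" by eventually_elim simp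
  then show "isCont (\<lambda>y. q \<lfloor>3 ^ s * y\<rfloor>) x" unfolding isCont_def by (rule tendsto_eventually)
qed

section \<open>The singular measure and its typical orbits\<close>

text \<open>The decay \<open>k powr (- 1 / 2)\<close> is borderline: the sum of the squares diverges, which makes the Riesz product
  singular, while the amplitudes tend to zero, which makes the Jacobian continuous and the orbits
  equidistributed.\<close>

definition amp :: "nat \<Rightarrow> real" where "amp k = 1 / (10 * sqrt (real k + 1))"

lemma amp_tendsto_0: "amp \<longlonglongrightarrow> 0"
proof -
  have r: "filterlim (\<lambda>k. real (Suc k)) at_top sequentially"
    by (rule filterlim_compose[OF filterlim_real_sequentially filterlim_Suc])
  have "filterlim (\<lambda>k. sqrt (real (Suc k))) at_top sequentially"
    by (rule filterlim_compose[OF sqrt_at_top r])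
  then have "(\<lambda>k. (1 / 10) / sqrt (real (Suc k))) \<longlonglongrightarrow> 0"
    by (intro tendsto_divide_0[OF tendsto_const] filterlim_at_top_imp_at_infinity)
  then show ?thesis by (simp add: amp_def[abs_def] add.commute)
qed

lemma amp_bounds: "0 \<le> amp k" "amp k \<le> 1 / 10"
  by (simp_all add: amp_def divide_le_eq)

lemma decseq_amp: "decseq amp"
  by (rule decseq_SucI) (unfold amp_def, rule divide_left_mono, simp_all)

lemma null_coeffs_amp: "null_coeffs amp"
  unfolding null_coeffs_def small_coeffs_def by (intro conjI allI amp_bounds decseq_amp amp_tendsto_0)

text \<open>The singular Riesz product enters through its distribution function and the inverse of that function alone:
  statements about almost every point for the singular measure are statements about \<open>amp_quantile t\<close> for
  almost every \<open>t\<close>.\<close>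

definition amp_cdf :: "real \<Rightarrow> real" where "amp_cdf = riesz_lim amp"

definition amp_quantile :: "real \<Rightarrow> real" where "amp_quantile = inv amp_cdf"

lemma circle_lift_amp_cdf: "circle_lift amp_cdf"
  unfolding amp_cdf_def by (rule circle_lift_riesz_lim[OF null_coeffs_amp])

lemma AE_tendsto_0_of_summable:
  fixes f :: "nat \<Rightarrow> real \<Rightarrow> real"
  assumes "\<And>i. bdd_borel (f i)" "\<And>i x. 0 \<le> f i x" "\<And>i. integral\<^sup>L ui (f i) \<le> c i" "summable c"
  shows "AE x in ui. (\<lambda>i. f i x) \<longlonglongrightarrow> 0"
proof -
  have m: "f i \<in> borel_measurable ui" for i
    using assms(1) by (intro measurable_ui) (simp add: bdd_borel_def)
  have c0: "0 \<le> c i" for i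
    using assms(3)[of i] Bochner_Integration.integral_nonneg[of ui "f i"] assms(2) by (meson order_trans)
  have "(\<integral>\<^sup>+x. (\<Sum>i. ennreal (f i x)) \<partial>ui) = (\<Sum>i. \<integral>\<^sup>+x. ennreal (f i x) \<partial>ui)"
    by (rule nn_integral_suminf) (use m in measurable)
  also have "\<dots> = (\<Sum>i. ennreal (integral\<^sup>L ui (f i)))"
    by (intro suminf_cong nn_integral_eq_integral integrable_ui assms(1)) (use assms(2) in auto)
  also have "\<dots> \<le> (\<Sum>i. ennreal (c i))"
    by (intro suminf_le ennreal_leI assms(3)) auto
  also have "\<dots> = ennreal (suminf c)" by (rule suminf_ennreal2[OF c0 assms(4)])
  finally have "(\<integral>\<^sup>+x. (\<Sum>i. ennreal (f i x)) \<partial>ui) \<noteq> \<infinity>" by (auto simp: top_unique)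
  then have "AE x in ui. (\<Sum>i. ennreal (f i x)) \<noteq> \<infinity>"
    by (intro nn_integral_PInf_AE) (use m in measurable)
  then show ?thesis
  proof eventually_elim
    case (elim x)
    then have "summable (\<lambda>i. f i x)" by (intro summable_suminf_not_top assms(2)) simp
    then show ?case by (rule summable_LIMSEQ_zero)
  qed
qed

lemma sum_amp_square: "\<exists>n. r \<le> (\<Sum>k<n. (amp k)\<^sup>2)"
proof (rule ccontr)
  assume "\<not> ?thesis"
  then have b: "(\<Sum>k<n. (amp k)\<^sup>2) \<le> r" for n by (meson le_cases)
  have "summable (\<lambda>k. (amp k)\<^sup>2)" by (rule summableI_nonneg_bounded[where x = r]) (use b in auto)
  then have "summable (\<lambda>k. 100 * (amp k)\<^sup>2)" by (rule summable_mult)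
  moreover have *: "(\<lambda>k. 100 * (amp k)\<^sup>2) = (\<lambda>k. inverse (real (Suc k)))"
  proof
    fix k :: nat
    have "100 * (1 / (10 * sqrt r))\<^sup>2 = inverse r" if "r > 0" for r
      using that by (simp add: power_divide power_mult_distrib inverse_eq_divide)
    from this[of "real k + 1"] show "100 * (amp k)\<^sup>2 = inverse (real (Suc k))"
      by (simp add: amp_def add.commute)
  qed
  ultimately have "summable (\<lambda>k. inverse (real (Suc k)))" unfolding * by -
  then have "summable (\<lambda>k. inverse (real k))"
    by (rule summable_Suc_iff[of "\<lambda>k. inverse (real k)", THEN iffD1])
  then show False using not_summable_harmonic[where 'a = real] by blast
qed

text \<open>The normalized sums \<open>\<Sum>k<n. amp k * psi (3 ^ k * x) / (\<Sum>k<n. (amp k)\<^sup>2)\<close> tend, along a subsequence, to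
  \<open>1/2\<close> for the Riesz product and to \<open>0\<close> for the Lebesgue measure, so the two measures live on
  disjoint sets.\<close>

lemma amp_cdf_singular:
  obtains Z where "Z \<in> null_sets lborel" "AE x in ui. amp_cdf x \<in> Z"
proof -
  have "\<forall>i. \<exists>n. 2 ^ i \<le> (\<Sum>k<n. (amp k)\<^sup>2)" by (intro allI sum_amp_square)
  from choice[OF this] obtain n where n: "\<And>i. 2 ^ i \<le> (\<Sum>k<n i. (amp k)\<^sup>2)" by blast
  define A where "A i = (\<Sum>k<n i. (amp k)\<^sup>2)" for i
  define Y where "Y i x = (\<Sum>k<n i. amp k * psi (3 ^ k * x)) / A i" for i x
  have A: "A i \<ge> 2 ^ i" "A i > 0" for i
    using n[of i] by (auto simp: A_def intro: less_le_trans[of 0 "2 ^ i"])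
  have bY: "bdd_borel (\<lambda>x. (Y i x - c)\<^sup>2)" for i c
  proof -
    have "bdd_borel (\<lambda>x. ((1 / A i) * (\<Sum>k<n i. amp k * psi (3 ^ k * x)) - c)\<^sup>2)"
      by (intro bdd_borel_intros)
    then show ?thesis by (simp add: Y_def)
  qed
  have center: "(\<Sum>k<n i. amp k * (psi (3 ^ k * x) - b * amp k / 2))\<^sup>2 / (A i)\<^sup>2 = (Y i x - b / 2)\<^sup>2" for x b i
  proof -
    have "(\<Sum>k<n i. amp k * (psi (3 ^ k * x) - b * amp k / 2))
        = (\<Sum>k<n i. amp k * psi (3 ^ k * x)) - b / 2 * A i"
    proof -
      have "amp k * (psi (3 ^ k * x) - b * amp k / 2) = amp k * psi (3 ^ k * x) - b / 2 * (amp k)\<^sup>2" for k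
        by (simp add: power2_eq_square algebra_simps)
      then show ?thesis by (simp only: A_def sum_subtractf sum_distrib_left)
    qed
    then show ?thesis
      using A(2)[of i] by (simp add: Y_def power_divide[symmetric] diff_divide_distrib)
  qed
  have small: "small_coeffs (\<lambda>_. 0)" "small_coeffs amp"
    using null_coeffs_small[OF null_coeffs_amp] by (auto simp: small_coeffs_def)
  have div: "2 * A i / (A i)\<^sup>2 \<le> 2 * (1 / 2) ^ i" for i
  proof -
    have "2 * A i / (A i)\<^sup>2 = 2 / A i" using A(2)[of i] by (simp add: power2_eq_square)
    also have "\<dots> \<le> 2 / 2 ^ i" using A[of i] by (intro divide_left_mono) auto
    finally show ?thesis by (simp add: power_one_over)
  qed
  have leb: "(\<integral>x. (Y i x - 0)\<^sup>2 \<partial>ui) \<le> 2 * (1 / 2) ^ i" for i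
  proof -
    have "rint (\<lambda>_. 0) (n i) (\<lambda>x. (\<Sum>k<n i. amp k * (psi (3 ^ k * x) - 0 / 2))\<^sup>2) \<le> 2 * A i"
      unfolding A_def by (rule rint_psi_square[OF small(1) order_refl])
    then have "1 / (A i)\<^sup>2 * rint (\<lambda>_. 0) (n i) (\<lambda>x. (\<Sum>k<n i. amp k * psi (3 ^ k * x))\<^sup>2) \<le> 1 / (A i)\<^sup>2 * (2 * A i)"
      by (intro mult_left_mono) auto
    moreover have "(Y i x)\<^sup>2 = 1 / (A i)\<^sup>2 * (\<Sum>k<n i. amp k * psi (3 ^ k * x))\<^sup>2" for x
      using center[of x 0 i] by simp
    ultimately have "(\<integral>x. (Y i x)\<^sup>2 \<partial>ui) \<le> 2 * A i / (A i)\<^sup>2" by (simp add: rint_def riesz_def)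
    with div[of i] show ?thesis by simp
  qed
  have sing: "(\<integral>t. (Y i (amp_quantile t) - 1 / 2)\<^sup>2 \<partial>ui) \<le> 2 * (1 / 2) ^ i" for i
  proof -
    let ?f = "\<lambda>x. (\<Sum>k<n i. amp k * (psi (3 ^ k * x) - amp k / 2))\<^sup>2"
    have "(\<integral>t. ?f (amp_quantile t) \<partial>ui) \<le> 2 * A i"
      unfolding amp_quantile_def amp_cdf_def A_def
    proof (rule integral_riesz_lim_le[where M = "n i" and f = ?f])
      show "bdd_borel ?f" by (intro bdd_borel_intros)
      show "irr_cont ?f" by (intro irr_cont_power irr_cont_sum irr_cont_psi)
      show "rint amp N ?f \<le> 2 * (\<Sum>k<n i. (amp k)\<^sup>2)" if "N \<ge> n i" for N
        using rint_psi_square[OF small(2) that] .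
    qed (rule null_coeffs_amp)
    then have "1 / (A i)\<^sup>2 * (\<integral>t. ?f (amp_quantile t) \<partial>ui) \<le> 1 / (A i)\<^sup>2 * (2 * A i)"
      by (intro mult_left_mono) auto
    moreover have "(Y i x - 1 / 2)\<^sup>2 = 1 / (A i)\<^sup>2 * ?f x" for x using center[of x 1 i] by simp
    ultimately have "(\<integral>t. (Y i (amp_quantile t) - 1 / 2)\<^sup>2 \<partial>ui) \<le> 2 * A i / (A i)\<^sup>2" by simp
    with div[of i] show ?thesis by simp
  qed
  have summ: "summable (\<lambda>i. 2 * (1 / 2) ^ i :: real)" by (intro summable_mult summable_geometric) simp
  have mq: "amp_quantile \<in> borel_measurable borel"
    unfolding amp_quantile_def
    by (intro borel_measurable_circle_lift circle_lift_inv_lift circle_lift_amp_cdf)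
  have "AE t in ui. (\<lambda>i. (Y i (amp_quantile t) - 1 / 2)\<^sup>2) \<longlonglongrightarrow> 0"
    by (rule AE_tendsto_0_of_summable[OF _ _ sing summ]) (auto intro: bdd_borel_compose[OF bY mq])
  then have "AE t in lborel. t \<in> {0..<1} \<longrightarrow> (\<lambda>i. (Y i (amp_quantile t) - 1 / 2)\<^sup>2) \<longlonglongrightarrow> 0"
    by (simp only: AE_ui)
  then obtain Z where Z: "{t \<in> space lborel. \<not> (t \<in> {0..<1} \<longrightarrow> (\<lambda>i. (Y i (amp_quantile t) - 1 / 2)\<^sup>2) \<longlonglongrightarrow> 0)} \<subseteq> Z"
    "emeasure lborel Z = 0" "Z \<in> sets lborel" by (rule AE_E)
  have "AE x in ui. (\<lambda>i. (Y i x - 0)\<^sup>2) \<longlonglongrightarrow> 0"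
    by (rule AE_tendsto_0_of_summable[OF _ _ leb summ]) (auto intro: bY[of _ 0, simplified])
  moreover have "AE x in ui. x \<in> space ui" by (rule AE_space)
  ultimately have "AE x in ui. amp_cdf x \<in> Z"
  proof eventually_elim
    case (elim x)
    have q: "amp_quantile (amp_cdf x) = x"
      unfolding amp_quantile_def by (rule circle_lift_inv(2)[OF circle_lift_amp_cdf])
    have sm: "strict_mono amp_cdf" "amp_cdf 0 = 0" "amp_cdf 1 = 1"
      using circle_lift_amp_cdf unfolding circle_lift_def by (simp_all) (metis add_0)
    have "amp_cdf x \<in> {0..<1}"
      using elim(2) strict_mono_less[OF sm(1), of x 1] strict_mono_less_eq[OF sm(1), of 0 x] sm by simp
    moreover have "\<not> (\<lambda>i. (Y i x - 1 / 2)\<^sup>2) \<longlonglongrightarrow> 0"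
    proof
      assume "(\<lambda>i. (Y i x - 1 / 2)\<^sup>2) \<longlonglongrightarrow> 0"
      then have "(\<lambda>i. sqrt ((Y i x - 1 / 2)\<^sup>2)) \<longlonglongrightarrow> sqrt 0" by (rule tendsto_real_sqrt)
      moreover have "(\<lambda>i. sqrt ((Y i x - 0)\<^sup>2)) \<longlonglongrightarrow> sqrt 0" using elim(1) by (rule tendsto_real_sqrt)
      ultimately have "(\<lambda>i. Y i x - (Y i x - 1 / 2)) \<longlonglongrightarrow> 0 - 0"
        by (intro tendsto_diff) (simp_all add: tendsto_rabs_zero_iff)
      then show False by (simp add: LIMSEQ_const_iff)
    qed
    ultimately show ?case using Z(1) q by auto
  qed
  moreover have "Z \<in> null_sets lborel" using Z by (intro null_setsI) auto
  ultimately show ?thesis using that by blast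
qed

section \<open>Equidistribution of the typical orbits\<close>

definition averages_to :: "(nat \<Rightarrow> real) \<Rightarrow> real \<Rightarrow> bool" where
  "averages_to z c \<longleftrightarrow> (\<lambda>n. (\<Sum>k<n. z k) / real n) \<longlonglongrightarrow> c"

lemma averages_to_add: "averages_to y b \<Longrightarrow> averages_to z c \<Longrightarrow> averages_to (\<lambda>k. y k + z k) (b + c)"
  unfolding averages_to_def by (simp add: sum.distrib add_divide_distrib tendsto_add)

lemma averages_to_cmult: "averages_to z c \<Longrightarrow> averages_to (\<lambda>k. b * z k) (b * c)"
  unfolding averages_to_def sum_distrib_left[symmetric] times_divide_eq_right[symmetric]
  by (rule tendsto_mult_left)

lemma averages_to_const: "averages_to (\<lambda>_. c) c"
proof -
  have "\<forall>\<^sub>F n in sequentially. (\<Sum>k<n. c) / real n = c"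
    using eventually_gt_at_top[of 0] by eventually_elim simp
  then show ?thesis unfolding averages_to_def by (rule tendsto_eventually)
qed

lemma averages_to_sum:
  "(\<And>i. i \<in> I \<Longrightarrow> averages_to (z i) (c i)) \<Longrightarrow> averages_to (\<lambda>k. \<Sum>i\<in>I. z i k) (\<Sum>i\<in>I. c i)"
  by (induction I rule: infinite_finite_induct) (auto simp: averages_to_const intro: averages_to_add)

lemma averages_to_Suc:
  assumes "averages_to z c" shows "averages_to (\<lambda>k. z (Suc k)) c"
proof -
  have "(\<lambda>n. (\<Sum>k<Suc n. z k) / real (Suc n) * (1 + 1 / real n) - z 0 / real n) \<longlonglongrightarrow> c * (1 + 0) - 0"
    by (intro tendsto_diff tendsto_mult tendsto_add tendsto_const lim_1_over_n lim_const_over_n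
          LIMSEQ_Suc[OF assms[unfolded averages_to_def]])
  moreover have "\<forall>\<^sub>F n in sequentially. (\<Sum>k<Suc n. z k) / real (Suc n) * (1 + 1 / real n) - z 0 / real n
      = (\<Sum>k<n. z (Suc k)) / real n"
    using eventually_gt_at_top[of 0]
  proof eventually_elim
    case (elim n)
    have s: "(\<Sum>k<Suc n. z k) = z 0 + (\<Sum>k<n. z (Suc k))" by (rule sum.lessThan_Suc_shift)
    have "1 + 1 / real n = real (Suc n) / real n" using elim by (simp add: field_simps)
    then have "S / real (Suc n) * (1 + 1 / real n) = S / real n" for S
      using elim by (simp del: of_nat_Suc)
    then show ?case by (simp only: s) (simp add: add_divide_distrib)
  qed
  ultimately show ?thesis unfolding averages_to_def by (simp add: Lim_transform_eventually)
qed

lemma averages_to_close: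
  assumes "\<And>e. e > 0 \<Longrightarrow> \<exists>y b. averages_to y b \<and> (\<forall>k. \<bar>z k - y k\<bar> \<le> e) \<and> \<bar>c - b\<bar> \<le> e"
  shows "averages_to z c"
  unfolding averages_to_def
proof (rule LIMSEQ_I)
  fix r :: real assume "r > 0"
  define e where "e = r / 4"
  have e: "e > 0" using \<open>r > 0\<close> by (simp add: e_def)
  obtain y b where y: "averages_to y b" "\<And>k. \<bar>z k - y k\<bar> \<le> e" "\<bar>c - b\<bar> \<le> e"
    using assms[OF e] by blast
  obtain N where N: "\<And>n. n \<ge> N \<Longrightarrow> norm ((\<Sum>k<n. y k) / real n - b) < e"
    using LIMSEQ_D[OF y(1)[unfolded averages_to_def] e] by blast
  have "norm ((\<Sum>k<n. z k) / real n - c) < r" if "n \<ge> max N 1" for n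
  proof -
    have "\<bar>(\<Sum>k<n. z k) - (\<Sum>k<n. y k)\<bar> \<le> (\<Sum>k<n. \<bar>z k - y k\<bar>)"
      by (simp add: sum_subtractf[symmetric])
    also have "\<dots> \<le> (\<Sum>k<n. e)" by (intro sum_mono y)
    finally have "\<bar>(\<Sum>k<n. z k) / real n - (\<Sum>k<n. y k) / real n\<bar> \<le> e"
      using that by (simp add: diff_divide_distrib[symmetric] abs_divide divide_le_eq mult.commute)
    moreover have "\<bar>(\<Sum>k<n. y k) / real n - b\<bar> < e" using N[of n] that by simp
    ultimately have "\<bar>(\<Sum>k<n. z k) / real n - c\<bar> < 4 * e" using y(3) e by linarith
    then show ?thesis by (simp add: e_def)
  qed
  then show "\<exists>no. \<forall>n\<ge>no. norm ((\<Sum>k<n. z k) / real n - c) < r" by blast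
qed

text \<open>Along fourth powers the square roots in the variance bounds become summable, and a bounded
  sequence whose averages tend to zero along fourth powers has averages tending to zero, because
  consecutive fourth powers have ratio tending to one.\<close>

lemma averages_to_0_of_fourth_powers:
  assumes b: "\<And>k. \<bar>z k\<bar> \<le> 1" and l: "(\<lambda>i. (\<Sum>k<i ^ 4. z k) / real (i ^ 4)) \<longlonglongrightarrow> 0"
  shows "averages_to z 0"
  unfolding averages_to_def
proof (rule LIMSEQ_I)
  fix r :: real assume r: "r > 0"
  obtain I where I: "\<And>i. i \<ge> I \<Longrightarrow> norm ((\<Sum>k<i ^ 4. z k) / real (i ^ 4) - 0) < r / 2"
    using LIMSEQ_D[OF l, of "r / 2"] r by auto
  \<comment> \<open>From \<open>(i + 1) ^ 4 - i ^ 4 \<le> 15 * i ^ 3\<close> the terms after \<open>i ^ 4\<close> contribute at most \<open>15 / i\<close>, which \<open>i > 30 / r\<close> makes smaller than \<open>r / 2\<close>.\<close>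
  define J where "J = max (max I 1) (nat \<lceil>30 / r\<rceil> + 1)"
  have "norm ((\<Sum>k<n. z k) / real n - 0) < r" if n: "n \<ge> J ^ 4" for n
  proof -
    have fin: "i \<le> n" if "i ^ 4 \<le> n" for i :: nat
      using that self_le_power[of i 4] by (cases "i = 0") auto
    have J4: "J ^ 4 \<le> n" using n .
    define i where "i = Max {i. i ^ 4 \<le> n}"
    have F: "finite {i. i ^ 4 \<le> n}" by (rule finite_subset[of _ "{..n}"]) (use fin in auto)
    have i4: "i ^ 4 \<le> n" using Max_in[OF F] J4 unfolding i_def by auto
    have iJ: "J \<le> i" unfolding i_def using F J4 by (intro Max_ge) auto
    have i1: "n < (i + 1) ^ 4"
    proof (rule ccontr)
      assume "\<not> n < (i + 1) ^ 4"
      then have "i + 1 \<le> i" unfolding i_def using F by (intro Max_ge) (auto simp: i_def)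
      then show False by simp
    qed
    have ipos: "i \<ge> 1" "i \<ge> I" "real i > 30 / r"
      using iJ by (auto simp: J_def) linarith
    have "(i + 1) ^ 4 = i ^ 4 + (4 * i ^ 3 + 6 * i ^ 2 + 4 * i + 1)"
      by (simp add: eval_nat_numeral algebra_simps)
    moreover have "i ^ 2 \<le> i ^ 3" "i \<le> i ^ 3" "1 \<le> i ^ 3"
      using ipos by (auto intro: power_increasing self_le_power)
    ultimately have gap: "n - i ^ 4 \<le> 15 * i ^ 3" using i1 by linarith
    have "(\<Sum>k<n. z k) = (\<Sum>k<i ^ 4. z k) + (\<Sum>k=i ^ 4..<n. z k)"
      using sum.atLeastLessThan_concat[of 0 "i ^ 4" n z] i4 by (simp add: atLeast0LessThan)
    moreover have "\<bar>\<Sum>k=i ^ 4..<n. z k\<bar> \<le> (\<Sum>k=i ^ 4..<n. 1)"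
      by (rule order_trans[OF sum_abs]) (intro sum_mono b)
    then have "\<bar>\<Sum>k=i ^ 4..<n. z k\<bar> \<le> 15 * real i ^ 3"
      using gap i4 of_nat_le_iff[of "n - i ^ 4" "15 * i ^ 3", where 'a = real] by simp
    ultimately have S: "\<bar>\<Sum>k<n. z k\<bar> \<le> \<bar>\<Sum>k<i ^ 4. z k\<bar> + 15 * real i ^ 3" by linarith
    have n0: "real n > 0" "real i ^ 4 > 0" "real i ^ 4 \<le> real n"
    proof -
      have "n \<ge> 1" using one_le_power[OF ipos(1), of 4] i4 by (rule order_trans)
      then show "real n > 0" by simp
      show "real i ^ 4 > 0" using ipos by simp
      show "real i ^ 4 \<le> real n" using i4 of_nat_le_iff[of "i ^ 4" n, where 'a = real] by simp
    qed
    have "\<bar>\<Sum>k<n. z k\<bar> / real n \<le> (\<bar>\<Sum>k<i ^ 4. z k\<bar> + 15 * real i ^ 3) / real i ^ 4"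
      using S n0 by (intro frac_le) auto
    also have "\<dots> = \<bar>\<Sum>k<i ^ 4. z k\<bar> / real i ^ 4 + 15 / real i"
      using ipos by (simp add: add_divide_distrib eval_nat_numeral)
    also have "\<bar>\<Sum>k<i ^ 4. z k\<bar> / real i ^ 4 < r / 2" using I[OF ipos(2)] by simp
    also have "15 / real i < r / 2" using ipos r by (simp add: field_simps)
    finally show ?thesis using n0 by (simp add: abs_divide)
  qed
  then show "\<exists>no. \<forall>n\<ge>no. norm ((\<Sum>k<n. z k) / real n - 0) < r" by blast
qed

lemma sum_amp_le: "(\<Sum>j<k. amp j) \<le> sqrt (real k) / 5"
proof (induction k)
  case (Suc k)
  have "sqrt (real k) \<le> sqrt (real k + 1)" by simp
  then have "(sqrt (real k + 1) - sqrt (real k)) * (2 * sqrt (real k + 1))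
      \<ge> (sqrt (real k + 1) - sqrt (real k)) * (sqrt (real k + 1) + sqrt (real k))"
    by (intro mult_left_mono) auto
  also have "(sqrt (real k + 1) - sqrt (real k)) * (sqrt (real k + 1) + sqrt (real k)) = 1"
    by (simp add: algebra_simps)
  finally have "1 / (2 * sqrt (real k + 1)) \<le> sqrt (real k + 1) - sqrt (real k)"
    by (subst pos_divide_le_eq) auto
  then have "amp k \<le> (sqrt (real k + 1) - sqrt (real k)) / 5"
    by (simp add: amp_def)
  with Suc show ?case by (simp add: add.commute[of 1])
qed simp

lemma variance_bound:
  assumes "n = i ^ 4" "i \<ge> 1"
  shows "(\<Sum>k<n. 1 + 2 * (\<Sum>j<k. amp j)) \<le> 2 * real i ^ 6"
proof -
  have "1 + 2 * (\<Sum>j<k. amp j) \<le> 1 + real i ^ 2" if "k < n" for k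
  proof -
    have "real k \<le> (real i ^ 2)\<^sup>2"
      using that assms(1) of_nat_le_iff[of k "i ^ 4", where 'a = real] by (simp flip: power_mult)
    then have "sqrt (real k) \<le> real i ^ 2" by (intro real_le_lsqrt) auto
    then show ?thesis using sum_amp_le[of k] zero_le_power2[of "real i"] by linarith
  qed
  then have "(\<Sum>k<n. 1 + 2 * (\<Sum>j<k. amp j)) \<le> (\<Sum>k<n. 1 + real i ^ 2)" by (intro sum_mono) auto
  also have "\<dots> = real i ^ 4 + real i ^ 6"
    by (simp add: assms(1) distrib_left power_add[symmetric])
  also have "real i ^ 4 \<le> real i ^ 6" using assms(2) by (intro power_increasing) auto
  finally show ?thesis by simp
qed

text \<open>The second moment of the Birkhoff sum up to \<open>i ^ 4\<close> is at most \<open>2 * i ^ 6\<close>, so the squares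
  of the averages have summable integrals.\<close>

lemma AE_fluctuation_averages:
  assumes "bdd_borel g" "irr_cont g" "\<And>x. g (x + 1) = g x" "\<And>x. tri_avg g x = 0" "\<And>x. \<bar>g x\<bar> \<le> 1"
  shows "AE t in ui. averages_to (\<lambda>k. g (3 ^ k * amp_quantile t)) 0"
proof -
  define S where "S i x = (1 / real (i ^ 4))\<^sup>2 * (\<Sum>k<i ^ 4. g (3 ^ k * x))\<^sup>2" for i x
  have bS: "bdd_borel (S i)" for i
    unfolding S_def by (intro bdd_borel_intros bdd_borel_scale[OF assms(1)])
  have mq: "amp_quantile \<in> borel_measurable borel"
    unfolding amp_quantile_def
    by (intro borel_measurable_circle_lift circle_lift_inv_lift circle_lift_amp_cdf)
  have int: "(\<integral>t. S i (amp_quantile t) \<partial>ui) \<le> 2 * (1 / real i ^ 2)" for i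
  proof (cases "i = 0")
    case False
    let ?f = "\<lambda>x. (\<Sum>k<i ^ 4. g (3 ^ k * x))\<^sup>2"
    have "(\<integral>t. ?f (amp_quantile t) \<partial>ui) \<le> (\<Sum>k<i ^ 4. 1 + 2 * (\<Sum>j<k. amp j))"
      unfolding amp_quantile_def amp_cdf_def
    proof (rule integral_riesz_lim_le[where f = ?f])
      show "bdd_borel ?f" by (intro bdd_borel_intros bdd_borel_scale[OF assms(1)])
      show "irr_cont ?f" by (intro irr_cont_power irr_cont_sum irr_cont_scale assms(2))
      show "rint amp N ?f \<le> (\<Sum>k<i ^ 4. 1 + 2 * (\<Sum>j<k. amp j))" if "N \<ge> i ^ 4" for N
        by (rule rint_birkhoff_square[OF null_coeffs_small[OF null_coeffs_amp] assms(1,3,4,5) that])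
    qed (rule null_coeffs_amp)
    also have "\<dots> \<le> 2 * real i ^ 6" using False by (intro variance_bound) auto
    finally have "(1 / real (i ^ 4))\<^sup>2 * (\<integral>t. ?f (amp_quantile t) \<partial>ui) \<le> (1 / real (i ^ 4))\<^sup>2 * (2 * real i ^ 6)"
      by (intro mult_left_mono) auto
    also have "\<dots> = 2 * (1 / real i ^ 2)" using False by (simp add: eval_nat_numeral field_simps)
    finally show ?thesis by (simp add: S_def)
  qed (simp add: S_def)
  have summ: "summable (\<lambda>i. 2 * (1 / real i ^ 2))"
    using inverse_power_summable[of 2, where 'a = real] by (intro summable_mult) (simp add: inverse_eq_divide)
  have "AE t in ui. (\<lambda>i. S i (amp_quantile t)) \<longlonglongrightarrow> 0"
    by (rule AE_tendsto_0_of_summable[OF bdd_borel_compose[OF bS mq] _ int summ]) (simp add: S_def)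
  then show ?thesis
  proof eventually_elim
    case (elim t)
    then have "(\<lambda>i. sqrt (S i (amp_quantile t))) \<longlonglongrightarrow> sqrt 0" by (rule tendsto_real_sqrt)
    moreover have "sqrt (S i (amp_quantile t)) = \<bar>(\<Sum>k<i ^ 4. g (3 ^ k * amp_quantile t)) / real (i ^ 4)\<bar>" for i
      by (simp add: S_def real_sqrt_mult abs_divide)
    ultimately have "(\<lambda>i. (\<Sum>k<i ^ 4. g (3 ^ k * amp_quantile t)) / real (i ^ 4)) \<longlonglongrightarrow> 0"
      by - (rule tendsto_rabs_zero_cancel, simp)
    then show ?case by (intro averages_to_0_of_fourth_powers assms(5))
  qed
qed

definition step_periodic :: "nat \<Rightarrow> (int \<Rightarrow> real) \<Rightarrow> bool" where
  "step_periodic s q \<longleftrightarrow> (\<forall>j. q (j + 3 ^ s) = q j)"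

text \<open>The action of \<open>tri_avg\<close> on the values of a ternary step function.\<close>

definition step_avg :: "nat \<Rightarrow> (int \<Rightarrow> real) \<Rightarrow> int \<Rightarrow> real" where
  "step_avg s q j = (q j + q (j + 3 ^ s) + q (j + 2 * 3 ^ s)) / 3"

lemma step_periodic_mod: 
  assumes "step_periodic s q" shows "q (j mod 3 ^ s) = q j"
proof -
  have "q (j + 3 ^ s * k) = q j" for j k
  proof (induction k rule: int_induct[where k = 0])
    case (step1 i)
    then show ?case using assms unfolding step_periodic_def
      by (metis (no_types, opaque_lifting) add.assoc distrib_left mult.right_neutral)
  next
    case (step2 i)
    then show ?case using assms unfolding step_periodic_def
      by (metis (no_types, opaque_lifting) add.assoc diff_add_cancel distrib_left mult.right_neutral)
  qed simp
  from this[of "j mod 3 ^ s" "j div 3 ^ s"] show ?thesis by (simp add: mult.commute)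
qed

lemma step_periodic_bounded:
  assumes "step_periodic s q" obtains B where "B > 0" "\<And>j. \<bar>q j\<bar> \<le> B"
proof
  let ?B = "1 + (\<Sum>i\<in>{0..<3 ^ s}. \<bar>q i\<bar>)"
  show "0 < ?B" by (intro add_pos_nonneg sum_nonneg) auto
  fix j
  have "\<bar>q (j mod 3 ^ s)\<bar> \<le> (\<Sum>i\<in>{0..<3 ^ s}. \<bar>q i\<bar>)"
    by (rule member_le_sum[where f = "\<lambda>i. \<bar>q i\<bar>"]) auto
  then show "\<bar>q j\<bar> \<le> ?B" by (simp add: step_periodic_mod[OF assms])
qed

lemma step_avg_diff:
  "step_avg s (\<lambda>j. c * (q j - p j)) j = c * (step_avg s q j - (p j + p (j + 3 ^ s) + p (j + 2 * 3 ^ s)) / 3)"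
  by (simp add: step_avg_def field_simps)

lemma step_avg_periodic:
  assumes "step_periodic (Suc s) q" shows "step_periodic s (step_avg s q)"
proof -
  have "q (j + 3 * 3 ^ s) = q j" for j using assms by (simp add: step_periodic_def)
  moreover have "j + 3 ^ s + 2 * 3 ^ s = j + 3 * 3 ^ s" for j :: int by simp
  ultimately show ?thesis
    by (simp add: step_periodic_def step_avg_def add.assoc)
qed

lemma tri_avg_step: "tri_avg (\<lambda>x. q \<lfloor>3 ^ Suc s * x\<rfloor>) x = step_avg s q \<lfloor>3 ^ s * x\<rfloor>"
proof -
  have "\<lfloor>3 ^ Suc s * ((x + of_int c) / 3)\<rfloor> = \<lfloor>3 ^ s * x\<rfloor> + c * 3 ^ s" for c
  proof -
    have "3 ^ Suc s * ((x + of_int c) / 3) = 3 ^ s * x + of_int (c * 3 ^ s)" by (simp add: field_simps)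
    then show ?thesis by (simp only: floor_add_int)
  qed
  from this[of 0] this[of 1] this[of 2] show ?thesis by (simp add: tri_avg_def step_avg_def)
qed

lemma step_mean: "(\<Sum>i<3 ^ Suc s. q (int i)) / 3 ^ Suc s = (\<Sum>i<3 ^ s. step_avg s q (int i)) / 3 ^ s"
proof -
  have block: "(\<Sum>i=c * 3 ^ s..<(c + 1) * 3 ^ s. q (int i)) = (\<Sum>i<3 ^ s. q (int i + int c * 3 ^ s))" for c
    using sum.shift_bounds_nat_ivl[of "\<lambda>i. q (int i)" 0 "c * 3 ^ s" "3 ^ s"]
    by (simp add: atLeast0LessThan add.commute)
  have "(\<Sum>i<3 ^ Suc s. q (int i)) = (\<Sum>i=0 * 3 ^ s..<1 * 3 ^ s. q (int i))
      + (\<Sum>i=1 * 3 ^ s..<2 * 3 ^ s. q (int i)) + (\<Sum>i=2 * 3 ^ s..<3 * 3 ^ s. q (int i))"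
    by (simp add: sum.atLeastLessThan_concat atLeast0LessThan[symmetric])
  also have "\<dots> = (\<Sum>i<3 ^ s. 3 * step_avg s q (int i))"
  proof -
    have "3 * step_avg s q j = q j + q (j + 3 ^ s) + q (j + 2 * 3 ^ s)" for j by (simp add: step_avg_def)
    then show ?thesis
      using block[of 0] block[of 1, unfolded one_add_one] block[of 2] by (simp add: sum.distrib)
  qed
  finally show ?thesis by (simp add: sum_distrib_left[symmetric])
qed

lemma bdd_borel_step:
  assumes "step_periodic s q" shows "bdd_borel (\<lambda>x. q \<lfloor>3 ^ s' * x\<rfloor>)"
proof -
  obtain B where "\<And>j. \<bar>q j\<bar> \<le> B" using step_periodic_bounded[OF assms] by blast
  moreover have "(\<lambda>x::real. q \<lfloor>3 ^ s' * x\<rfloor>) \<in> borel_measurable borel"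
  proof (rule measurable_compose[where g = q])
    show "(\<lambda>x::real. \<lfloor>3 ^ s' * x\<rfloor>) \<in> borel \<rightarrow>\<^sub>M count_space UNIV"
      by (rule measurable_compose[OF _ measurable_real_floor]) simp
  qed simp
  ultimately show ?thesis by (auto simp: bdd_borel_def)
qed

lemma integral_step:
  "step_periodic s q \<Longrightarrow> (\<integral>x. q \<lfloor>3 ^ s * x\<rfloor> \<partial>ui) = (\<Sum>i<3 ^ s. q (int i)) / 3 ^ s"
proof (induction s arbitrary: q)
  case 0
  have "q \<lfloor>x\<rfloor> = q 0" for x using step_periodic_mod[OF 0, of "\<lfloor>x\<rfloor>"] by simp
  then have "(\<lambda>x. q \<lfloor>3 ^ 0 * x\<rfloor>) = (\<lambda>x::real. q 0)" by (intro ext)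
  then show ?case using ui.prob_space by (simp only:) simp
next
  case (Suc s)
  have "(\<integral>x. q \<lfloor>3 ^ Suc s * x\<rfloor> \<partial>ui) = integral\<^sup>L ui (tri_avg (\<lambda>x. q \<lfloor>3 ^ Suc s * x\<rfloor>))"
    by (rule integral_tri_avg[symmetric]) (rule bdd_borel_step[OF Suc.prems])
  also have "\<dots> = (\<Sum>i<3 ^ s. step_avg s q (int i)) / 3 ^ s"
    unfolding tri_avg_step[abs_def] by (rule Suc.IH[OF step_avg_periodic[OF Suc.prems]])
  finally show ?case by (simp only: step_mean)
qed

text \<open>A step function of level \<open>Suc s\<close> is a fluctuation plus the pull-back, under \<open>x \<mapsto> 3 * x\<close>, of a
  step function of level \<open>s\<close> with the same mean.\<close>

lemma AE_step_averages:
  "step_periodic s q \<Longrightarrow>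
   AE t in ui. averages_to (\<lambda>k. q \<lfloor>3 ^ s * (3 ^ k * amp_quantile t)\<rfloor>) ((\<Sum>i<3 ^ s. q (int i)) / 3 ^ s)"
proof (induction s arbitrary: q)
  case 0
  have "q \<lfloor>x\<rfloor> = q 0" for x using step_periodic_mod[OF 0, of "\<lfloor>x\<rfloor>"] by simp
  then have "(\<lambda>k. q \<lfloor>3 ^ 0 * (3 ^ k * amp_quantile t)\<rfloor>) = (\<lambda>k. q 0)" for t by (intro ext)
  then show ?case by (simp only:) (simp add: averages_to_const)
next
  case (Suc s)
  let ?p = "step_avg s q"
  define q0 where "q0 j = q j - ?p j" for j
  have per: "step_periodic s ?p" by (rule step_avg_periodic[OF Suc.prems])
  have p3: "?p (j + 3 ^ s) = ?p j" "?p (j + 2 * 3 ^ s) = ?p j" "?p (j + 3 * 3 ^ s) = ?p j" for j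
    using per[unfolded step_periodic_def, rule_format, of j] per[unfolded step_periodic_def, rule_format, of "j + 3 ^ s"]
      per[unfolded step_periodic_def, rule_format, of "j + 2 * 3 ^ s"] by (simp_all add: add.assoc)
  have per0: "step_periodic (Suc s) q0"
    using Suc.prems p3(3) by (simp add: step_periodic_def q0_def)
  obtain B where B: "B > 0" "\<And>j. \<bar>q0 j\<bar> \<le> B" using step_periodic_bounded[OF per0] by blast
  define r where "r j = (1 / B) * q0 j" for j
  have perr: "step_periodic (Suc s) r" using per0 by (simp add: step_periodic_def r_def)
  have "AE t in ui. averages_to (\<lambda>k. r \<lfloor>3 ^ Suc s * (3 ^ k * amp_quantile t)\<rfloor>) 0"
  proof (rule AE_fluctuation_averages[where g = "\<lambda>x. r \<lfloor>3 ^ Suc s * x\<rfloor>"])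
    show "bdd_borel (\<lambda>x. r \<lfloor>3 ^ Suc s * x\<rfloor>)" by (rule bdd_borel_step[OF perr])
    show "irr_cont (\<lambda>x. r \<lfloor>3 ^ Suc s * x\<rfloor>)" by (rule irr_cont_floor)
    show "r \<lfloor>3 ^ Suc s * (x + 1)\<rfloor> = r \<lfloor>3 ^ Suc s * x\<rfloor>" for x
    proof -
      have "3 ^ Suc s * (x + 1) = 3 ^ Suc s * x + of_int (3 ^ Suc s)" by (simp add: field_simps)
      then show ?thesis using perr by (simp only: floor_add_int[symmetric] step_periodic_def)
    qed
    have "step_avg s r j = 0" for j
      unfolding r_def q0_def step_avg_diff p3 by simp
    then show "tri_avg (\<lambda>x. r \<lfloor>3 ^ Suc s * x\<rfloor>) x = 0" for x by (simp only: tri_avg_step)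
    show "\<bar>r \<lfloor>3 ^ Suc s * x\<rfloor>\<bar> \<le> 1" for x using B by (simp add: r_def abs_mult)
  qed
  with Suc.IH[OF per] show ?case
  proof eventually_elim
    case (elim t)
    let ?x = "amp_quantile t"
    have "averages_to (\<lambda>k. B * r \<lfloor>3 ^ Suc s * (3 ^ k * ?x)\<rfloor> + ?p \<lfloor>3 ^ s * (3 ^ Suc k * ?x)\<rfloor>)
       (B * 0 + (\<Sum>i<3 ^ s. ?p (int i)) / 3 ^ s)"
      by (intro averages_to_add averages_to_cmult elim averages_to_Suc[OF elim(1)])
    moreover have "B * r \<lfloor>3 ^ Suc s * (3 ^ k * ?x)\<rfloor> + ?p \<lfloor>3 ^ s * (3 ^ Suc k * ?x)\<rfloor> = q \<lfloor>3 ^ Suc s * (3 ^ k * ?x)\<rfloor>" for k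
    proof -
      have "3 ^ s * (3 ^ Suc k * ?x) = 3 ^ Suc s * (3 ^ k * ?x)" by simp
      then show ?thesis using B(1) by (simp only: r_def q0_def) simp
    qed
    ultimately show ?case by (simp only: step_mean) simp
  qed
qed

lemma continuous_periodic_uniform:
  fixes f :: "real \<Rightarrow> real"
  assumes "continuous_on UNIV f" "\<And>x. f (x + 1) = f x" "e > 0"
  obtains d where "d > 0" "\<And>x y. \<bar>x - y\<bar> < d \<Longrightarrow> \<bar>f x - f y\<bar> < e"
proof -
  have "uniformly_continuous_on {-1..2} f"
    by (intro compact_uniformly_continuous continuous_on_subset[OF assms(1)]) auto
  then obtain d where d: "d > 0" "\<And>x y. x \<in> {-1..2} \<Longrightarrow> y \<in> {-1..2} \<Longrightarrow> dist y x < d \<Longrightarrow> dist (f y) (f x) < e"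
    unfolding uniformly_continuous_on_def using assms(3) by metis
  show ?thesis
  proof
    show "min d 1 > 0" using d by simp
    fix x y :: real assume xy: "\<bar>x - y\<bar> < min d 1"
    let ?k = "\<lfloor>x\<rfloor>"
    have s: "f (z - of_int ?k) = f z" for z
      using periodic_shift_int[of f "z - of_int ?k" ?k, OF assms(2)] by simp
    have "x - of_int ?k \<in> {-1..2}" "y - of_int ?k \<in> {-1..2}"
      using xy by (auto simp: abs_less_iff) linarith+
    then have "dist (f (x - of_int ?k)) (f (y - of_int ?k)) < e"
      using xy by (intro d(2)) (auto simp: dist_real_def)
    then show "\<bar>f x - f y\<bar> < e" by (simp add: s dist_real_def)
  qed
qed

definition equidistributed :: "real \<Rightarrow> bool" where
  "equidistributed x \<longleftrightarrow> (\<forall>f. continuous_on UNIV f \<and> (\<forall>y. f (y + 1) = f y) \<longrightarrow>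
     averages_to (\<lambda>k. f (3 ^ k * x)) (integral\<^sup>L ui f))"

text \<open>A continuous periodic function is uniformly close to the step function of its values at the points
  \<open>j / 3 ^ s\<close>, so counting visits to the ternary intervals decides equidistribution.\<close>

lemma equidistributedI:
  assumes "\<And>s i. i < 3 ^ s \<Longrightarrow>
      averages_to (\<lambda>k. of_bool (\<lfloor>3 ^ s * (3 ^ k * x)\<rfloor> mod 3 ^ s = int i)) (1 / 3 ^ s)"
  shows "equidistributed x"
  unfolding equidistributed_def
proof (intro allI impI)
  fix f :: "real \<Rightarrow> real" assume f: "continuous_on UNIV f \<and> (\<forall>y. f (y + 1) = f y)"
  show "averages_to (\<lambda>k. f (3 ^ k * x)) (integral\<^sup>L ui f)"
  proof (rule averages_to_close)
    fix e :: real assume "e > 0"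
    then obtain d where d: "d > 0" "\<And>x y. \<bar>x - y\<bar> < d \<Longrightarrow> \<bar>f x - f y\<bar> < e"
      using continuous_periodic_uniform[of f e] f by metis
    obtain s where s: "1 / d < 3 ^ s" using real_arch_pow[of 3 "1 / d"] by auto
    define q where "q j = f (of_int j / 3 ^ s)" for j :: int
    have per: "step_periodic s q"
      unfolding step_periodic_def q_def using f by (simp add: add_divide_distrib)
    have close: "\<bar>f y - q \<lfloor>3 ^ s * y\<rfloor>\<bar> \<le> e" for y
    proof -
      have "\<bar>3 ^ s * y - of_int \<lfloor>3 ^ s * y\<rfloor>\<bar> < 1" by linarith
      then have "\<bar>(3 ^ s * y - of_int \<lfloor>3 ^ s * y\<rfloor>) / 3 ^ s\<bar> < 1 / 3 ^ s"
        unfolding abs_divide by (simp add: divide_strict_right_mono)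
      then have "\<bar>y - of_int \<lfloor>3 ^ s * y\<rfloor> / 3 ^ s\<bar> < 1 / 3 ^ s" by (simp add: diff_divide_distrib)
      also have "1 / 3 ^ s < d" using s d(1) by (simp add: field_simps)
      finally show ?thesis unfolding q_def using d(2) by (simp add: less_imp_le)
    qed
    have q_sum: "q j = (\<Sum>i<3 ^ s. q (int i) * of_bool (j mod 3 ^ s = int i))" for j
    proof -
      have "(\<Sum>i<3 ^ s. q (int i) * of_bool (j mod 3 ^ s = int i))
          = (\<Sum>i<3 ^ s. if i = nat (j mod 3 ^ s) then q (int i) else 0)"
        by (intro sum.cong) (auto simp: nat_eq_iff2)
      also have "\<dots> = q (j mod 3 ^ s)" by (simp add: nat_less_iff)
      finally show ?thesis by (simp add: step_periodic_mod[OF per])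
    qed
    have av: "averages_to (\<lambda>k. q \<lfloor>3 ^ s * (3 ^ k * x)\<rfloor>) ((\<Sum>i<3 ^ s. q (int i)) / 3 ^ s)"
    proof -
      have "averages_to (\<lambda>k. \<Sum>i<3 ^ s. q (int i) * of_bool (\<lfloor>3 ^ s * (3 ^ k * x)\<rfloor> mod 3 ^ s = int i))
         (\<Sum>i<3 ^ s. q (int i) * (1 / 3 ^ s))"
        by (intro averages_to_sum averages_to_cmult assms) simp
      then show ?thesis unfolding q_sum[symmetric] by (simp add: sum_divide_distrib)
    qed
    have bf: "bdd_borel f"
    proof -
      obtain B where B: "\<And>j. \<bar>q j\<bar> \<le> B" using step_periodic_bounded[OF per] by blast
      have "\<bar>f y\<bar> \<le> B + e" for y using close[of y] B[of "\<lfloor>3 ^ s * y\<rfloor>"] by linarith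
      then show ?thesis using f by (auto simp: bdd_borel_def intro: borel_measurable_continuous_onI)
    qed
    have "\<bar>integral\<^sup>L ui f - (\<integral>y. q \<lfloor>3 ^ s * y\<rfloor> \<partial>ui)\<bar> = \<bar>\<integral>y. f y - q \<lfloor>3 ^ s * y\<rfloor> \<partial>ui\<bar>"
      by (simp add: integrable_ui[OF bf] integrable_ui[OF bdd_borel_step[OF per]])
    also have "\<dots> \<le> (\<integral>y. \<bar>f y - q \<lfloor>3 ^ s * y\<rfloor>\<bar> \<partial>ui)" by (rule integral_abs_bound)
    also have "\<dots> \<le> (\<integral>y. e \<partial>ui)"
      by (intro integral_mono integrable_abs Bochner_Integration.integrable_diff integrable_ui bf bdd_borel_step[OF per] bdd_borel_const close)
    also have "\<dots> = e" using ui.prob_space by simp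
    finally have "\<bar>integral\<^sup>L ui f - (\<Sum>i<3 ^ s. q (int i)) / 3 ^ s\<bar> \<le> e"
      by (simp only: integral_step[OF per])
    with av close show "\<exists>y b. averages_to y b \<and> (\<forall>k. \<bar>f (3 ^ k * x) - y k\<bar> \<le> e) \<and> \<bar>integral\<^sup>L ui f - b\<bar> \<le> e"
      by blast
  qed
qed

lemma AE_equidistributed: "AE t in ui. equidistributed (amp_quantile t)"
proof -
  have "AE t in ui. \<forall>s. \<forall>i. i < 3 ^ s \<longrightarrow>
      averages_to (\<lambda>k. of_bool (\<lfloor>3 ^ s * (3 ^ k * amp_quantile t)\<rfloor> mod 3 ^ s = int i)) (1 / 3 ^ s)"
  proof (subst AE_all_countable, intro allI, subst AE_all_countable, intro allI)
    fix s i :: nat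
    show "AE t in ui. i < 3 ^ s \<longrightarrow>
      averages_to (\<lambda>k. of_bool (\<lfloor>3 ^ s * (3 ^ k * amp_quantile t)\<rfloor> mod 3 ^ s = int i)) (1 / 3 ^ s)"
    proof (cases "i < 3 ^ s")
      case True
      let ?q = "\<lambda>j. of_bool (j mod 3 ^ s = int i) :: real"
      have "(\<Sum>j<3 ^ s. ?q (int j)) = (\<Sum>j<3 ^ s. if j = i then 1 else 0)"
      proof (intro sum.cong refl)
        fix j :: nat assume "j \<in> {..<3 ^ s}"
        then have "int j < 3 ^ s" using of_nat_less_iff[of j "3 ^ s", where 'a = int] by simp
        then have "int j mod 3 ^ s = int j" by (intro mod_pos_pos_trivial) simp_all
        then show "?q (int j) = (if j = i then 1 else 0)" by (simp only: of_nat_eq_iff) simp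
      qed
      also have "\<dots> = 1" using True by (subst sum.delta) auto
      finally have sum1: "(\<Sum>j<3 ^ s. ?q (int j)) = 1" .
      have "step_periodic s ?q" unfolding step_periodic_def mod_add_self2 by blast
      from AE_step_averages[OF this] show ?thesis
        unfolding sum1 by (rule eventually_mono) (rule impI)
    qed simp
  qed
  then show ?thesis
  proof eventually_elim
    case (elim t)
    then show ?case by (intro equidistributedI) blast
  qed
qed

section \<open>Diffeomorphisms onto their image\<close>

lemma C1_onI:
  fixes f :: "'a::euclidean_space \<Rightarrow> 'b::real_normed_vector"
  assumes d: "\<And>x. x \<in> S \<Longrightarrow> (f has_derivative D x) (at x)"
    and c: "\<And>v. continuous_on S (\<lambda>x. D x v)"
  shows "C1_on f S"
proof -
  define f' where "f' x = Blinfun (D x)" for x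
  have ap: "blinfun_apply (f' x) = D x" if "x \<in> S" for x
    unfolding f'_def using bounded_linear_Blinfun_apply[OF has_derivative_bounded_linear[OF d[OF that]]] .
  have "continuous_on S f'"
  proof (rule continuous_on_blinfun_componentwise)
    fix i :: 'a
    show "continuous_on S (\<lambda>x. blinfun_apply (f' x) i)"
      using c[of i] by (rule continuous_on_eq) (simp add: ap)
  qed
  then show ?thesis unfolding C1_on_def using d ap by (intro exI[of _ f']) auto
qed

text \<open>Invariance of domain makes the image open and the inverse continuous, so the inverse is differentiable wherever the
  derivative of \<open>T\<close> is invertible. The inverse derivatives depend continuously on the point because near a
  given point the derivatives are uniformly bounded below.\<close>

lemma C1_diffeo_onto_imageI:
  fixes T :: "'a::euclidean_space \<Rightarrow> 'a"
  assumes "open U" "inj_on T U" "C1_on T U"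
    and inj: "\<And>x D. x \<in> U \<Longrightarrow> (T has_derivative D) (at x) \<Longrightarrow> inj D"
  shows "C1_diffeo_onto_image T U"
proof -
  obtain T' where T': "\<And>x. x \<in> U \<Longrightarrow> (T has_derivative blinfun_apply (T' x)) (at x)" "continuous_on U T'"
    using assms(3) unfolding C1_on_def by blast
  have cT: "continuous_on U T"
    using T'(1) has_derivative_continuous continuous_at_imp_continuous_on by blast
  have openI: "open (T ` V)" if "open V" "V \<subseteq> U" for V
    by (rule invariance_of_domain) (use that cT assms(2) in \<open>auto intro: continuous_on_subset inj_on_subset\<close>)
  have oTU: "open (T ` U)" by (rule openI[OF assms(1)]) simp
  let ?g = "inv_into U T"
  have gU: "?g y \<in> U" "T (?g y) = y" if "y \<in> T ` U" for y
    using that by (auto simp: inv_into_into f_inv_into_f)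
  have cg: "continuous_on (T ` U) ?g"
  proof (rule continuous_on_open_invariant[THEN iffD2], intro allI impI)
    fix B :: "'a set" assume "open B"
    have "T ` (U \<inter> B) \<inter> T ` U = ?g -` B \<inter> T ` U"
    proof (intro subset_antisym subsetI)
      fix y assume "y \<in> T ` (U \<inter> B) \<inter> T ` U"
      then obtain x where "x \<in> U" "x \<in> B" "y = T x" by blast
      then show "y \<in> ?g -` B \<inter> T ` U" using inv_into_f_f[OF assms(2), of x] by simp
    next
      fix y assume "y \<in> ?g -` B \<inter> T ` U"
      then have "?g y \<in> U \<inter> B" "T (?g y) = y" "y \<in> T ` U" using gU[of y] by auto
      then show "y \<in> T ` (U \<inter> B) \<inter> T ` U" by (metis IntI imageI)
    qed
    moreover have "open (T ` (U \<inter> B))" using assms(1) \<open>open B\<close> by (intro openI) auto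
    ultimately show "\<exists>A. open A \<and> A \<inter> T ` U = ?g -` B \<inter> T ` U" by (intro exI conjI)
  qed
  have ex: "\<exists>L. blinfun_apply L \<circ> blinfun_apply (T' x) = id \<and> blinfun_apply (T' x) \<circ> blinfun_apply L = id" if "x \<in> U" for x
  proof -
    have i: "inj (blinfun_apply (T' x))" by (rule inj[OF that T'(1)[OF that]])
    have l: "linear (blinfun_apply (T' x))" by (rule bounded_linear.linear[OF blinfun.bounded_linear_right])
    from linear_injective_isomorphism[OF l i]
    obtain g where g: "linear g" "\<And>v. g (blinfun_apply (T' x) v) = v" "\<And>v. blinfun_apply (T' x) (g v) = v"
      by blast
    have "blinfun_apply (Blinfun g) = g"
      using g(1) by (intro bounded_linear_Blinfun_apply) (simp add: linear_conv_bounded_linear)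
    then show ?thesis using g by (intro exI[of _ "Blinfun g"]) (simp add: fun_eq_iff)
  qed
  define L where "L x = (SOME L. blinfun_apply L \<circ> blinfun_apply (T' x) = id \<and> blinfun_apply (T' x) \<circ> blinfun_apply L = id)" for x
  have L: "blinfun_apply (L x) \<circ> blinfun_apply (T' x) = id" "blinfun_apply (T' x) \<circ> blinfun_apply (L x) = id"
    if "x \<in> U" for x
    using someI_ex[OF ex[OF that]] unfolding L_def by blast+
  have "C1_on ?g (T ` U)"
  proof (rule C1_onI[where D = "\<lambda>y. blinfun_apply (L (?g y))"])
    fix y assume y: "y \<in> T ` U"
    show "(?g has_derivative blinfun_apply (L (?g y))) (at y)"
    proof (rule has_derivative_inverse_basic[where f = T and g = ?g and y = y and T = "T ` U",
          OF T'(1)[OF gU(1)[OF y]]])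
      show "blinfun_apply (L (?g y)) \<circ> blinfun_apply (T' (?g y)) = id" by (rule L(1)[OF gU(1)[OF y]])
      show "continuous (at y) ?g" using cg oTU y continuous_on_eq_continuous_at by blast
    qed (use oTU y gU in \<open>auto intro: blinfun.bounded_linear_right\<close>)
  next
    fix v
    have cL: "continuous_on U (\<lambda>x. L x v)"
    proof (subst continuous_on_sequentially, intro ballI allI impI)
      fix s x assume s: "x \<in> U" "(\<forall>n. s n \<in> U) \<and> s \<longlonglongrightarrow> x"
      have Tl: "(\<lambda>n. T' (s n)) \<longlonglongrightarrow> T' x"
        using T'(2) s unfolding continuous_on_sequentially by (auto simp: o_def)
      obtain w where w: "blinfun_apply (T' x) w = v" "w = blinfun_apply (L x) v"
        using L(2)[OF s(1)] by (metis comp_apply id_apply)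
      \<comment> \<open>the inverse matrices are uniformly bounded below near \<open>x\<close>\<close>
      define c where "c = 1 / (norm (L x) + 1)"
      have c: "c > 0" by (simp add: c_def add_nonneg_pos)
      have lower: "c * norm u \<le> norm (blinfun_apply (T' x) u)" for u
      proof -
        have "norm u = norm (blinfun_apply (L x) (blinfun_apply (T' x) u))"
          using L(1)[OF s(1)] by (metis comp_apply id_apply)
        also have "\<dots> \<le> norm (L x) * norm (blinfun_apply (T' x) u)" by (rule norm_blinfun)
        also have "\<dots> \<le> (norm (L x) + 1) * norm (blinfun_apply (T' x) u)" by (intro mult_right_mono) auto
        finally show ?thesis by (simp add: c_def pos_divide_le_eq add_nonneg_pos mult.commute)
      qed
      have ev: "\<forall>\<^sub>F n in sequentially. norm (T' (s n) - T' x) < c / 2"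
        using tendstoD[OF Tl, of "c / 2"] c by (simp add: dist_norm)
      have "\<forall>\<^sub>F n in sequentially. norm (blinfun_apply (L (s n)) v - w) \<le> 2 / c * norm (blinfun_apply (T' x) w - blinfun_apply (T' (s n)) w)"
        using ev
      proof eventually_elim
        case (elim n)
        let ?u = "blinfun_apply (L (s n)) v - w"
        have Ts: "blinfun_apply (T' (s n)) (blinfun_apply (L (s n)) v) = v"
          using L(2)[of "s n"] s by (metis comp_apply id_apply)
        have "c * norm ?u \<le> norm (blinfun_apply (T' x) ?u)" using lower[of ?u] by simp
        also have "\<dots> \<le> norm (blinfun_apply (T' (s n)) ?u) + norm (blinfun_apply (T' (s n) - T' x) ?u)"
          using norm_triangle_ineq4[of "blinfun_apply (T' (s n)) ?u" "blinfun_apply (T' (s n) - T' x) ?u"]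
          by (simp add: blinfun.diff_left)
        also have "norm (blinfun_apply (T' (s n) - T' x) ?u) \<le> c / 2 * norm ?u"
          using norm_blinfun[of "T' (s n) - T' x" ?u] elim
          by (meson mult_right_mono less_imp_le norm_ge_zero order_trans)
        finally have "c / 2 * norm ?u \<le> norm (blinfun_apply (T' (s n)) ?u)" by simp
        moreover have "blinfun_apply (T' (s n)) ?u = blinfun_apply (T' x) w - blinfun_apply (T' (s n)) w"
          using w(1) Ts by (simp add: blinfun.diff_right)
        ultimately show ?case using c by (simp add: field_simps)
      qed
      moreover have "(\<lambda>n. 2 / c * norm (blinfun_apply (T' x) w - blinfun_apply (T' (s n)) w))
          \<longlonglongrightarrow> 2 / c * norm (blinfun_apply (T' x) w - blinfun_apply (T' x) w)"
        by (intro tendsto_mult tendsto_const tendsto_norm tendsto_diff blinfun.tendsto Tl)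
      then have "(\<lambda>n. 2 / c * norm (blinfun_apply (T' x) w - blinfun_apply (T' (s n)) w)) \<longlonglongrightarrow> 0"
        by simp
      ultimately have "(\<lambda>n. blinfun_apply (L (s n)) v - w) \<longlonglongrightarrow> 0"
        by (rule Lim_null_comparison)
      then show "((\<lambda>x. blinfun_apply (L x) v) \<circ> s) \<longlonglongrightarrow> blinfun_apply (L x) v"
        using w(2) by (simp add: o_def LIM_zero_iff)
    qed
    show "continuous_on (T ` U) (\<lambda>y. blinfun_apply (L (?g y)) v)"
      by (rule continuous_on_compose2[OF cL cg]) (use gU in auto)
  qed
  with assms oTU show ?thesis by (simp add: C1_diffeo_onto_image_def)
qed

section \<open>Attractors of injective maps\<close>

lemma funpow_in: "T ` U \<subseteq> U \<Longrightarrow> x \<in> U \<Longrightarrow> (T ^^ n) x \<in> U"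
  by (induction n) auto

lemma attractor_subset: "attractor T U \<subseteq> U"
  unfolding attractor_def by (auto dest!: spec[of _ 0] INT_D[of _ _ _ 0])

lemma attractor_preimage:
  assumes "T ` U \<subseteq> U" "inj_on T U" "x \<in> attractor T U"
  shows "inv_into U T x \<in> attractor T U" "T (inv_into U T x) = x"
proof -
  let ?y = "inv_into U T x"
  have "x \<in> (T ^^ Suc 0) ` U" using assms(3) unfolding attractor_def by blast
  then have "x \<in> T ` U" by simp
  then show Ty: "T ?y = x" by (rule f_inv_into_f)
  have yU: "?y \<in> U" using \<open>x \<in> T ` U\<close> by (rule inv_into_into)
  have "?y \<in> (T ^^ k) ` U" for k
  proof -
    have "x \<in> (T ^^ Suc k) ` U" using assms(3) unfolding attractor_def by blast
    then obtain z where z: "z \<in> U" "x = T ((T ^^ k) z)" by auto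
    then have "?y = (T ^^ k) z" using assms(2) Ty yU funpow_in[OF assms(1) z(1)] by (metis inj_onD)
    then show ?thesis using z by blast
  qed
  then show "?y \<in> attractor T U" by (simp add: attractor_def)
qed

lemma attractor_image:
  assumes "T ` U \<subseteq> U" "x \<in> attractor T U" shows "T x \<in> attractor T U"
  unfolding attractor_def
proof
  fix k
  have "x \<in> (T ^^ k) ` U" using assms(2) unfolding attractor_def by blast
  then obtain z where z: "z \<in> U" "x = (T ^^ k) z" by blast
  then have "T x = (T ^^ k) (T z)" by (simp add: funpow_swap1)
  then show "T x \<in> (T ^^ k) ` U" using z assms(1) by blast
qed

text \<open>After one step the orbit is in \<open>K\<close>, so the attractor is also the intersection of the compact sets \<open>(T ^^ k) ` K\<close>.\<close>

lemma compact_attractor: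
  fixes T :: "'a::heine_borel \<Rightarrow> 'a"
  assumes "K \<subseteq> U" "T ` U \<subseteq> K" "compact K" "continuous_on U T"
  shows "compact (attractor T U)"
proof -
  have TU: "T ` U \<subseteq> U" using assms by blast
  have "compact ((T ^^ k) ` K) \<and> (T ^^ k) ` K \<subseteq> U" for k
  proof (induction k)
    case (Suc k)
    have "(T ^^ Suc k) ` K = T ` ((T ^^ k) ` K)" by (simp add: image_comp)
    moreover have "compact (T ` ((T ^^ k) ` K))"
      by (rule compact_continuous_image[OF continuous_on_subset[OF assms(4)]]) (use Suc in auto)
    moreover have "T ` ((T ^^ k) ` K) \<subseteq> U" using Suc TU by blast
    ultimately show ?case by simp
  qed (use assms in auto)
  then have "compact (\<Inter>(range (\<lambda>k. (T ^^ k) ` K)))" by (intro compact_Inter) auto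
  moreover have "attractor T U = (\<Inter>k. (T ^^ k) ` K)"
  proof
    show "attractor T U \<subseteq> (\<Inter>k. (T ^^ k) ` K)"
    proof
      fix x assume x: "x \<in> attractor T U"
      have "x \<in> (T ^^ k) ` K" for k
      proof -
        have "x \<in> (T ^^ Suc k) ` U" using x unfolding attractor_def by blast
        then obtain z where "z \<in> U" "x = (T ^^ k) (T z)" unfolding funpow_Suc_right by auto
        then show ?thesis using assms(2) by blast
      qed
      then show "x \<in> (\<Inter>k. (T ^^ k) ` K)" by blast
    qed
    show "(\<Inter>k. (T ^^ k) ` K) \<subseteq> attractor T U" unfolding attractor_def using assms(1) by blast
  qed
  ultimately show ?thesis by simp
qed

section \<open>Polar coordinates around a circle in space\<close>

text \<open>The space is regarded as \<open>\<complex> \<times> \<real>\<close>, a horizontal plane and a height.\<close>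

definition mk3 :: "complex \<Rightarrow> real \<Rightarrow> real^3" where "mk3 u z = vector [Re u, Im u, z]"

definition hor :: "real^3 \<Rightarrow> complex" where "hor p = Complex (p $ 1) (p $ 2)"

lemma mk3_simps [simp]: "hor (mk3 u z) = u" "mk3 u z $ 3 = z" "mk3 (hor p) (p $ 3) = p"
  by (simp_all add: mk3_def hor_def vec_eq_iff forall_3)

lemma real3_eqI: "hor p = hor q \<Longrightarrow> p $ 3 = q $ 3 \<Longrightarrow> p = q"
  by (metis mk3_simps(3))

lemma norm_mk3: "(norm (mk3 u z))\<^sup>2 = (cmod u)\<^sup>2 + z\<^sup>2"
  by (simp add: norm_vec_def L2_set_def sum_3 mk3_def cmod_power2 sum_nonneg add_nonneg_nonneg)

lemma bounded_linear_hor: "bounded_linear hor"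
  unfolding linear_conv_bounded_linear[symmetric]
  by (auto simp: linear_iff hor_def complex_eq_iff)

lemma bounded_linear_mk3: "bounded_linear (\<lambda>q. mk3 (fst q) (snd q))"
  unfolding linear_conv_bounded_linear[symmetric]
  by (auto simp: linear_iff mk3_def vec_eq_iff forall_3)

lemma hor_linear: "hor (p + q) = hor p + hor q" "hor (p - q) = hor p - hor q" "hor (c *\<^sub>R p) = of_real c * hor p"
  by (auto simp: hor_def complex_eq_iff)

lemma has_derivative_mk3:
  assumes "(f has_derivative f') (at x within S)" "(g has_derivative g') (at x within S)"
  shows "((\<lambda>x. mk3 (f x) (g x)) has_derivative (\<lambda>h. mk3 (f' h) (g' h))) (at x within S)"
  using bounded_linear.has_derivative[OF bounded_linear_mk3 has_derivative_Pair[OF assms]] by simp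

lemma continuous_on_mk3:
  "continuous_on S f \<Longrightarrow> continuous_on S g \<Longrightarrow> continuous_on S (\<lambda>x. mk3 (f x) (g x))"
  using bounded_linear.continuous_on[OF bounded_linear_mk3 continuous_on_Pair[of S f g]] by simp

lemma continuous_on_hor: "continuous_on S f \<Longrightarrow> continuous_on S (\<lambda>x. hor (f x))"
  by (rule bounded_linear.continuous_on[OF bounded_linear_hor])

definition turn :: "real \<Rightarrow> complex" where "turn t = cis (2 * pi * t)"

lemma turn_add: "turn (s + t) = turn s * turn t"
  by (simp add: turn_def distrib_left cis_mult)

lemma turn_int [simp]: "turn (of_int k) = 1"
  unfolding turn_def using cis_multiple_2pi[of "of_int k"] by (simp add: mult.assoc)

lemma turn_0 [simp]: "turn 0 = 1" using turn_int[of 0] by simp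

lemma turn_shift_int [simp]: "turn (t + of_int k) = turn t"
  by (simp add: turn_add)

lemma norm_turn [simp]: "cmod (turn t) = 1"
  by (simp add: turn_def)

lemma sgn_turn [simp]: "sgn (turn t) = turn t"
  by (simp add: sgn_eq)

lemma turn_nonzero [simp]: "turn t \<noteq> 0"
  using norm_turn[of t] by (metis norm_zero zero_neq_one)

lemma turn_eq_iff: "turn s = turn t \<longleftrightarrow> (\<exists>k. s = t + of_int k)"
proof
  assume "turn s = turn t"
  then have "cis (2 * pi * s - 2 * pi * t) = 1"
    by (simp add: turn_def cis_divide[symmetric])
  then obtain k where "2 * pi * s - 2 * pi * t = 2 * pi * of_int k"
    by (auto simp: complex_eq_iff cos_one_2pi_int mult_ac)
  then have "2 * pi * (s - t) = 2 * pi * of_int k" by (simp add: algebra_simps)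
  then have "s = t + of_int k" by simp
  then show "\<exists>k. s = t + of_int k" by blast
qed auto

lemma has_derivative_turn:
  assumes "(g has_derivative g') (at x within S)"
  shows "((\<lambda>x. turn (g x)) has_derivative (\<lambda>h. of_real (g' h) * (2 * pi * \<i> * turn (g x)))) (at x within S)"
proof -
  have e: "turn t = exp (\<i> * of_real (2 * pi) * of_real t)" for t
    by (simp add: turn_def cis_conv_exp mult.assoc)
  have "((\<lambda>x. \<i> * of_real (2 * pi) * of_real (g x)) has_derivative (\<lambda>h. \<i> * of_real (2 * pi) * of_real (g' h))) (at x within S)"
    by (intro has_derivative_mult_right has_derivative_of_real assms)
  from has_derivative_compose[OF this, of exp "\<lambda>h. exp (\<i> * of_real (2 * pi) * of_real (g x)) * h"]
  have "((\<lambda>x. exp (\<i> * of_real (2 * pi) * of_real (g x))) has_derivative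
     (\<lambda>h. exp (\<i> * of_real (2 * pi) * of_real (g x)) * (\<i> * of_real (2 * pi) * of_real (g' h)))) (at x within S)"
    using DERIV_exp[of "\<i> * of_real (2 * pi) * of_real (g x)"] by (simp add: has_field_derivative_def)
  then show ?thesis unfolding e by (simp add: mult_ac)
qed

lemma continuous_on_turn: "continuous_on S g \<Longrightarrow> continuous_on S (\<lambda>x. turn (g x))"
  unfolding turn_def by (intro continuous_intros)

text \<open>Coordinates adapted to the horizontal circle of radius two around the vertical axis: \<open>t\<close> is the angle, measured in
  turns, and \<open>w\<close> is the position in the vertical half-plane at that angle, relative to the point of the circle.
  The functions \<open>angle\<close> and \<open>slice\<close> recover \<open>t\<close> modulo one and \<open>w\<close>.\<close>

definition tube :: "real \<Rightarrow> complex \<Rightarrow> real^3" where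
  "tube t w = mk3 (of_real (2 + Re w) * turn t) (Im w)"

definition slice :: "real^3 \<Rightarrow> complex" where
  "slice p = Complex (cmod (hor p) - 2) (p $ 3)"

definition angle :: "real^3 \<Rightarrow> real" where
  "angle p = Arg2pi (hor p) / (2 * pi)"

definition torus :: "(real^3) set" where "torus = {p. cmod (slice p) < 1}"

lemma angle_bounds: "0 \<le> angle p" "angle p < 1"
  using Arg2pi[of "hor p"] by (auto simp: angle_def)

lemma hor_angle: "hor p = of_real (cmod (hor p)) * turn (angle p)"
  using Arg2pi_eq[of "hor p"] by (simp add: turn_def angle_def cis_conv_exp mult.commute)

lemma sgn_hor: "hor p \<noteq> 0 \<Longrightarrow> sgn (hor p) = turn (angle p)"
  using hor_angle[of p] by (simp add: sgn_eq)
   (metis nonzero_mult_div_cancel_left norm_eq_zero of_real_eq_0_iff)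

lemma torus_hor: assumes "p \<in> torus" shows "1 < cmod (hor p)" "cmod (hor p) < 3" "hor p \<noteq> 0"
proof -
  have "\<bar>cmod (hor p) - 2\<bar> < 1"
    using abs_Re_le_cmod[of "slice p"] assms by (simp add: torus_def slice_def)
  then show "1 < cmod (hor p)" "cmod (hor p) < 3" by auto
  then show "hor p \<noteq> 0" by auto
qed

lemma tube_angle_slice: "tube (angle p) (slice p) = p"
  unfolding tube_def using hor_angle[of p] by (intro real3_eqI) (simp_all add: slice_def)

lemma tube_shift_int [simp]: "tube (t + of_int k) w = tube t w"
  by (simp add: tube_def)

lemma slice_tube: assumes "Re w > -2" shows "slice (tube t w) = w"
proof -
  have "cmod (of_real (2 + Re w) * turn t) = 2 + Re w"
    using assms by (simp only: norm_mult norm_of_real norm_turn) simp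
  then show ?thesis by (simp only: slice_def tube_def mk3_simps) simp
qed

lemma Re_gt_of_small: "cmod w < 1 \<Longrightarrow> Re w > -2"
  using abs_Re_le_cmod[of w] by linarith

lemma tube_in_torus: "cmod w < 1 \<Longrightarrow> tube t w \<in> torus"
  by (simp add: torus_def slice_tube Re_gt_of_small)

lemma hor_tube_nonzero: "Re w > -2 \<Longrightarrow> hor (tube t w) \<noteq> 0"
  by (simp add: tube_def flip: of_real_eq_0_iff) (metis add_eq_0_iff less_irrefl of_real_eq_0_iff of_real_add of_real_numeral)

lemma angle_tube: assumes "Re w > -2" obtains k :: int where "angle (tube t w) = t + of_int k"
proof -
  have "sgn (hor (tube t w)) = turn t"
    using assms by (simp only: tube_def mk3_simps sgn_mult sgn_of_real sgn_turn) simp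
  then have "turn (angle (tube t w)) = turn t"
    using sgn_hor[OF hor_tube_nonzero[OF assms]] by simp
  with that show thesis by (auto simp: turn_eq_iff)
qed

lemma continuous_slice: "continuous_on S slice"
proof -
  have s: "slice = (\<lambda>p. of_real (cmod (hor p) - 2) + \<i> * of_real (p $ 3))"
    by (auto simp: slice_def complex_eq_iff)
  show ?thesis
    unfolding s by (intro continuous_intros continuous_on_hor)
qed

lemma open_torus: "open torus"
  unfolding torus_def by (intro open_Collect_less continuous_on_norm continuous_slice continuous_on_const)

lemma norm_torus: "p \<in> torus \<Longrightarrow> norm p \<le> 4"
proof -
  assume p: "p \<in> torus"
  have "\<bar>p $ 3\<bar> < 1" using abs_Im_le_cmod[of "slice p"] p by (simp add: torus_def slice_def)
  then have "(p $ 3)\<^sup>2 \<le> 1" by (simp add: abs_square_le_1)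
  moreover have "(cmod (hor p))\<^sup>2 \<le> 3\<^sup>2" using torus_hor[OF p] by (intro power_mono) auto
  ultimately have "(norm p)\<^sup>2 \<le> 4\<^sup>2" using norm_mk3[of "hor p" "p $ 3"] by simp
  then show ?thesis by (rule power2_le_imp_le) simp
qed

lemma bounded_torus: "bounded torus"
  using norm_torus by (auto simp: bounded_iff)

text \<open>Near a point off the axis the angle has a differentiable branch; every function built from the
  angle by a periodic function is therefore as regular as that function.\<close>

lemma local_angle:
  assumes "hor p \<noteq> 0"
  obtains \<theta> where "\<theta> p = angle p"
    "(\<theta> has_derivative (\<lambda>v. Im (hor v / hor p) / (2 * pi))) (at p)"
    "\<forall>\<^sub>F q in nhds p. hor q \<noteq> 0 \<and> (\<exists>k. angle q = \<theta> q + of_int k)"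
proof -
  let ?\<theta> = "\<lambda>q. angle p + Im (Ln (hor q / hor p)) / (2 * pi)"
  have 1: "?\<theta> p = angle p" using assms by simp
  have dh: "(hor has_derivative hor) (at p)"
    by (rule bounded_linear_imp_has_derivative[OF bounded_linear_hor])
  have "((\<lambda>q. hor q / hor p) has_derivative (\<lambda>v. hor v / hor p)) (at p)"
    by (rule has_derivative_divide'[OF dh has_derivative_const assms, THEN has_derivative_eq_rhs])
       (use assms in \<open>auto simp: field_simps\<close>)
  moreover have "(Ln has_derivative (\<lambda>h. h)) (at (hor p / hor p))"
  proof -
    have "(*) (inverse (1::complex)) = (\<lambda>h. h)" by auto
    then show ?thesis using has_field_derivative_Ln[of 1] assms by (simp add: has_field_derivative_def)
  qed
  ultimately have "((\<lambda>q. Ln (hor q / hor p)) has_derivative (\<lambda>v. hor v / hor p)) (at p)"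
    by (rule has_derivative_compose)
  then have "((\<lambda>q. Im (Ln (hor q / hor p))) has_derivative (\<lambda>v. Im (hor v / hor p))) (at p)"
    by (rule bounded_linear.has_derivative[OF bounded_linear_Im])
  then have 2: "(?\<theta> has_derivative (\<lambda>v. Im (hor v / hor p) / (2 * pi))) (at p)"
    using has_derivative_add[OF has_derivative_const[of "angle p"] bounded_linear.has_derivative[OF bounded_linear_divide]]
    by fastforce
  have "continuous (at p) (\<lambda>q. hor q)" using dh by (rule has_derivative_continuous)
  then have "(hor \<longlongrightarrow> hor p) (nhds p)" by (simp add: continuous_within tendsto_at_iff_tendsto_nhds)
  then have "\<forall>\<^sub>F q in nhds p. hor q \<noteq> 0" using assms by (rule tendsto_imp_eventually_ne)
  then have 3: "\<forall>\<^sub>F q in nhds p. hor q \<noteq> 0 \<and> (\<exists>k. angle q = ?\<theta> q + of_int k)"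
  proof eventually_elim
    case (elim q)
    let ?z = "hor q / hor p"
    have z: "?z \<noteq> 0" using elim assms by simp
    have "?z = exp (Ln ?z)" using z by simp
    also have "\<dots> = of_real (exp (Re (Ln ?z))) * turn (Im (Ln ?z) / (2 * pi))"
      by (simp add: exp_eq_polar turn_def)
    finally have "hor q = hor p * (of_real (exp (Re (Ln ?z))) * turn (Im (Ln ?z) / (2 * pi)))"
      using assms by (simp add: field_simps)
    then have "sgn (hor q) = sgn (hor p * (of_real (exp (Re (Ln ?z))) * turn (Im (Ln ?z) / (2 * pi))))"
      by (rule arg_cong)
    then have "sgn (hor q) = sgn (hor p) * (sgn (of_real (exp (Re (Ln ?z)))) * sgn (turn (Im (Ln ?z) / (2 * pi))))"
      by (simp only: sgn_mult)
    then have "turn (angle q) = turn (?\<theta> q)"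
      using sgn_hor[OF elim] sgn_hor[OF assms] by (simp add: sgn_of_real turn_add)
    then show ?case using elim by (simp add: turn_eq_iff)
  qed
  from 1 2 3 show thesis by (rule that)
qed

text \<open>The angle jumps by one across a half-plane, and \<open>g\<close> does not see the jump.\<close>

lemma continuous_on_periodic_angle:
  fixes g :: "real \<Rightarrow> 'b::topological_space"
  assumes "continuous_on UNIV g" "\<And>t. g (t + 1) = g t" "\<And>p. p \<in> S \<Longrightarrow> hor p \<noteq> 0"
  shows "continuous_on S (\<lambda>p. g (angle p))"
proof (rule continuous_at_imp_continuous_on, rule ballI)
  fix p assume "p \<in> S"
  obtain \<theta> where \<theta>: "\<theta> p = angle p" "(\<theta> has_derivative (\<lambda>v. Im (hor v / hor p) / (2 * pi))) (at p)"
    "\<forall>\<^sub>F q in nhds p. hor q \<noteq> 0 \<and> (\<exists>k. angle q = \<theta> q + of_int k)"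
    by (rule local_angle[OF assms(3)[OF \<open>p \<in> S\<close>]])
  have "isCont g (\<theta> p)" using assms(1) by (simp add: continuous_on_eq_continuous_at)
  then have c: "isCont (\<lambda>q. g (\<theta> q)) p"
    by (rule isCont_o2[OF has_derivative_continuous[OF \<theta>(2)]])
  have "\<forall>\<^sub>F q in nhds p. g (angle q) = g (\<theta> q)"
    using \<theta>(3) by eventually_elim (auto simp: periodic_shift_int[of g, OF assms(2)])
  from isCont_cong[OF this] c show "isCont (\<lambda>q. g (angle q)) p" by simp
qed

section \<open>The tangent frame\<close>

text \<open>The tangent vector at \<open>p\<close> of a curve in tube coordinates with angular velocity \<open>\<tau>\<close> and velocity \<open>\<omega>\<close> in the slice, as
  \<open>has_derivative_tube\<close> confirms; \<open>frame_ang\<close> and \<open>frame_slc\<close> are the two components of a vector.\<close>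

definition frame :: "real^3 \<Rightarrow> real \<Rightarrow> complex \<Rightarrow> real^3" where
  "frame p \<tau> \<omega> = mk3 (sgn (hor p) * Complex (Re \<omega>) (2 * pi * \<tau> * cmod (hor p))) (Im \<omega>)"

definition frame_ang :: "real^3 \<Rightarrow> real^3 \<Rightarrow> real" where
  "frame_ang p v = Im (hor v / hor p) / (2 * pi)"

definition frame_slc :: "real^3 \<Rightarrow> real^3 \<Rightarrow> complex" where
  "frame_slc p v = Complex (inner (sgn (hor p)) (hor v)) (v $ 3)"

lemma inner_sgn_mult: "h \<noteq> 0 \<Longrightarrow> inner (sgn h) (h * z) = cmod h * Re z" for h z :: complex
proof -
  assume h: "h \<noteq> 0"
  have "inner (sgn h) (h * z) = Re (cnj (sgn h) * (h * z))" by (simp add: inner_complex_def)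
  also have "cnj (sgn h) * (h * z) = of_real (cmod h) * z"
    using h by (simp add: sgn_eq field_simps complex_norm_square[symmetric] power2_eq_square)
  finally show ?thesis by simp
qed

text \<open>Angular and slice directions are orthogonal; on the axis \<open>sgn 0 = 0\<close> annihilates the horizontal part.\<close>

lemma norm_frame:
  "(norm (frame p \<tau> \<omega>))\<^sup>2 = (cmod \<omega>)\<^sup>2 + (if hor p = 0 then - (Re \<omega>)\<^sup>2 else (2 * pi * \<tau> * cmod (hor p))\<^sup>2)"
  by (simp add: frame_def norm_mk3 norm_mult norm_sgn cmod_power2 power_mult_distrib)

lemma frame_inverse:
  assumes "hor p \<noteq> 0"
  shows "frame p (frame_ang p v) (frame_slc p v) = v"
    "frame_ang p (frame p \<tau> \<omega>) = \<tau>" "frame_slc p (frame p \<tau> \<omega>) = \<omega>"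
proof -
  let ?h = "hor p"
  have sg: "sgn ?h = ?h / of_real (cmod ?h)" by (simp add: sgn_eq)
  have hv: "hor v = ?h * (hor v / ?h)" using assms by simp
  have "Complex (cmod ?h * Re z) (cmod ?h * Im z) = of_real (cmod ?h) * z" for z
    by (simp add: complex_eq_iff)
  moreover have "inner (sgn ?h) (hor v) = cmod ?h * Re (hor v / ?h)"
    using inner_sgn_mult[OF assms, of "hor v / ?h"] assms by simp
  ultimately have "sgn ?h * Complex (inner (sgn ?h) (hor v)) (2 * pi * frame_ang p v * cmod ?h) = hor v"
    using assms by (simp add: frame_ang_def mult.commute[of _ "cmod ?h"]) (simp add: sg)
  then show "frame p (frame_ang p v) (frame_slc p v) = v"
    by (intro real3_eqI) (simp_all add: frame_def frame_slc_def)
  let ?z = "Complex (Re \<omega>) (2 * pi * \<tau> * cmod ?h)"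
  have q: "hor (frame p \<tau> \<omega>) / ?h = ?z / of_real (cmod ?h)"
    using assms by (simp add: frame_def sg)
  show "frame_ang p (frame p \<tau> \<omega>) = \<tau>"
    unfolding frame_ang_def q using assms by (simp add: Im_divide_of_real)
  have "hor (frame p \<tau> \<omega>) = ?h * (?z / of_real (cmod ?h))"
    using assms by (simp add: frame_def sg)
  then have "inner (sgn ?h) (hor (frame p \<tau> \<omega>)) = cmod ?h * Re (?z / of_real (cmod ?h))"
    by (simp only: inner_sgn_mult[OF assms])
  also have "\<dots> = Re \<omega>" using assms by (simp add: Re_divide_of_real)
  finally show "frame_slc p (frame p \<tau> \<omega>) = \<omega>"
    by (simp add: frame_slc_def complex_eq_iff) (simp add: frame_def)
qed

lemma frame_linear:
  "frame p (\<tau> + \<tau>') (\<omega> + \<omega>') = frame p \<tau> \<omega> + frame p \<tau>' \<omega>'"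
  "frame p (c * \<tau>) (of_real c * \<omega>) = c *\<^sub>R frame p \<tau> \<omega>"
  by (intro real3_eqI; simp add: frame_def hor_linear complex_eq_iff algebra_simps add_divide_distrib)+

lemma frame_zero: "frame p 0 0 = 0"
  using frame_linear(2)[of p 0 0 0] by simp

lemma continuous_on_frame:
  assumes "continuous_on S f" "continuous_on S g" "continuous_on S h" "\<And>x. x \<in> S \<Longrightarrow> hor (f x) \<noteq> 0"
  shows "continuous_on S (\<lambda>x. frame (f x) (g x) (h x))"
proof -
  have "frame (f x) (g x) (h x) = mk3 (sgn (hor (f x)) *
      (of_real (Re (h x)) + \<i> * of_real (2 * pi * g x * cmod (hor (f x))))) (Im (h x))" for x
    unfolding frame_def by (rule arg_cong2[where f = mk3]) (simp_all add: complex_eq_iff)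
  then show ?thesis
    by (simp only:) (intro continuous_on_mk3 continuous_intros continuous_on_hor assms, use assms in auto)
qed

lemma has_derivative_tube:
  assumes "(t has_derivative t') (at p)" "(w has_derivative w') (at p)"
    and "Re (w p) > -2"
  shows "((\<lambda>q. tube (t q) (w q)) has_derivative (\<lambda>v. frame (tube (t p) (w p)) (t' v) (w' v))) (at p)"
proof -
  let ?h = "hor (tube (t p) (w p))"
  have n: "cmod ?h = 2 + Re (w p)"
    using assms(3) by (simp only: tube_def mk3_simps norm_mult norm_of_real norm_turn) simp
  have s: "sgn ?h = turn (t p)"
    using assms(3) by (simp only: tube_def mk3_simps sgn_mult sgn_of_real sgn_turn) simp
  have dR: "((\<lambda>q. of_real (2 + Re (w q))) has_derivative (\<lambda>v. complex_of_real (0 + Re (w' v)))) (at p)"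
    by (intro has_derivative_of_real has_derivative_add has_derivative_const bounded_linear.has_derivative[OF bounded_linear_Re] assms)
  have "((\<lambda>q. tube (t q) (w q)) has_derivative
     (\<lambda>v. mk3 (of_real (2 + Re (w p)) * (of_real (t' v) * (2 * pi * \<i> * turn (t p)))
        + of_real (0 + Re (w' v)) * turn (t p)) (Im (w' v)))) (at p)"
    unfolding tube_def
    by (intro has_derivative_mk3 has_derivative_mult dR has_derivative_turn
          bounded_linear.has_derivative[OF bounded_linear_Im] assms)
  moreover have "of_real (2 + Re (w p)) * (of_real (t' v) * (2 * pi * \<i> * turn (t p))) + of_real (0 + Re (w' v)) * turn (t p)
      = turn (t p) * Complex (Re (w' v)) (2 * pi * t' v * (2 + Re (w p)))" for v
    by (simp add: complex_eq_iff algebra_simps)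
  ultimately show ?thesis unfolding frame_def n s by simp
qed

lemma has_derivative_slice:
  assumes "hor p \<noteq> 0" shows "(slice has_derivative frame_slc p) (at p)"
proof -
  have "slice = (\<lambda>p. of_real (cmod (hor p) - 2) + \<i> * of_real (p $ 3))"
    by (auto simp: slice_def complex_eq_iff)
  moreover have "((\<lambda>p. complex_of_real (cmod (hor p) - 2) + \<i> * of_real (p $ 3)) has_derivative
      (\<lambda>v. of_real (inner (sgn (hor p)) (hor v) - 0) + \<i> * of_real (v $ 3))) (at p)"
    using has_derivative_compose[OF bounded_linear_imp_has_derivative[OF bounded_linear_hor] has_derivative_norm[OF assms]]
    by (intro has_derivative_add has_derivative_of_real has_derivative_mult_right has_derivative_diff
          has_derivative_const bounded_linear_imp_has_derivative[OF bounded_linear_vec_nth])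
       (simp add: inner_commute)
  moreover have "frame_slc p = (\<lambda>v. of_real (inner (sgn (hor p)) (hor v) - 0) + \<i> * of_real (v $ 3))"
    by (auto simp: frame_slc_def complex_eq_iff)
  ultimately show ?thesis by simp
qed

lemma continuous_subbundleI:
  assumes "\<And>i. i < d \<Longrightarrow> continuous_on L (v i)"
    and "\<And>y. y \<in> L \<Longrightarrow> inj_on (\<lambda>i. v i y) {..<d} \<and> independent ((\<lambda>i. v i y) ` {..<d}) \<and>
          span ((\<lambda>i. v i y) ` {..<d}) = E y"
  shows "continuous_subbundle L d E"
  unfolding continuous_subbundle_def
  by (rule ballI, rule exI[of _ UNIV], rule exI[of _ v]) (use assms in simp)

section \<open>The solenoid over an expanding circle map\<close>

text \<open>A \<open>C\<^sup>1\<close> expanding circle map of degree three, given by the homeomorphism \<open>H\<close> that conjugates it to \<open>x \<mapsto> 3 * x\<close>, and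
  its derivative \<open>dF\<close>. The conjugacy describes the topological dynamics, the derivative the smooth one.\<close>

locale circle_model =
  fixes H dF :: "real \<Rightarrow> real"
  assumes lift: "circle_lift H"
    and deriv: "\<And>t. ((\<lambda>t. H (3 * inv H t)) has_real_derivative dF t) (at t)"
    and continuous_dF: "continuous_on UNIV dF"
    and dF_periodic: "\<And>t. dF (t + 1) = dF t"
    and dF_bounds: "\<And>t. 2 \<le> dF t" "\<And>t. dF t \<le> 4"
begin

abbreviation X :: "real \<Rightarrow> real" where "X \<equiv> inv H"

definition F :: "real \<Rightarrow> real" where "F t = H (3 * X t)"

lemma HX [simp]: "H (X t) = t" "X (H x) = x"
  using circle_lift_inv[OF lift] by auto

lemma F_H: "F (H x) = H (3 * x)"
  by (simp add: F_def)

lemma F_deriv: "(F has_real_derivative dF t) (at t)"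
  unfolding F_def[abs_def] by (rule deriv)

lemma H_int: "H (x + of_int k) = H x + of_int k" and X_int: "X (t + of_int k) = X t + of_int k"
  using circle_lift_int[OF lift] circle_lift_int[OF circle_lift_inv_lift[OF lift]] by auto

lemma F_int: "F (t + of_int k) = F t + 3 * of_int k"
  using H_int[of "3 * X t" "3 * k"] by (simp add: F_def X_int distrib_left)

lemma F_expand:
  assumes "s \<le> t" shows "2 * (t - s) \<le> F t - F s" "F t - F s \<le> 4 * (t - s)"
proof -
  have "\<exists>z. F t - F s = (t - s) * dF z"
  proof (cases "s = t")
    case False
    then show ?thesis using MVT2[of s t F dF] F_deriv assms by force
  qed simp
  then obtain z where "F t - F s = (t - s) * dF z" by blast
  then show "2 * (t - s) \<le> F t - F s" "F t - F s \<le> 4 * (t - s)"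
    using mult_left_mono[OF dF_bounds(1)[of z], of "t - s"] mult_left_mono[OF dF_bounds(2)[of z], of "t - s"] assms
    by (auto simp: mult.commute)
qed

text \<open>The solenoid map. The discs are shrunk by the factor \<open>1/8\<close> and shifted by half a unit vector, which keeps the
  images of the three discs with the same image angle disjoint.\<close>

definition T :: "real^3 \<Rightarrow> real^3" where
  "T p = tube (F (angle p)) (slice p / 8 + turn (angle p) / 2)"

lemma T_tube:
  assumes "Re w > -2" shows "T (tube t w) = tube (F t) (w / 8 + turn t / 2)"
proof -
  obtain k where k: "angle (tube t w) = t + of_int k" by (rule angle_tube[OF assms])
  have "F (t + of_int k) = F t + of_int (3 * k)" by (simp add: F_int)
  then show ?thesis unfolding T_def k slice_tube[OF assms] by (simp only: tube_shift_int turn_shift_int)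
qed

lemma next_slice_bound: "cmod w < 1 \<Longrightarrow> cmod (w / 8 + turn t / 2) \<le> 5 / 8"
  using norm_triangle_ineq[of "w / 8" "turn t / 2"] by (simp add: norm_divide)

lemma next_slice_Re: "cmod w < 1 \<Longrightarrow> Re (w / 8 + turn t / 2) > -2"
  by (rule Re_gt_of_small[OF le_less_trans[OF next_slice_bound]]) auto

lemma T_torus:
  assumes "p \<in> torus" shows "cmod (slice (T p)) \<le> 5 / 8" "T p \<in> torus"
proof -
  have w: "cmod (slice p) < 1" using assms by (simp add: torus_def)
  from next_slice_bound[OF this]
  have b: "cmod (slice p / 8 + turn (angle p) / 2) \<le> 5 / 8" .
  then show "cmod (slice (T p)) \<le> 5 / 8"
    unfolding T_def by (simp only: slice_tube[OF next_slice_Re[OF w]])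
  then show "T p \<in> torus" by (simp add: torus_def)
qed

lemma T_image: "T ` torus \<subseteq> torus"
  using T_torus(2) by blast

text \<open>Two different preimages under the circle map are at least a quarter turn apart, since the
  slope is at most four. Half the unit vectors at the two angles then differ by at least \<open>1/2\<close>, while the
  shrunk discs have radius \<open>1/8\<close>.\<close>

lemma T_inj: "inj_on T torus"
proof (rule inj_onI)
  fix p q assume pq: "p \<in> torus" "q \<in> torus" "T p = T q"
  define w w' where "w = slice p" and "w' = slice q"
  have w: "cmod w < 1" "cmod w' < 1" using pq by (auto simp: w_def w'_def torus_def)
  define s where "s = angle p"
  have p: "p = tube s w" "q = tube (angle q) w'"
    by (simp_all add: s_def w_def w'_def tube_angle_slice)
  have b: "Re (w / 8 + turn a / 2) > -2" "Re (w' / 8 + turn a / 2) > -2" for a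
    by (rule next_slice_Re[OF w(1)], rule next_slice_Re[OF w(2)])
  have Tp: "T p = tube (F s) (w / 8 + turn s / 2)" "T q = tube (F (angle q)) (w' / 8 + turn (angle q) / 2)"
    using T_tube[OF Re_gt_of_small[OF w(1)], of s] T_tube[OF Re_gt_of_small[OF w(2)], of "angle q"] p by simp_all
  obtain j where j: "angle (T p) = F s + of_int j" unfolding Tp by (rule angle_tube[OF b(1)])
  obtain l where l: "angle (T q) = F (angle q) + of_int l" unfolding Tp by (rule angle_tube[OF b(2)])
  define m where "m = j - l"
  have m: "F (angle q) = F s + of_int m" using j l pq(3) by (simp add: m_def)
  define t where "t = angle q - of_int (m div 3)"
  have Ft: "F t = F s + of_int (m mod 3)"
  proof -
    have "F (angle q) = F (t + of_int (m div 3))" by (simp add: t_def)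
    then have "F t = F s + of_int (m - 3 * (m div 3))" using m F_int[of t "m div 3"] by simp
    then show ?thesis by (simp add: minus_mult_div_eq_mod)
  qed
  have qt: "q = tube t w'" "turn (angle q) = turn t"
    using p(2) tube_shift_int[of t "m div 3" w'] turn_shift_int[of t "m div 3"] by (auto simp: t_def)
  have sl: "w / 8 + turn s / 2 = w' / 8 + turn t / 2"
  proof -
    have "slice (T p) = w / 8 + turn s / 2" unfolding Tp(1) by (rule slice_tube[OF b(1)])
    moreover have "slice (T q) = w' / 8 + turn (angle q) / 2" unfolding Tp(2) by (rule slice_tube[OF b(2)])
    ultimately show ?thesis using pq(3) qt(2) by metis
  qed
  have st: "s \<le> t"
  proof (rule ccontr)
    assume "\<not> s \<le> t"
    then have "2 * (s - t) \<le> F s - F t" by (intro F_expand) auto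
    moreover have "F s \<le> F t" using Ft by simp
    ultimately show False using \<open>\<not> s \<le> t\<close> by simp
  qed
  show "p = q"
  proof (cases "m mod 3 = 0")
    case True
    then have "t = s" using F_expand(1)[OF st] Ft st by simp
    then show ?thesis using sl p qt by simp
  next
    case False
    then have r: "1 \<le> m mod 3" "m mod 3 \<le> 2" using pos_mod_sign[of 3 m] pos_mod_bound[of 3 m] by linarith+
    have t4: "1 / 4 \<le> t - s" using F_expand(2)[OF st] Ft r(1) by simp
    have ts: "t \<le> s + 1"
    proof (rule ccontr)
      assume "\<not> t \<le> s + 1"
      then have "2 * (t - (s + 1)) \<le> F t - F (s + 1)" by (intro F_expand) auto
      then show False using Ft r(2) F_int[of s 1] \<open>\<not> t \<le> s + 1\<close> by simp
    qed
    have "F (s + 1) - F t \<le> 4 * (s + 1 - t)" using F_expand(2)[OF ts] .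
    then have t34: "t - s \<le> 3 / 4" using Ft r(2) F_int[of s 1] by simp
    have "Re (turn (t - s)) \<le> 0"
    proof -
      have "2 * pi * (t - s) = pi + pi * (2 * (t - s) - 1)" by (simp add: algebra_simps)
      then have "cos (2 * pi * (t - s)) = - cos (pi * (2 * (t - s) - 1))" by (simp only: cos_periodic_pi2 cos_add) simp
      moreover have "0 \<le> cos (pi * (2 * (t - s) - 1))"
      proof (rule cos_ge_zero)
        have "pi * (- (1 / 2)) \<le> pi * (2 * (t - s) - 1)" using t4 by (intro mult_left_mono) auto
        then show "- (pi / 2) \<le> pi * (2 * (t - s) - 1)" by simp
        have "pi * (2 * (t - s) - 1) \<le> pi * (1 / 2)" using t34 by (intro mult_left_mono) auto
        then show "pi * (2 * (t - s) - 1) \<le> pi / 2" by simp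
      qed
      ultimately show ?thesis by (simp add: turn_def)
    qed
    then have "1 \<le> cmod (1 - turn (t - s))" using abs_Re_le_cmod[of "1 - turn (t - s)"] by simp
    moreover have "turn t = turn s * turn (t - s)" using turn_add[of s "t - s"] by simp
    then have "cmod (turn s - turn t) = cmod (1 - turn (t - s))"
      by (metis mult.right_neutral mult_1 norm_mult norm_turn right_diff_distrib)
    moreover have "turn s - turn t = (w' - w) / 4" using sl by (simp add: field_simps) algebra
    then have "cmod (turn s - turn t) = cmod (w' - w) / 4" by (simp only: norm_divide) simp
    ultimately have False using norm_triangle_ineq4[of w' w] w by simp
    then show ?thesis ..
  qed
qed

definition DT :: "real^3 \<Rightarrow> real^3 \<Rightarrow> real^3" where
  "DT p v = frame (T p) (frame_ang p v * dF (angle p))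
     (frame_slc p v / 8 + of_real (frame_ang p v) * (2 * pi * \<i> * turn (angle p)) / 2)"

lemma T_deriv:
  assumes "p \<in> torus" shows "(T has_derivative DT p) (at p)"
proof -
  have h: "hor p \<noteq> 0" using torus_hor[OF assms] by blast
  obtain \<theta> where \<theta>: "\<theta> p = angle p" "(\<theta> has_derivative (\<lambda>v. Im (hor v / hor p) / (2 * pi))) (at p)"
    "\<forall>\<^sub>F q in nhds p. hor q \<noteq> 0 \<and> (\<exists>k. angle q = \<theta> q + of_int k)"
    by (rule local_angle[OF h])
  have d\<theta>: "(\<theta> has_derivative frame_ang p) (at p)"
    using \<theta>(2) by (simp add: frame_ang_def[abs_def])
  have dF: "((\<lambda>q. F (\<theta> q)) has_derivative (\<lambda>v. frame_ang p v * dF (\<theta> p))) (at p)"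
    by (rule DERIV_compose_FDERIV[OF F_deriv d\<theta>])
  let ?w = "\<lambda>q. slice q / 8 + turn (\<theta> q) / 2"
  have dw: "(?w has_derivative (\<lambda>v. frame_slc p v / 8 + of_real (frame_ang p v) * (2 * pi * \<i> * turn (\<theta> p)) / 2)) (at p)"
    by (intro has_derivative_add bounded_linear.has_derivative[OF bounded_linear_divide]
          has_derivative_slice h has_derivative_turn d\<theta>)
  have Tp: "T p = tube (F (\<theta> p)) (?w p)" by (simp add: T_def \<theta>(1))
  have "cmod (?w p) \<le> 5 / 8" using assms by (intro next_slice_bound) (simp add: torus_def)
  then have "Re (?w p) > -2" by (intro Re_gt_of_small) simp
  from has_derivative_tube[OF dF dw this]
  have "((\<lambda>q. tube (F (\<theta> q)) (?w q)) has_derivative DT p) (at p)"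
    unfolding DT_def Tp \<theta>(1) .
  moreover have "\<forall>\<^sub>F q in nhds p. tube (F (\<theta> q)) (?w q) = T q"
    using \<theta>(3)
  proof eventually_elim
    case (elim q)
    then obtain k where k: "angle q = \<theta> q + of_int k" by blast
    have "F (angle q) = F (\<theta> q) + of_int (3 * k)" unfolding k by (simp add: F_int)
    then show ?case unfolding T_def by (simp only: tube_shift_int) (simp add: k)
  qed
  then obtain S where "open S" "p \<in> S" "\<And>q. q \<in> S \<Longrightarrow> tube (F (\<theta> q)) (?w q) = T q"
    unfolding eventually_nhds by blast
  ultimately show ?thesis using has_derivative_transform_within_open by blast
qed

lemma continuous_T: "continuous_on torus T"
  using T_deriv has_derivative_continuous continuous_at_imp_continuous_on by blast

lemma continuous_on_turn_angle: "S \<subseteq> torus \<Longrightarrow> continuous_on S (\<lambda>p. turn (angle p))"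
  using turn_shift_int[of _ 1] torus_hor(3)
  by (intro continuous_on_periodic_angle continuous_on_turn continuous_on_id) auto

lemma continuous_on_dF_angle: "S \<subseteq> torus \<Longrightarrow> continuous_on S (\<lambda>p. dF (angle p))"
  using torus_hor(3) by (intro continuous_on_periodic_angle continuous_dF dF_periodic) auto

lemma C1_T: "C1_on T torus"
proof (rule C1_onI[OF T_deriv])
  fix v
  have hc: "continuous_on torus hor" by (rule continuous_on_hor[OF continuous_on_id])
  have n: "\<And>p. p \<in> torus \<Longrightarrow> hor p \<noteq> 0" by (rule torus_hor(3))
  have a: "continuous_on torus (\<lambda>p. frame_ang p v)"
    unfolding frame_ang_def using n by (intro continuous_intros hc) auto
  have e: "(\<lambda>p. frame_slc p v) = (\<lambda>p. of_real (inner (sgn (hor p)) (hor v)) + \<i> * of_real (v $ 3))"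
    by (auto simp: frame_slc_def complex_eq_iff)
  have s: "continuous_on torus (\<lambda>p. frame_slc p v)"
    unfolding e using n by (intro continuous_intros hc) auto
  show "continuous_on torus (\<lambda>p. DT p v)"
    unfolding DT_def
    by (intro continuous_on_frame continuous_T continuous_on_mult continuous_on_add continuous_on_divide
          continuous_on_const continuous_on_of_real a s continuous_on_dF_angle continuous_on_turn_angle subset_refl)
       (use torus_hor(3)[OF T_torus(2)] in auto)
qed

lemma DT_frame:
  assumes "p \<in> torus"
  shows "DT p (frame p \<tau> \<omega>) = frame (T p) (\<tau> * dF (angle p)) (\<omega> / 8 + of_real \<tau> * (2 * pi * \<i> * turn (angle p)) / 2)"
  unfolding DT_def using frame_inverse(2,3)[OF torus_hor(3)[OF assms]] by simp

lemma T_diffeo: "C1_diffeo_onto_image T torus"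
proof (rule C1_diffeo_onto_imageI[OF open_torus T_inj C1_T])
  fix p D assume p: "p \<in> torus" and D: "(T has_derivative D) (at p)"
  have DD: "D = DT p" by (rule has_derivative_unique[OF D T_deriv[OF p]])
  have h: "hor p \<noteq> 0" "hor (T p) \<noteq> 0" using p T_torus(2)[OF p] torus_hor(3) by auto
  show "inj D"
  proof (rule injI)
    fix u v assume "D u = D v"
    then have eq: "DT p u = DT p v" by (simp add: DD)
    have "frame_ang p u * dF (angle p) = frame_ang p v * dF (angle p)"
      using arg_cong[OF eq, of "frame_ang (T p)"] unfolding DT_def frame_inverse(2)[OF h(2)] .
    then have a: "frame_ang p u = frame_ang p v" using dF_bounds(1)[of "angle p"] by auto
    have "frame_slc p u = frame_slc p v"
      using arg_cong[OF eq, of "frame_slc (T p)"] unfolding DT_def frame_inverse(3)[OF h(2)] a by simp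
    with a show "u = v" by (metis frame_inverse(1)[OF h(1)])
  qed
qed

section \<open>Hyperbolicity\<close>

abbreviation Lam :: "(real^3) set" where "Lam \<equiv> attractor T torus"

abbreviation Tinv :: "real^3 \<Rightarrow> real^3" where "Tinv \<equiv> inv_into torus T"

lemma Lam_torus: "p \<in> Lam \<Longrightarrow> p \<in> torus"
  by (rule subsetD[OF attractor_subset])

lemma Tinv_Lam: assumes "p \<in> Lam" shows "Tinv p \<in> Lam" "T (Tinv p) = p"
  by (rule attractor_preimage[OF T_image T_inj assms])+

lemma Tinv_T: "p \<in> torus \<Longrightarrow> Tinv (T p) = p"
  by (rule inv_into_f_f[OF T_inj])

lemma T_Lam: "p \<in> Lam \<Longrightarrow> T p \<in> Lam"
  by (rule attractor_image[OF T_image])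

lemma Tinv_pow_Lam: "p \<in> Lam \<Longrightarrow> (Tinv ^^ j) p \<in> Lam"
  by (induction j) (auto intro: Tinv_Lam)

lemma T_pow_Lam: "p \<in> Lam \<Longrightarrow> (T ^^ j) p \<in> Lam"
  by (induction j) (auto intro: T_Lam)

lemma compact_Lam: "compact Lam"
proof (rule compact_attractor[OF _ _ _ continuous_T])
  let ?K = "{p. cmod (slice p) \<le> 5 / 8}"
  show "?K \<subseteq> torus" by (auto simp: torus_def)
  show "T ` torus \<subseteq> ?K" using T_torus(1) by auto
  have "closed ?K" by (intro closed_Collect_le continuous_on_norm continuous_slice continuous_on_const)
  moreover have "bounded ?K" by (rule bounded_subset[OF bounded_torus]) (auto simp: torus_def)
  ultimately show "compact ?K" by (simp add: compact_eq_bounded_closed)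
qed

lemma continuous_Tinv: "continuous_on Lam Tinv"
proof -
  have "C1_on Tinv (T ` torus)" using T_diffeo by (simp add: C1_diffeo_onto_image_def)
  then obtain f' where f': "\<And>x. x \<in> T ` torus \<Longrightarrow> (Tinv has_derivative blinfun_apply (f' x)) (at x)"
    unfolding C1_on_def by blast
  have "continuous_on (T ` torus) Tinv"
    by (intro continuous_at_imp_continuous_on ballI has_derivative_continuous[OF f'])
  moreover have "Lam \<subseteq> T ` torus"
  proof
    fix p assume "p \<in> Lam"
    then show "p \<in> T ` torus" by (intro image_eqI[of _ _ "Tinv p"] Lam_torus Tinv_Lam Tinv_Lam(2)[symmetric])
  qed
  ultimately show ?thesis by (rule continuous_on_subset)
qed

lemma continuous_Tinv_pow: "continuous_on Lam (Tinv ^^ j)"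
proof (induction j)
  case (Suc j)
  have "continuous_on Lam (\<lambda>p. Tinv ((Tinv ^^ j) p))"
    by (rule continuous_on_compose2[OF continuous_Tinv Suc]) (auto intro: Tinv_pow_Lam)
  then show ?case by (simp add: o_def)
qed (simp add: id_def)

text \<open>The unstable direction at a point of the attractor is the graph of a slope over the angular
  direction. Its invariance under the derivative is an affine recursion along the backward
  orbit, solved by a geometrically convergent series.\<close>

definition slope_term :: "nat \<Rightarrow> real^3 \<Rightarrow> complex" where
  "slope_term j p = (1 / 8) ^ j * (pi * \<i> * turn (angle ((Tinv ^^ Suc j) p)))
     / of_real (\<Prod>i<Suc j. dF (angle ((Tinv ^^ Suc i) p)))"

definition slope :: "real^3 \<Rightarrow> complex" where "slope p = (\<Sum>j. slope_term j p)"

lemma slope_term_bound: "cmod (slope_term j p) \<le> pi * (1 / 8) ^ j"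
proof -
  have "1 \<le> (\<Prod>i<Suc j. dF (angle ((Tinv ^^ Suc i) p)))"
    by (rule prod_ge_1) (use dF_bounds(1) in \<open>auto intro: order_trans[of _ 2]\<close>)
  then have "pi * (1 / 8) ^ j / \<bar>\<Prod>i<Suc j. dF (angle ((Tinv ^^ Suc i) p))\<bar> \<le> pi * (1 / 8) ^ j / 1"
    by (intro divide_left_mono) auto
  then show ?thesis
    unfolding slope_term_def norm_divide norm_mult norm_of_real norm_power by (simp add: norm_divide mult.commute)
qed

lemma summable_slope: "summable (\<lambda>j. slope_term j p)"
  by (rule summable_comparison_test'[where g = "\<lambda>j. pi * (1 / 8) ^ j" and N = 0])
     (use slope_term_bound in \<open>auto intro: summable_mult summable_geometric\<close>)

lemma slope_bound: "cmod (slope p) \<le> 2 * pi"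
proof -
  have s: "summable (\<lambda>j. pi * (1 / 8) ^ j)" by (intro summable_mult summable_geometric) simp
  have "cmod (slope p) \<le> (\<Sum>j. pi * (1 / 8) ^ j)"
    unfolding slope_def by (rule norm_suminf_le[OF slope_term_bound s])
  also have "\<dots> = pi * (8 / 7)" using suminf_geometric[of "1 / 8 :: real"] by (subst suminf_mult) (auto intro: summable_geometric)
  also have "\<dots> \<le> 2 * pi" using pi_gt_zero by linarith
  finally show ?thesis .
qed

lemma continuous_slope: "continuous_on Lam slope"
proof -
  have c: "continuous_on Lam (slope_term j)" for j
    unfolding slope_term_def
  proof (intro continuous_on_divide continuous_on_mult continuous_on_of_real continuous_on_prod continuous_on_const ballI)
    have i: "(Tinv ^^ i) ` Lam \<subseteq> torus" for i using Tinv_pow_Lam Lam_torus by blast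
    show "continuous_on Lam (\<lambda>p. turn (angle ((Tinv ^^ Suc j) p)))"
      by (rule continuous_on_compose2[OF continuous_on_turn_angle[OF i[of "Suc j"]] continuous_Tinv_pow]) auto
    show "continuous_on Lam (\<lambda>p. dF (angle ((Tinv ^^ Suc i) p)))" for i
      by (rule continuous_on_compose2[OF continuous_on_dF_angle[OF i[of "Suc i"]] continuous_Tinv_pow]) auto
    show "complex_of_real (\<Prod>i<Suc j. dF (angle ((Tinv ^^ Suc i) p))) \<noteq> 0" for p
      using dF_bounds(1) by (simp del: prod.lessThan_Suc) (metis not_numeral_le_zero)
  qed
  have "uniform_limit Lam (\<lambda>n p. \<Sum>j<n. slope_term j p) slope sequentially"
    unfolding slope_def[abs_def]
    by (rule Weierstrass_m_test[where M = "\<lambda>j. pi * (1 / 8) ^ j"])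
       (use slope_term_bound in \<open>auto intro: summable_mult summable_geometric\<close>)
  then show ?thesis
    by (rule uniform_limit_theorem[rotated]) (auto intro!: always_eventually continuous_on_sum c)
qed

lemma slope_T:
  assumes "p \<in> Lam"
  shows "of_real (dF (angle p)) * slope (T p) = slope p / 8 + pi * \<i> * turn (angle p)"
proof -
  have pow: "(Tinv ^^ Suc j) (T p) = (Tinv ^^ j) p" for j
    using Tinv_T[OF Lam_torus[OF assms]] by (simp add: funpow_Suc_right del: funpow.simps)
  have d: "dF (angle p) \<noteq> 0" using dF_bounds(1)[of "angle p"] by auto
  have 0: "of_real (dF (angle p)) * slope_term 0 (T p) = pi * \<i> * turn (angle p)"
    using d pow[of 0] by (simp add: slope_term_def)
  have S: "of_real (dF (angle p)) * slope_term (Suc j) (T p) = slope_term j p / 8" for j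
  proof -
    have "(\<Prod>i<Suc (Suc j). dF (angle ((Tinv ^^ Suc i) (T p)))) = dF (angle p) * (\<Prod>i<Suc j. dF (angle ((Tinv ^^ Suc i) p)))"
      unfolding pow by (subst prod.lessThan_Suc_shift) simp
    moreover have "of_real b * ((1 / 8) ^ Suc j * z / of_real (b * P)) = (1 / 8) ^ j * z / of_real P / 8"
      if "b \<noteq> 0" for b P :: real and z :: complex
      using that by (cases "P = 0") (simp_all add: field_simps)
    ultimately show ?thesis using d unfolding slope_term_def pow[of "Suc j"] by (simp only:)
  qed
  have "of_real (dF (angle p)) * slope (T p) = (\<Sum>j. of_real (dF (angle p)) * slope_term j (T p))"
    unfolding slope_def by (rule suminf_mult[symmetric, OF summable_slope])
  also have "\<dots> = (\<Sum>j. of_real (dF (angle p)) * slope_term (Suc j) (T p)) + of_real (dF (angle p)) * slope_term 0 (T p)"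
    unfolding suminf_split_head[OF summable_mult[OF summable_slope]] by (simp only: diff_add_cancel)
  also have "\<dots> = slope p / 8 + pi * \<i> * turn (angle p)"
    unfolding 0 S slope_def by (simp add: suminf_divide summable_slope)
  finally show ?thesis .
qed

definition Eu :: "real^3 \<Rightarrow> (real^3) set" where "Eu p = range (\<lambda>\<tau>. frame p \<tau> (of_real \<tau> * slope p))"

definition Es :: "real^3 \<Rightarrow> (real^3) set" where "Es p = range (frame p 0)"

lemma frame_scale: "frame p \<tau> (of_real \<tau> * s) = \<tau> *\<^sub>R frame p 1 s"
  using frame_linear(2)[of p \<tau> 1 s] by simp

lemma DT_unstable:
  assumes "p \<in> Lam"
  shows "DT p (frame p \<tau> (of_real \<tau> * slope p)) = frame (T p) (dF (angle p) * \<tau>) (of_real (dF (angle p) * \<tau>) * slope (T p))"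
proof -
  have "of_real \<tau> * slope p / 8 + of_real \<tau> * (2 * pi * \<i> * turn (angle p)) / 2
      = of_real \<tau> * (slope p / 8 + pi * \<i> * turn (angle p))" by (simp add: algebra_simps)
  also have "\<dots> = of_real (dF (angle p) * \<tau>) * slope (T p)"
    unfolding slope_T[OF assms, symmetric] by simp
  finally show ?thesis unfolding DT_frame[OF Lam_torus[OF assms]] by (simp add: mult.commute)
qed

lemma DT_stable: "p \<in> Lam \<Longrightarrow> DT p (frame p 0 \<omega>) = frame (T p) 0 (\<omega> / 8)"
  using DT_frame[OF Lam_torus, of p 0 \<omega>] by simp

text \<open>The number \<open>P\<close> is the derivative of the \<open>n\<close>-th iterate of the circle map at the angle of \<open>p\<close>.\<close>

lemma T_pow_deriv:
  assumes "p \<in> Lam"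
  shows "\<exists>D P. ((T ^^ n) has_derivative D) (at p) \<and> P \<ge> 2 ^ n \<and>
    (\<forall>\<omega>. D (frame p 0 \<omega>) = frame ((T ^^ n) p) 0 (\<omega> / 8 ^ n)) \<and>
    (\<forall>\<tau>. D (frame p \<tau> (of_real \<tau> * slope p)) = frame ((T ^^ n) p) (P * \<tau>) (of_real (P * \<tau>) * slope ((T ^^ n) p)))"
proof (induction n)
  case 0
  show ?case by (intro exI[of _ "\<lambda>v. v"] exI[of _ 1]) (auto simp: id_def)
next
  case (Suc n)
  then obtain D P where D: "((T ^^ n) has_derivative D) (at p)" "P \<ge> 2 ^ n"
    "\<And>\<omega>. D (frame p 0 \<omega>) = frame ((T ^^ n) p) 0 (\<omega> / 8 ^ n)"
    "\<And>\<tau>. D (frame p \<tau> (of_real \<tau> * slope p)) = frame ((T ^^ n) p) (P * \<tau>) (of_real (P * \<tau>) * slope ((T ^^ n) p))"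
    by blast
  let ?q = "(T ^^ n) p"
  have q: "?q \<in> Lam" by (rule T_pow_Lam[OF assms])
  have "((\<lambda>x. T ((T ^^ n) x)) has_derivative (\<lambda>v. DT ?q (D v))) (at p)"
    by (rule has_derivative_compose[OF D(1) T_deriv[OF Lam_torus[OF q]]])
  moreover have "dF (angle ?q) * P \<ge> 2 * 2 ^ n"
    using dF_bounds(1) D(2) by (intro mult_mono) (auto intro: order_trans[of 0 2])
  moreover have "DT ?q (D (frame p 0 \<omega>)) = frame (T ?q) 0 (\<omega> / 8 ^ Suc n)" for \<omega>
    by (simp only: D(3) DT_stable[OF q]) (simp add: mult.commute)
  moreover have "DT ?q (D (frame p \<tau> (of_real \<tau> * slope p)))
      = frame (T ?q) (dF (angle ?q) * P * \<tau>) (of_real (dF (angle ?q) * P * \<tau>) * slope (T ?q))" for \<tau>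
    by (simp only: D(4) DT_unstable[OF q] mult.assoc)
  ultimately show ?case
    by (intro exI[of _ "\<lambda>v. DT ?q (D v)"] exI[of _ "dF (angle ?q) * P"])
       (simp only: funpow.simps o_def power_Suc simp_thms)
qed

lemma Lam_hor: "p \<in> Lam \<Longrightarrow> hor p \<noteq> 0" "p \<in> Lam \<Longrightarrow> 1 < cmod (hor p)" "p \<in> Lam \<Longrightarrow> cmod (hor p) < 3"
  using torus_hor Lam_torus by auto

lemma norm_stable: "p \<in> Lam \<Longrightarrow> norm (frame p 0 \<omega>) = cmod \<omega>"
  using norm_frame[of p 0 \<omega>] Lam_hor(1)[of p] by (simp add: power2_eq_iff_nonneg)

text \<open>The distance from the axis is between one and three and the slope is at most \<open>2 * pi\<close>, so the norm on the unstable
  line is comparable to the angular component, by \<open>sqrt (9 + 1) \<le> 4\<close>.\<close>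

lemma norm_unstable:
  assumes "p \<in> Lam"
  shows "2 * pi * \<bar>\<tau>\<bar> \<le> norm (frame p \<tau> (of_real \<tau> * slope p))"
    "norm (frame p \<tau> (of_real \<tau> * slope p)) \<le> 4 * (2 * pi * \<bar>\<tau>\<bar>)"
proof -
  let ?s = "slope p" and ?r = "cmod (hor p)"
  have N: "(norm (frame p 1 ?s))\<^sup>2 = (cmod ?s)\<^sup>2 + (2 * pi)\<^sup>2 * ?r\<^sup>2"
    using norm_frame[of p 1 ?s] Lam_hor(1)[OF assms] by (simp add: power_mult_distrib)
  have r: "1 \<le> ?r\<^sup>2" "?r\<^sup>2 \<le> 9"
    using Lam_hor(2,3)[OF assms] power_mono[of 1 ?r 2] power_mono[of ?r 3 2] by auto
  have s: "(cmod ?s)\<^sup>2 \<le> (2 * pi)\<^sup>2" by (rule power_mono[OF slope_bound norm_ge_zero])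
  have "(2 * pi)\<^sup>2 * 1 \<le> (2 * pi)\<^sup>2 * ?r\<^sup>2" using r by (intro mult_left_mono) auto
  then have "(2 * pi)\<^sup>2 \<le> (norm (frame p 1 ?s))\<^sup>2" unfolding N using zero_le_power2[of "cmod ?s"] by linarith
  then have lo: "2 * pi \<le> norm (frame p 1 ?s)" by (rule power2_le_imp_le) simp
  have "(2 * pi)\<^sup>2 * ?r\<^sup>2 \<le> (2 * pi)\<^sup>2 * 9" using r by (intro mult_left_mono) auto
  then have "(norm (frame p 1 ?s))\<^sup>2 \<le> 16 * (2 * pi)\<^sup>2"
    unfolding N using s zero_le_power2[of "2 * pi"] by linarith
  also have "\<dots> = (4 * (2 * pi))\<^sup>2" by (simp add: power_mult_distrib)
  finally have hi: "norm (frame p 1 ?s) \<le> 4 * (2 * pi)" by (rule power2_le_imp_le) simp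
  show "2 * pi * \<bar>\<tau>\<bar> \<le> norm (frame p \<tau> (of_real \<tau> * slope p))"
    "norm (frame p \<tau> (of_real \<tau> * slope p)) \<le> 4 * (2 * pi * \<bar>\<tau>\<bar>)"
    using mult_right_mono[OF lo, of "\<bar>\<tau>\<bar>"] mult_right_mono[OF hi, of "\<bar>\<tau>\<bar>"]
    by (simp_all add: frame_scale mult_ac)
qed

lemma subbundle_Eu: "continuous_subbundle Lam 1 Eu"
proof -
  let ?v = "\<lambda>(i::nat) p. frame p 1 (slope p)"
  have n: "?v i y \<noteq> 0" if "y \<in> Lam" for i y
    using norm_unstable(1)[OF that, of 1] pi_gt3 by (auto simp del: pi_gt_zero)
  have "continuous_on Lam (?v i)" for i
    by (intro continuous_on_frame continuous_slope continuous_intros) (use Lam_hor in auto)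
  moreover have "span {?v 0 y} = Eu y" for y
    by (simp add: span_singleton Eu_def frame_scale)
  ultimately show ?thesis
    using n by (intro continuous_subbundleI[where v = ?v]) (auto simp: lessThan_Suc)
qed

lemma subbundle_Es: "continuous_subbundle Lam 2 Es"
proof -
  let ?v = "\<lambda>(i::nat) p. frame p 0 (if i = 0 then 1 else \<i>)"
  have cont: "continuous_on Lam (?v i)" for i
    by (intro continuous_on_frame continuous_intros) (use Lam_hor in auto)
  have S: "a *\<^sub>R ?v 0 y + b *\<^sub>R ?v 1 y = frame y 0 (Complex a b)" for y a b
  proof -
    have "of_real a * 1 + of_real b * \<i> = Complex a b" by (simp add: complex_eq_iff)
    then show ?thesis
      using frame_linear(2)[of y a 0 1] frame_linear(2)[of y b 0 \<i>]
        frame_linear(1)[of y 0 0 "of_real a * 1" "of_real b * \<i>"] by simp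
  qed
  have ind: "?v 0 y \<noteq> ?v 1 y \<and> independent {?v 0 y, ?v 1 y}" if "y \<in> Lam" for y
  proof -
    have z: "a = 0 \<and> b = 0" if "a *\<^sub>R ?v 0 y + b *\<^sub>R ?v 1 y = 0" for a b
    proof -
      have "cmod (Complex a b) = 0" using that norm_stable[OF \<open>y \<in> Lam\<close>, of "Complex a b"] unfolding S by simp
      then have "Complex a b = 0" by (simp only: norm_eq_zero)
      then show ?thesis by (simp add: complex_eq_iff)
    qed
    have "?v 1 y \<noteq> 0" using z[of 0 1] by auto
    moreover have "?v 0 y \<notin> span {?v 1 y}"
    proof
      assume "?v 0 y \<in> span {?v 1 y}"
      then obtain c where "?v 0 y = c *\<^sub>R ?v 1 y" by (auto simp: span_singleton)
      then show False using z[of 1 "- c"] by simp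
    qed
    moreover have "?v 0 y \<noteq> ?v 1 y" using calculation(2) by (metis insertI1 span_base)
    ultimately show ?thesis by (simp add: independent_insert)
  qed
  have sp: "span {?v 0 y, ?v 1 y} = Es y" for y
  proof
    show "span {?v 0 y, ?v 1 y} \<subseteq> Es y"
    proof
      fix u assume "u \<in> span {?v 0 y, ?v 1 y}"
      then obtain a where "u - a *\<^sub>R ?v 0 y \<in> span {?v 1 y}"
        unfolding span_breakdown_eq[of u "?v 0 y"] by blast
      then obtain b where "u - a *\<^sub>R ?v 0 y = b *\<^sub>R ?v 1 y"
        unfolding span_singleton by blast
      then have "u = a *\<^sub>R ?v 0 y + b *\<^sub>R ?v 1 y" by (simp only: diff_eq_eq add.commute)
      then have "u = frame y 0 (Complex a b)" unfolding S .
      then show "u \<in> Es y" by (simp add: Es_def)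
    qed
    show "Es y \<subseteq> span {?v 0 y, ?v 1 y}"
    proof
      fix u assume "u \<in> Es y"
      then obtain \<omega> where "u = frame y 0 \<omega>" by (auto simp: Es_def)
      then have "u = Re \<omega> *\<^sub>R ?v 0 y + Im \<omega> *\<^sub>R ?v 1 y" unfolding S by simp
      then show "u \<in> span {?v 0 y, ?v 1 y}" by (simp add: span_add span_scale span_base)
    qed
  qed
  have two: "{..<2::nat} = {0, 1}" by auto
  show ?thesis
  proof (rule continuous_subbundleI[where v = ?v])
    fix y assume y: "y \<in> Lam"
    have "inj_on (\<lambda>i. ?v i y) {0, 1}"
      using ind[OF y] unfolding inj_on_def by (intro ballI impI) (metis insertE singletonD)
    with ind[OF y] show "inj_on (\<lambda>i. ?v i y) {..<2} \<and> independent ((\<lambda>i. ?v i y) ` {..<2}) \<and> span ((\<lambda>i. ?v i y) ` {..<2}) = Es y"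
      unfolding two image_insert image_empty sp by blast
  qed (rule cont)
qed

lemma hyperbolic: "uniformly_hyperbolic_attractor T torus 1"
proof -
  have fd: "frechet_derivative T (at x) = DT x" if "x \<in> Lam" for x
    by (rule frechet_derivative_at[symmetric, OF T_deriv[OF Lam_torus[OF that]]])
  have "partially_hyperbolic_splitting T Lam 1 2 Eu Es 4 2 (1 / 8)"
    unfolding partially_hyperbolic_splitting_def
  proof (intro conjI ballI allI)
    fix x assume x: "x \<in> Lam"
    have d: "dF (angle x) \<noteq> 0" using dF_bounds(1)[of "angle x"] by auto
    have "DT x ` Eu x = range (\<lambda>\<tau>. frame (T x) (dF (angle x) * \<tau>) (of_real (dF (angle x) * \<tau>) * slope (T x)))"
      unfolding Eu_def image_image by (simp only: DT_unstable[OF x])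
    also have "\<dots> = (\<lambda>\<tau>. frame (T x) \<tau> (of_real \<tau> * slope (T x))) ` range (\<lambda>\<tau>. dF (angle x) * \<tau>)"
      by (simp only: image_image)
    also have "range (\<lambda>\<tau>. dF (angle x) * \<tau>) = UNIV"
      using d by (intro surjI[where f = "\<lambda>\<tau>. \<tau> / dF (angle x)"]) simp
    finally show "frechet_derivative T (at x) ` Eu x = Eu (T x)" by (simp add: fd[OF x] Eu_def)
    have "DT x ` Es x = frame (T x) 0 ` range (\<lambda>\<omega>. \<omega> / 8)"
      unfolding Es_def image_image by (simp only: DT_stable[OF x])
    also have "range (\<lambda>\<omega>::complex. \<omega> / 8) = UNIV"
      by (rule surjI[where f = "\<lambda>\<omega>. \<omega> * 8"]) simp
    finally show "frechet_derivative T (at x) ` Es x = Es (T x)" by (simp add: fd[OF x] Es_def)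
    show "Eu x \<inter> Es x = {0}"
    proof
      show "Eu x \<inter> Es x \<subseteq> {0}"
      proof
        fix u assume u: "u \<in> Eu x \<inter> Es x"
        obtain \<tau> where \<tau>: "u = frame x \<tau> (of_real \<tau> * slope x)" using u unfolding Eu_def by blast
        obtain \<omega> where \<omega>: "u = frame x 0 \<omega>" using u unfolding Es_def by blast
        have "\<tau> = frame_ang x u" unfolding \<tau> by (rule frame_inverse(2)[OF Lam_hor(1)[OF x], symmetric])
        also have "\<dots> = 0" unfolding \<omega> by (rule frame_inverse(2)[OF Lam_hor(1)[OF x]])
        finally show "u \<in> {0}" using \<tau> by (simp add: frame_zero)
      qed
      have "0 \<in> Eu x" unfolding Eu_def by (rule range_eqI[of _ _ 0]) (simp add: frame_zero)
      moreover have "0 \<in> Es x" unfolding Es_def by (rule range_eqI[of _ _ 0]) (simp add: frame_zero)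
      ultimately show "{0} \<subseteq> Eu x \<inter> Es x" by simp
    qed
    show "{u + v |u v. u \<in> Eu x \<and> v \<in> Es x} = UNIV"
    proof (rule UNIV_eq_I[THEN sym])
      fix u :: "real^3"
      let ?\<tau> = "frame_ang x u" and ?\<omega> = "frame_slc x u"
      have "u = frame x ?\<tau> (of_real ?\<tau> * slope x) + frame x 0 (?\<omega> - of_real ?\<tau> * slope x)"
        using frame_linear(1)[of x ?\<tau> 0 "of_real ?\<tau> * slope x" "?\<omega> - of_real ?\<tau> * slope x"]
          frame_inverse(1)[OF Lam_hor(1)[OF x], of u] by simp
      then show "u \<in> {u + v |u v. u \<in> Eu x \<and> v \<in> Es x}" unfolding Eu_def Es_def by blast
    qed
  next
    fix x n u assume x: "x \<in> Lam" and u: "u \<in> Es x"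
    obtain D P where D: "((T ^^ n) has_derivative D) (at x)" "\<And>\<omega>. D (frame x 0 \<omega>) = frame ((T ^^ n) x) 0 (\<omega> / 8 ^ n)"
      using T_pow_deriv[OF x, of n] by blast
    obtain \<omega> where \<omega>: "u = frame x 0 \<omega>" using u by (auto simp: Es_def)
    have "norm (D u) = norm u * (1 / 8) ^ n"
      unfolding \<omega> D(2) norm_stable[OF x] norm_stable[OF T_pow_Lam[OF x]] by (simp add: norm_divide norm_power power_one_over)
    then show "norm (frechet_derivative (T ^^ n) (at x) u) \<le> 4 * (1 / 8) ^ n * norm u"
      unfolding frechet_derivative_at[symmetric, OF D(1)] using mult_nonneg_nonneg[of "norm u" "(1 / 8) ^ n"] by simp
  next
    fix x n u assume x: "x \<in> Lam" and u: "u \<in> Eu x"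
    obtain D P where D: "((T ^^ n) has_derivative D) (at x)" "P \<ge> 2 ^ n"
      "\<And>\<tau>. D (frame x \<tau> (of_real \<tau> * slope x)) = frame ((T ^^ n) x) (P * \<tau>) (of_real (P * \<tau>) * slope ((T ^^ n) x))"
      using T_pow_deriv[OF x, of n] by blast
    obtain \<tau> where \<tau>: "u = frame x \<tau> (of_real \<tau> * slope x)" using u by (auto simp: Eu_def)
    have "inverse 4 * 2 ^ n * norm u \<le> inverse 4 * 2 ^ n * (4 * (2 * pi * \<bar>\<tau>\<bar>))"
      unfolding \<tau> by (intro mult_left_mono norm_unstable(2)[OF x]) auto
    also have "\<dots> = 2 * pi * (2 ^ n * \<bar>\<tau>\<bar>)" by simp
    also have "\<dots> \<le> 2 * pi * (P * \<bar>\<tau>\<bar>)" using D(2) by (intro mult_left_mono mult_right_mono) auto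
    also have "\<dots> = 2 * pi * \<bar>P * \<tau>\<bar>"
      using order_trans[OF zero_le_power[of 2 n] D(2)] by (simp add: abs_mult)
    also have "\<dots> \<le> norm (D u)" unfolding \<tau> D(3) by (rule norm_unstable(1)[OF T_pow_Lam[OF x]])
    finally show "inverse 4 * 2 ^ n * norm u \<le> norm (frechet_derivative (T ^^ n) (at x) u)"
      unfolding frechet_derivative_at[symmetric, OF D(1)] .
  next
    show "continuous_subbundle Lam 1 Eu" by (rule subbundle_Eu)
    show "continuous_subbundle Lam 2 Es" by (rule subbundle_Es)
  qed simp_all
  then show ?thesis unfolding uniformly_hyperbolic_attractor_def by force
qed

end

section \<open>Weak limits of empirical measures\<close>

lemma measurable_continuous_restrict:
  fixes f :: "'a::topological_space \<Rightarrow> real"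
  assumes "continuous_on U f" "sets M = sets (restrict_space borel U)"
  shows "f \<in> borel_measurable M"
  unfolding measurable_cong_sets[OF assms(2) refl]
  by (rule borel_measurable_continuous_on_restrict[OF assms(1)])

text \<open>The continuous functions \<open>max 0 (1 - n * infdist x C)\<close> decrease to the indicator of the closed set
  \<open>C\<close>, and the closed sets generate the Borel sets.\<close>

lemma measure_eq_of_continuous_integrals:
  fixes U :: "'a::metric_space set"
  assumes "prob_space \<mu>" "space \<mu> = U" "sets \<mu> = sets (restrict_space borel U)"
    and "prob_space \<nu>" "space \<nu> = U" "sets \<nu> = sets (restrict_space borel U)"
    and eq: "\<And>f :: 'a \<Rightarrow> real. continuous_on U f \<Longrightarrow> bounded (f ` U) \<Longrightarrow> integral\<^sup>L \<mu> f = integral\<^sup>L \<nu> f"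
  shows "\<mu> = \<nu>"
proof -
  interpret \<mu>: prob_space \<mu> by fact
  interpret \<nu>: prob_space \<nu> by fact
  have meas: "f \<in> borel_measurable M" if "continuous_on UNIV f" "sets M = sets (restrict_space borel U)"
    for f :: "'a \<Rightarrow> real" and M :: "'a measure"
    by (rule measurable_continuous_restrict[OF continuous_on_subset[OF that(1) subset_UNIV] that(2)])
  have closed_lim: "(\<lambda>n. integral\<^sup>L M (\<lambda>x. max 0 (1 - real n * infdist x C))) \<longlonglongrightarrow> measure M (C \<inter> U)"
    if C: "closed C" "C \<noteq> {}" and M: "prob_space M" "space M = U" "sets M = sets (restrict_space borel U)"
    for C and M :: "'a measure"
  proof -
    interpret M: prob_space M by fact
    have CM: "C \<inter> U \<in> sets M" unfolding M(3) sets_restrict_space using C(1)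
      by (intro image_eqI[of _ _ C]) auto
    have "(\<lambda>n. integral\<^sup>L M (\<lambda>x. max 0 (1 - real n * infdist x C))) \<longlonglongrightarrow> integral\<^sup>L M (indicator (C \<inter> U))"
    proof (rule integral_dominated_convergence[where w = "\<lambda>_. 1"])
      show "AE x in M. (\<lambda>n. max 0 (1 - real n * infdist x C)) \<longlonglongrightarrow> indicator (C \<inter> U) x"
      proof (rule AE_I2)
        fix x assume x: "x \<in> space M"
        show "(\<lambda>n. max 0 (1 - real n * infdist x C)) \<longlonglongrightarrow> indicator (C \<inter> U) x"
        proof (cases "x \<in> C")
          case True
          then show ?thesis using x M(2) by (simp add: indicator_def)
        next
          case False
          then have "0 < infdist x C" using C by (simp add: infdist_pos_not_in_closed)
          then obtain m where m: "1 < real m * infdist x C" by (metis ex_less_of_nat_mult)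
          have "\<forall>\<^sub>F n in sequentially. max 0 (1 - real n * infdist x C) = 0"
            using eventually_ge_at_top[of m]
          proof eventually_elim
            case (elim n)
            then have "real m * infdist x C \<le> real n * infdist x C"
              by (intro mult_right_mono) (auto simp: infdist_nonneg)
            with m show ?case by simp
          qed
          then show ?thesis using False by (simp add: indicator_def tendsto_eventually)
        qed
      qed
      show "(\<lambda>x. max 0 (1 - real n * infdist x C)) \<in> borel_measurable M" for n
        by (rule meas[OF _ M(3)]) (intro continuous_intros)
      show "AE x in M. norm (max 0 (1 - real n * infdist x C)) \<le> 1" for n
        by (rule AE_I2) (auto simp: infdist_nonneg)
    qed (use CM in auto)
    then show ?thesis using CM by simp
  qed
  have closed_eq: "emeasure \<mu> (C \<inter> U) = emeasure \<nu> (C \<inter> U)" if "closed C" for C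
  proof (cases "C = {}")
    case False
    have i: "integral\<^sup>L \<mu> (\<lambda>x. max 0 (1 - real n * infdist x C)) = integral\<^sup>L \<nu> (\<lambda>x. max 0 (1 - real n * infdist x C))" for n
    proof (rule eq)
      show "continuous_on U (\<lambda>x. max 0 (1 - real n * infdist x C))" by (intro continuous_intros)
      show "bounded ((\<lambda>x. max 0 (1 - real n * infdist x C)) ` U)"
        by (rule boundedI[where B = 1]) (auto simp: infdist_nonneg)
    qed
    have "measure \<mu> (C \<inter> U) = measure \<nu> (C \<inter> U)"
      using closed_lim[OF that False assms(1-3)] closed_lim[OF that False assms(4-6)]
      unfolding i by (rule LIMSEQ_unique)
    then show ?thesis by (simp add: \<mu>.emeasure_eq_measure \<nu>.emeasure_eq_measure)
  qed simp
  have idm: "(\<lambda>x. x) \<in> measurable \<mu> borel" "(\<lambda>x. x) \<in> measurable \<nu> borel"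
    unfolding measurable_cong_sets[OF assms(3) refl] measurable_cong_sets[OF assms(6) refl]
    by (rule measurable_restrict_space1[OF measurable_ident[unfolded id_def]])+
  have dist_eq: "distr \<mu> borel (\<lambda>x. x) = distr \<nu> borel (\<lambda>x. x)"
  proof (rule measure_eqI_generator_eq[where \<Omega> = UNIV and E = "{C. closed C}" and A = "\<lambda>_. UNIV"])
    show "sets (distr \<mu> borel (\<lambda>x. x)) = sigma_sets UNIV {C. closed C}"
      "sets (distr \<nu> borel (\<lambda>x. x)) = sigma_sets UNIV {C. closed C}"
      by (simp_all add: borel_eq_closed)
    show "emeasure (distr \<mu> borel (\<lambda>x. x)) C = emeasure (distr \<nu> borel (\<lambda>x. x)) C" if "C \<in> {C. closed C}" for C
      using that closed_eq[of C] by (simp add: emeasure_distr[OF idm(1)] emeasure_distr[OF idm(2)] assms)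
    show "emeasure (distr \<mu> borel (\<lambda>x. x)) UNIV \<noteq> \<infinity>"
      using \<mu>.emeasure_space_1 by (simp add: emeasure_distr[OF idm(1)])
  qed (auto simp: Int_stable_def)
  show ?thesis
  proof (rule measure_eqI)
    show "sets \<mu> = sets \<nu>" using assms by simp
    fix A assume "A \<in> sets \<mu>"
    then obtain B where B: "B \<in> sets borel" "A = B \<inter> U" using assms(3) by (auto simp: sets_restrict_space)
    have "emeasure (distr \<mu> borel (\<lambda>x. x)) B = emeasure (distr \<nu> borel (\<lambda>x. x)) B" by (simp only: dist_eq)
    then show "emeasure \<mu> A = emeasure \<nu> A"
      using B by (simp add: emeasure_distr[OF idm(1)] emeasure_distr[OF idm(2)] assms)
  qed
qed

lemma integral_empirical:
  fixes f :: "'a::topological_space \<Rightarrow> real"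
  assumes "T ` U \<subseteq> U" "x \<in> U" "continuous_on U f" "n > 0"
  shows "integral\<^sup>L (empirical_measure T U x n) f = (\<Sum>k<n. f ((T ^^ k) x)) / real n"
proof -
  have m: "(\<lambda>k. (T ^^ k) x) \<in> measurable (uniform_count_measure {..<n}) (restrict_space borel U)"
    using funpow_in[OF assms(1,2)] by (auto simp: measurable_def uniform_count_measure_def space_restrict_space sets_point_measure space_point_measure)
  have "integral\<^sup>L (empirical_measure T U x n) f = (\<integral>k. f ((T ^^ k) x) \<partial>uniform_count_measure {..<n})"
    unfolding empirical_measure_def
    by (rule integral_distr[OF m]) (rule measurable_continuous_restrict[OF assms(3) refl])
  also have "\<dots> = (\<Sum>k<n. f ((T ^^ k) x)) / real n"
    using assms(4) by (subst integral_uniform_count_measure) auto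
  finally show ?thesis .
qed

lemma weak_star_converges_iff:
  fixes U :: "'a::topological_space set"
  assumes "T ` U \<subseteq> U" "x \<in> U"
  shows "weak_star_converges U (empirical_measure T U x) \<mu> \<longleftrightarrow>
    (\<forall>f :: 'a \<Rightarrow> real. continuous_on U f \<and> bounded (f ` U) \<longrightarrow> averages_to (\<lambda>k. f ((T ^^ k) x)) (integral\<^sup>L \<mu> f))"
proof -
  have "(\<lambda>n. integral\<^sup>L (empirical_measure T U x n) f) \<longlonglongrightarrow> c \<longleftrightarrow> averages_to (\<lambda>k. f ((T ^^ k) x)) c"
    if "continuous_on U f" for f :: "'a \<Rightarrow> real" and c
    unfolding averages_to_def
  proof (rule tendsto_cong)
    show "\<forall>\<^sub>F n in sequentially. integral\<^sup>L (empirical_measure T U x n) f = (\<Sum>k<n. f ((T ^^ k) x)) / real n"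
      using eventually_gt_at_top[of 0] by eventually_elim (rule integral_empirical[OF assms that])
  qed
  then show ?thesis unfolding weak_star_converges_def by blast
qed

lemma averages_to_unique: "averages_to z b \<Longrightarrow> averages_to z c \<Longrightarrow> b = c"
  unfolding averages_to_def by (rule LIMSEQ_unique)

lemma averages_to_unSuc:
  assumes "averages_to (\<lambda>k. z (Suc k)) c" shows "averages_to z c"
proof -
  let ?S = "\<lambda>n. \<Sum>k<n. z (Suc k)"
  have "(\<lambda>n. z 0 / real (Suc n) + ?S n / real n * (1 - 1 / real (Suc n))) \<longlonglongrightarrow> 0 + c * (1 - 0)"
    by (intro tendsto_add tendsto_mult tendsto_diff tendsto_const assms[unfolded averages_to_def]
          LIMSEQ_Suc[OF lim_const_over_n] LIMSEQ_Suc[OF lim_1_over_n])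
  moreover have "z 0 / real (Suc n) + ?S n / real n * (1 - 1 / real (Suc n)) = (\<Sum>k<Suc n. z k) / real (Suc n)" for n
  proof (cases "n = 0")
    case False
    have "1 - 1 / real (Suc n) = real n / real (Suc n)" by (simp add: field_simps)
    then show ?thesis using False unfolding sum.lessThan_Suc_shift
      by (simp del: of_nat_Suc add: add_divide_distrib)
  qed simp
  ultimately have "(\<lambda>n. (\<Sum>k<Suc n. z k) / real (Suc n)) \<longlonglongrightarrow> c" by simp
  then show ?thesis unfolding averages_to_def by (rule LIMSEQ_imp_Suc)
qed

lemma averages_to_unshift: "averages_to (\<lambda>k. z (k + n)) c \<Longrightarrow> averages_to z c"
proof (induction n)
  case (Suc n)
  then show ?case using averages_to_unSuc[of "\<lambda>k. z (k + n)" c] by simp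
qed simp

section \<open>The natural extension\<close>

text \<open>The inverse of the baker map on the unit square. It preserves the Lebesgue measure, and it
  realizes the natural extension of \<open>x \<mapsto> 3 * x\<close>: the second coordinate chooses the backward
  orbit of the first.\<close>

definition baker_inv :: "real \<times> real \<Rightarrow> real \<times> real" where
  "baker_inv q = ((fst q + of_int \<lfloor>3 * snd q\<rfloor>) / 3, 3 * snd q - of_int \<lfloor>3 * snd q\<rfloor>)"

lemma fst_snd_measurable: "(fst :: real \<times> real \<Rightarrow> real) \<in> borel_measurable borel"
  "(snd :: real \<times> real \<Rightarrow> real) \<in> borel_measurable borel"
  by (intro borel_measurable_continuous_onI continuous_intros)+

lemma baker_inv_measurable: "baker_inv \<in> borel_measurable borel"
proof -
  have "(\<lambda>q :: real \<times> real. 3 * snd q) \<in> borel_measurable borel"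
    by (intro borel_measurable_continuous_onI continuous_intros)
  from measurable_compose[OF this borel_measurable_real_floor]
  have "(\<lambda>q :: real \<times> real. real_of_int \<lfloor>3 * snd q\<rfloor>) \<in> borel_measurable borel" .
  then show ?thesis unfolding baker_inv_def[abs_def]
    by (intro borel_measurable_Pair borel_measurable_divide borel_measurable_add borel_measurable_diff
          borel_measurable_times borel_measurable_const fst_snd_measurable)
qed

lemma baker_inv_pow_measurable: "(baker_inv ^^ n) \<in> borel_measurable borel"
proof (induction n)
  case (Suc n)
  then have "(\<lambda>q. baker_inv ((baker_inv ^^ n) q)) \<in> borel_measurable borel"
    by (rule measurable_compose[OF _ baker_inv_measurable])
  then show ?case by (simp add: o_def)
qed (simp add: id_def)

interpretation sq: pair_prob_space ui ui ..

abbreviation square :: "(real \<times> real) measure" where "square \<equiv> ui \<Otimes>\<^sub>M ui"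

lemma measurable_square:
  assumes "f \<in> borel_measurable borel" shows "f \<in> borel_measurable square"
proof -
  have ui: "(\<lambda>x. x) \<in> measurable ui borel" by (rule measurable_ui) simp
  have "(\<lambda>q. (fst q, snd q)) \<in> measurable square (borel \<Otimes>\<^sub>M borel)"
    by (intro measurable_Pair measurable_compose[OF measurable_fst ui] measurable_compose[OF measurable_snd ui])
  then have "(\<lambda>q. q) \<in> measurable square borel" by (simp add: borel_prod)
  from measurable_compose[OF this assms] show ?thesis by simp
qed

lemma integrable_square:
  assumes "f \<in> borel_measurable borel" "\<And>q. \<bar>f q\<bar> \<le> B" shows "integrable square (f :: _ \<Rightarrow> real)"
  by (rule sq.P.integrable_const_bound[where B = B]) (use assms measurable_square in auto)

lemma integral_baker_inv:
  fixes f :: "real \<times> real \<Rightarrow> real"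
  assumes f: "f \<in> borel_measurable borel" "\<And>q. \<bar>f q\<bar> \<le> B"
  shows "(\<integral>q. f (baker_inv q) \<partial>square) = (\<integral>q. f q \<partial>square)"
proof -
  have bb: "bdd_borel (\<lambda>y. f (u y, v y))" if "u \<in> borel_measurable borel" "v \<in> borel_measurable borel" for u v
  proof -
    have "(\<lambda>y. (u y, v y)) \<in> borel_measurable borel"
      by (intro borel_measurable_Pair that)
    from measurable_compose[OF this f(1)] show ?thesis using f(2) by (auto simp: bdd_borel_def)
  qed
  have fl: "(\<lambda>y::real. real_of_int \<lfloor>3 * y\<rfloor>) \<in> borel_measurable borel"
    by (rule measurable_compose[OF _ borel_measurable_real_floor]) simp
  have i: "integrable square (\<lambda>q. f ((fst q + c) / 3, snd q))" for c
  proof (rule integrable_square)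
    have "(\<lambda>q :: real \<times> real. ((fst q + c) / 3, snd q)) \<in> borel_measurable borel"
      by (intro borel_measurable_continuous_onI continuous_intros) auto
    from measurable_compose[OF this f(1)] show "(\<lambda>q. f ((fst q + c) / 3, snd q)) \<in> borel_measurable borel" .
  qed (rule f(2))
  have "(\<integral>q. f (baker_inv q) \<partial>square) = (\<integral>x. \<integral>y. f (baker_inv (x, y)) \<partial>ui \<partial>ui)"
    by (rule sq.integral_fst'[symmetric])
       (rule integrable_square[OF measurable_compose[OF baker_inv_measurable f(1)] f(2)])
  also have "\<dots> = (\<integral>x. \<integral>y. (f ((x + 0) / 3, y) + f ((x + 1) / 3, y) + f ((x + 2) / 3, y)) / 3 \<partial>ui \<partial>ui)"
  proof (rule Bochner_Integration.integral_cong[OF refl])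
    fix x
    have "(\<integral>y. f (baker_inv (x, y)) \<partial>ui) = integral\<^sup>L ui (tri_avg (\<lambda>y. f (baker_inv (x, y))))"
      unfolding baker_inv_def fst_conv snd_conv
      by (rule integral_tri_avg[symmetric], rule bb) (use fl in measurable)
    also have "\<dots> = (\<integral>y. (f ((x + 0) / 3, y) + f ((x + 1) / 3, y) + f ((x + 2) / 3, y)) / 3 \<partial>ui)"
    proof (rule Bochner_Integration.integral_cong[OF refl])
      fix y assume "y \<in> space ui"
      then have y: "\<lfloor>y\<rfloor> = 0" by (simp add: floor_eq_iff)
      have "baker_inv (x, (y + of_int c) / 3) = ((x + of_int c) / 3, y)" for c
      proof -
        have e: "3 * ((y + of_int c) / 3) = y + of_int c" by simp
        show ?thesis unfolding baker_inv_def fst_conv snd_conv e using y by simp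
      qed
      from this[of 0] this[of 1] this[of 2]
      show "tri_avg (\<lambda>y. f (baker_inv (x, y))) y = (f ((x + 0) / 3, y) + f ((x + 1) / 3, y) + f ((x + 2) / 3, y)) / 3"
        by (simp add: tri_avg_def)
    qed
    finally show "(\<integral>y. f (baker_inv (x, y)) \<partial>ui) = (\<integral>y. (f ((x + 0) / 3, y) + f ((x + 1) / 3, y) + f ((x + 2) / 3, y)) / 3 \<partial>ui)" .
  qed
  also have "\<dots> = (\<integral>y. \<integral>x. (f ((x + 0) / 3, y) + f ((x + 1) / 3, y) + f ((x + 2) / 3, y)) / 3 \<partial>ui \<partial>ui)"
  proof -
    have "integrable square (\<lambda>q. (f ((fst q + 0) / 3, snd q) + f ((fst q + 1) / 3, snd q) + f ((fst q + 2) / 3, snd q)) / 3)"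
      by (intro Bochner_Integration.integrable_divide Bochner_Integration.integrable_add i)
    then show ?thesis
      using sq.Fubini_integral[of "\<lambda>x y. (f ((x + 0) / 3, y) + f ((x + 1) / 3, y) + f ((x + 2) / 3, y)) / 3"]
      by (simp add: case_prod_beta')
  qed
  also have "\<dots> = (\<integral>y. \<integral>x. f (x, y) \<partial>ui \<partial>ui)"
  proof (rule Bochner_Integration.integral_cong[OF refl])
    fix y
    have "bdd_borel (\<lambda>x. f (x, y))" by (rule bb) auto
    from integral_tri_avg[OF this]
    show "(\<integral>x. (f ((x + 0) / 3, y) + f ((x + 1) / 3, y) + f ((x + 2) / 3, y)) / 3 \<partial>ui) = (\<integral>x. f (x, y) \<partial>ui)"
      by (simp add: tri_avg_def[abs_def])
  qed
  also have "\<dots> = (\<integral>q. f q \<partial>square)"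
    using sq.integral_snd[of "\<lambda>x y. f (x, y)"] integrable_square[OF f] by simp
  finally show ?thesis .
qed

lemma integral_fst_baker_inv_pow:
  assumes "bdd_borel g" shows "(\<integral>q. g (fst ((baker_inv ^^ n) q)) \<partial>square) = integral\<^sup>L ui g"
proof -
  obtain B where B: "\<And>x. \<bar>g x\<bar> \<le> B" and g: "g \<in> borel_measurable borel" using assms by (auto simp: bdd_borel_def)
  have m: "(\<lambda>q. g (fst ((baker_inv ^^ n) q))) \<in> borel_measurable borel" for n
    by (rule measurable_compose[OF measurable_compose[OF baker_inv_pow_measurable fst_snd_measurable(1)] g])
  show ?thesis
  proof (induction n)
    case 0
    have "(\<integral>q. g (fst q) \<partial>square) = (\<integral>x. \<integral>y. g (fst (x, y)) \<partial>ui \<partial>ui)"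
      by (rule sq.integral_fst'[symmetric]) (rule integrable_square[OF m[of 0, simplified] B])
    then show ?case using ui.prob_space by simp
  next
    case (Suc n)
    have "(\<integral>q. g (fst ((baker_inv ^^ Suc n) q)) \<partial>square) = (\<integral>q. g (fst ((baker_inv ^^ n) (baker_inv q))) \<partial>square)"
      by (simp add: funpow_swap1)
    also have "\<dots> = (\<integral>q. g (fst ((baker_inv ^^ n) q)) \<partial>square)"
      by (rule integral_baker_inv[OF m B])
    finally show ?case using Suc by simp
  qed
qed

section \<open>The physical measure\<close>

lemma dist_tube_same_angle: "dist (tube s a) (tube s b) = cmod (a - b)"
proof -
  have "tube s a - tube s b = mk3 (of_real (Re (a - b)) * turn s) (Im (a - b))"
    by (intro real3_eqI) (simp_all add: tube_def hor_linear algebra_simps)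
  then have "(dist (tube s a) (tube s b))\<^sup>2 = (cmod (a - b))\<^sup>2"
    unfolding dist_norm by (simp add: norm_mk3 norm_mult cmod_power2)
  then show ?thesis by (simp add: power2_eq_iff_nonneg)
qed

lemma compact_inner_tube: "compact {p. cmod (slice p) \<le> 5 / 8}" "{p. cmod (slice p) \<le> 5 / 8} \<subseteq> torus"
proof -
  show "{p. cmod (slice p) \<le> 5 / 8} \<subseteq> torus" by (auto simp: torus_def)
  then have "bounded {p. cmod (slice p) \<le> 5 / 8}" by (rule bounded_subset[OF bounded_torus])
  moreover have "closed {p. cmod (slice p) \<le> 5 / 8}"
    by (intro closed_Collect_le continuous_on_norm continuous_slice continuous_on_const)
  ultimately show "compact {p. cmod (slice p) \<le> 5 / 8}" by (simp add: compact_eq_bounded_closed)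
qed

context circle_model
begin

text \<open>The slice coordinate of a point of the attractor whose preimages have the angles \<open>H (x 0), H (x 1), \<dots>\<close>, obtained by
  iterating \<open>w \<mapsto> w / 8 + turn t / 2\<close>; in \<open>geo\<close> the past is cut off after \<open>n\<close> steps.\<close>

definition geo :: "(nat \<Rightarrow> real) \<Rightarrow> nat \<Rightarrow> complex" where
  "geo x n = (\<Sum>j<n. (1 / 8) ^ j * (turn (H (x j)) / 2))"

definition geo_lim :: "(nat \<Rightarrow> real) \<Rightarrow> complex" where
  "geo_lim x = (\<Sum>j. (1 / 8) ^ j * (turn (H (x j)) / 2))"

lemma geo_term: "cmod ((1 / 8) ^ j * (turn t / 2)) \<le> (1 / 2) * (1 / 8) ^ j"
  by (simp add: norm_mult norm_divide norm_power power_divide)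

lemma summable_half_geometric: "summable (\<lambda>j. (1 / 2) * (1 / 8) ^ j :: real)"
  by (intro summable_mult summable_geometric) simp

lemma summable_geo: "summable (\<lambda>j. (1 / 8) ^ j * (turn (H (x j)) / 2))"
  by (rule summable_comparison_test'[OF summable_half_geometric]) (rule geo_term)

lemma geo_Suc: "geo x (Suc n) = turn (H (x 0)) / 2 + geo (\<lambda>j. x (Suc j)) n / 8"
  by (simp add: geo_def sum.lessThan_Suc_shift sum_divide_distrib del: sum.lessThan_Suc)

lemma geo_lim_Suc: "geo_lim x = turn (H (x 0)) / 2 + geo_lim (\<lambda>j. x (Suc j)) / 8"
proof -
  have "geo_lim x = (\<Sum>j. (1 / 8) ^ Suc j * (turn (H (x (Suc j))) / 2)) + turn (H (x 0)) / 2"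
    unfolding geo_lim_def using suminf_split_head[OF summable_geo[of x]] by simp
  also have "(\<Sum>j. (1 / 8) ^ Suc j * (turn (H (x (Suc j))) / 2)) = geo_lim (\<lambda>j. x (Suc j)) / 8"
    unfolding geo_lim_def using suminf_divide[OF summable_geo[of "\<lambda>j. x (Suc j)"], of 8] by simp
  finally show ?thesis by simp
qed

lemma geo_bound: "cmod (geo x n) \<le> 5 / 8" "cmod (geo_lim x) \<le> 5 / 8" "cmod (geo_lim x - geo x n) \<le> (1 / 8) ^ n"
proof -
  have s: "(\<Sum>j. (1 / 2) * (1 / 8) ^ j) = (4 / 7 :: real)"
    using suminf_geometric[of "1 / 8 :: real"] by (subst suminf_mult) (auto intro: summable_geometric)
  have "cmod (geo x n) \<le> (\<Sum>j<n. (1 / 2) * (1 / 8) ^ j)"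
    unfolding geo_def by (rule order_trans[OF norm_sum]) (intro sum_mono geo_term)
  also have "\<dots> \<le> (\<Sum>j. (1 / 2) * (1 / 8) ^ j)" by (rule sum_le_suminf[OF summable_half_geometric]) auto
  finally show "cmod (geo x n) \<le> 5 / 8" using s by simp
  have lim: "cmod (geo_lim x) \<le> 4 / 7" for x
    using norm_suminf_le[OF geo_term summable_half_geometric] s unfolding geo_lim_def by metis
  then show "cmod (geo_lim x) \<le> 5 / 8" by (rule order_trans) simp
  show "cmod (geo_lim x - geo x n) \<le> (1 / 8) ^ n"
  proof (induction n arbitrary: x)
    case 0
    show ?case using lim[of x] by (simp add: geo_def)
  next
    case (Suc n)
    have "geo_lim x - geo x (Suc n) = (geo_lim (\<lambda>j. x (Suc j)) - geo (\<lambda>j. x (Suc j)) n) / 8"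
      unfolding geo_lim_Suc[of x] geo_Suc by (simp add: diff_divide_distrib)
    then have "cmod (geo_lim x - geo x (Suc n)) = cmod (geo_lim (\<lambda>j. x (Suc j)) - geo (\<lambda>j. x (Suc j)) n) / 8"
      by (simp only: norm_divide) simp
    then show ?case using Suc[of "\<lambda>j. x (Suc j)"] by simp
  qed
qed

lemma small_norm: "cmod w \<le> 5 / 8 \<Longrightarrow> cmod w < 1" "cmod w \<le> 5 / 8 \<Longrightarrow> Re w > -2"
  using Re_gt_of_small[of w] by auto

lemma T_pow_tube:
  assumes "cmod w < 1" "cmod w' < 1"
  shows "\<exists>a b. (T ^^ n) (tube (H x) w) = tube (H (3 ^ n * x)) a \<and> (T ^^ n) (tube (H x) w') = tube (H (3 ^ n * x)) b
    \<and> a - b = (w - w') / 8 ^ n \<and> cmod a < 1 \<and> cmod b < 1"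
proof (induction n)
  case 0
  show ?case using assms by (intro exI[of _ w] exI[of _ w']) simp
next
  case (Suc n)
  then obtain a b where ab: "(T ^^ n) (tube (H x) w) = tube (H (3 ^ n * x)) a"
    "(T ^^ n) (tube (H x) w') = tube (H (3 ^ n * x)) b" "a - b = (w - w') / 8 ^ n" "cmod a < 1" "cmod b < 1"
    by blast
  let ?t = "turn (H (3 ^ n * x)) / 2"
  have F3: "F (H (3 ^ n * x)) = H (3 ^ Suc n * x)" by (simp add: F_H mult.assoc)
  have "(T ^^ Suc n) (tube (H x) w) = tube (H (3 ^ Suc n * x)) (a / 8 + ?t)"
    "(T ^^ Suc n) (tube (H x) w') = tube (H (3 ^ Suc n * x)) (b / 8 + ?t)"
    using T_tube[OF Re_gt_of_small[OF ab(4)], of "H (3 ^ n * x)"] T_tube[OF Re_gt_of_small[OF ab(5)], of "H (3 ^ n * x)"]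
    unfolding F3 by (simp_all only: funpow.simps o_apply ab)
  moreover have "(a / 8 + ?t) - (b / 8 + ?t) = (w - w') / 8 ^ Suc n"
    using ab(3) by (simp add: diff_divide_distrib[symmetric])
  moreover have "cmod (a / 8 + ?t) < 1" "cmod (b / 8 + ?t) < 1"
    using next_slice_bound[OF ab(4)] next_slice_bound[OF ab(5)] small_norm(1) by blast+
  ultimately show ?case by blast
qed

lemma T_pow_torus: "p \<in> torus \<Longrightarrow> (T ^^ n) p \<in> torus"
  by (rule funpow_in[OF T_image])

lemma continuous_T_pow: "continuous_on torus (T ^^ n)"
proof (induction n)
  case (Suc n)
  have "continuous_on torus (\<lambda>p. T ((T ^^ n) p))"
    by (rule continuous_on_compose2[OF continuous_T Suc]) (auto intro: T_pow_torus)
  then show ?case by (simp add: o_def)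
qed (simp add: id_def)

definition past :: "real \<times> real \<Rightarrow> nat \<Rightarrow> real" where
  "past q j = fst ((baker_inv ^^ Suc j) q)"

text \<open>The point of the attractor with conjugate angle \<open>fst q\<close> and the past chosen by \<open>snd q\<close>.\<close>

definition lift_pt :: "real \<times> real \<Rightarrow> real^3" where
  "lift_pt q = tube (H (fst q)) (geo_lim (past q))"

definition lift_approx :: "nat \<Rightarrow> real \<times> real \<Rightarrow> real^3" where
  "lift_approx n q = tube (H (fst q)) (geo (past q) n)"

lemma past_Suc: "(\<lambda>j. past q (Suc j)) = past (baker_inv q)"
  by (simp add: past_def funpow_swap1 fun_eq_iff)

text \<open>Forgetting the past beyond \<open>n\<close> steps means starting on the core circle \<open>n\<close> steps earlier.\<close>

lemma lift_approx_eq: "lift_approx n q = (T ^^ n) (tube (H (fst ((baker_inv ^^ n) q))) 0)"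
proof (induction n arbitrary: q)
  case 0
  show ?case by (simp add: lift_approx_def geo_def)
next
  case (Suc n)
  let ?q = "baker_inv q"
  have "3 * fst ?q = fst q + of_int \<lfloor>3 * snd q\<rfloor>" by (simp add: baker_inv_def)
  then have FH: "F (H (fst ?q)) = H (fst q) + of_int \<lfloor>3 * snd q\<rfloor>" by (simp add: F_H H_int)
  have "T (lift_approx n ?q) = tube (H (fst q)) (geo (past ?q) n / 8 + turn (H (fst ?q)) / 2)"
    unfolding lift_approx_def T_tube[OF small_norm(2)[OF geo_bound(1)]] FH by simp
  also have "\<dots> = lift_approx (Suc n) q"
    unfolding lift_approx_def geo_Suc past_Suc by (simp add: past_def add.commute)
  finally have "lift_approx (Suc n) q = T ((T ^^ n) (tube (H (fst ((baker_inv ^^ n) ?q))) 0))"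
    using Suc[of ?q] by simp
  then show ?case by (simp add: funpow_swap1)
qed

lemma lift_in: "lift_pt q \<in> {p. cmod (slice p) \<le> 5 / 8}" "lift_approx n q \<in> {p. cmod (slice p) \<le> 5 / 8}"
  using geo_bound(1,2) by (simp_all add: lift_pt_def lift_approx_def slice_tube small_norm(2))

lemma lift_approx_close: "dist (lift_pt q) (lift_approx n q) \<le> (1 / 8) ^ n"
  unfolding lift_pt_def lift_approx_def dist_tube_same_angle by (rule geo_bound(3))

lemma continuous_H: "continuous_on UNIV H"
  using lift by (simp add: circle_lift_def)

lemma continuous_on_tube:
  "continuous_on S f \<Longrightarrow> continuous_on S g \<Longrightarrow> continuous_on S (\<lambda>x. tube (f x) (g x))"
  unfolding tube_def by (intro continuous_on_mk3 continuous_on_turn continuous_intros)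

lemma lift_approx_measurable: "lift_approx n \<in> borel_measurable borel"
proof -
  have c: "continuous_on UNIV (\<lambda>x. (T ^^ n) (tube (H x) 0))"
    by (rule continuous_on_compose2[OF continuous_T_pow continuous_on_tube[OF continuous_H continuous_on_const]])
       (auto intro: tube_in_torus)
  have "(\<lambda>q. fst ((baker_inv ^^ n) q)) \<in> borel_measurable borel"
    by (rule measurable_compose[OF baker_inv_pow_measurable fst_snd_measurable(1)])
  from measurable_compose[OF this borel_measurable_continuous_onI[OF c]]
  show ?thesis unfolding lift_approx_eq[abs_def] .
qed

lemma lift_pt_measurable: "lift_pt \<in> borel_measurable borel"
proof (rule borel_measurable_LIMSEQ_metric[OF lift_approx_measurable])
  fix q
  have "(\<lambda>n. dist (lift_approx n q) (lift_pt q)) \<longlonglongrightarrow> 0"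
  proof (rule tendsto_sandwich[OF _ _ tendsto_const])
    show "\<forall>\<^sub>F n in sequentially. dist (lift_approx n q) (lift_pt q) \<le> (1 / 8) ^ n"
      using lift_approx_close by (simp add: dist_commute)
    show "(\<lambda>n. (1 / 8) ^ n :: real) \<longlonglongrightarrow> 0" by (intro LIMSEQ_power_zero) simp
  qed simp
  then show "(\<lambda>n. lift_approx n q) \<longlonglongrightarrow> lift_pt q" by (rule tendsto_dist_iff[THEN iffD2])
qed

definition phys :: "(real^3) measure" where
  "phys = distr square (restrict_space borel torus) lift_pt"

lemma lift_pt_meas: "lift_pt \<in> measurable square (restrict_space borel torus)"
  using lift_in(1) compact_inner_tube(2) measurable_square[OF lift_pt_measurable]
  by (intro measurable_restrict_space2) auto

lemma phys_space: "space phys = torus" "sets phys = sets (restrict_space borel torus)" "prob_space phys"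
proof -
  show "prob_space phys" unfolding phys_def by (rule sq.P.prob_space_distr[OF lift_pt_meas])
qed (simp_all add: phys_def space_restrict_space)

lemma integral_phys: "continuous_on torus f \<Longrightarrow> integral\<^sup>L phys f = (\<integral>q. f (lift_pt q) \<partial>square)"
  for f :: "real^3 \<Rightarrow> real"
  unfolding phys_def
  by (rule integral_distr[OF lift_pt_meas]) (rule measurable_continuous_restrict[OF _ refl])

text \<open>Iterating \<open>n\<close> times makes an observable depend on the angle alone up to a small error, because
  the discs are contracted. Equidistribution of the angles then gives the averages of the
  approximate observable, and the natural extension identifies the limit.\<close>

lemma equidistributed_orbit:
  fixes f :: "real^3 \<Rightarrow> real"
  assumes "equidistributed x" "cmod w < 1" "continuous_on torus f" "bounded (f ` torus)"
  shows "averages_to (\<lambda>k. f ((T ^^ k) (tube (H x) w))) (integral\<^sup>L phys f)"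
proof (rule averages_to_close)
  fix e :: real assume e: "e > 0"
  let ?K = "{p. cmod (slice p) \<le> 5 / 8}"
  let ?p = "tube (H x) w"
  have uc: "uniformly_continuous_on ?K f"
    by (intro compact_uniformly_continuous compact_inner_tube(1) continuous_on_subset[OF assms(3) compact_inner_tube(2)])
  obtain d where d: "d > 0" "\<And>p q. p \<in> ?K \<Longrightarrow> q \<in> ?K \<Longrightarrow> dist q p < d \<Longrightarrow> dist (f q) (f p) < e"
    using uc e unfolding uniformly_continuous_on_def by metis
  obtain m where m: "(1 / 8) ^ m < d" using real_arch_pow_inv[of d "1 / 8"] d(1) by auto
  define n where "n = Suc m"
  have n: "(1 / 8) ^ n < d" "n \<noteq> 0" using m d(1) by (auto simp: n_def)
  define G where "G y = f ((T ^^ n) (tube (H y) 0))" for y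
  obtain B where B: "\<And>p. p \<in> torus \<Longrightarrow> \<bar>f p\<bar> \<le> B" using assms(4) by (auto simp: bounded_iff)
  have cG: "continuous_on UNIV G"
    unfolding G_def
    by (rule continuous_on_compose2[OF assms(3)],
        rule continuous_on_compose2[OF continuous_T_pow continuous_on_tube[OF continuous_H continuous_on_const]])
       (auto intro!: tube_in_torus T_pow_torus)
  have pG: "G (y + 1) = G y" for y
    using H_int[of y 1] tube_shift_int[of "H y" 1 0] by (simp add: G_def)
  have bG: "bdd_borel G"
  proof -
    have "\<bar>G y\<bar> \<le> B" for y unfolding G_def by (intro B T_pow_torus tube_in_torus) simp
    then show ?thesis using borel_measurable_continuous_onI[OF cG] by (auto simp: bdd_borel_def)
  qed
  have av: "averages_to (\<lambda>k. G (3 ^ k * x)) (integral\<^sup>L ui G)"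
    using assms(1) cG pG unfolding equidistributed_def by blast
  have Kn: "(T ^^ n) p \<in> ?K" if "p \<in> torus" for p
  proof -
    have "T ((T ^^ m) p) \<in> ?K" using T_torus(1)[OF T_pow_torus[OF that]] by simp
    then show ?thesis by (simp add: n_def)
  qed
  have close: "\<bar>f ((T ^^ (k + n)) ?p) - G (3 ^ k * x)\<bar> \<le> e" for k
  proof -
    obtain a where a: "(T ^^ k) ?p = tube (H (3 ^ k * x)) a" "cmod a < 1"
      using T_pow_tube[OF assms(2,2), of k x] by blast
    obtain b c where bc: "(T ^^ n) (tube (H (3 ^ k * x)) a) = tube (H (3 ^ n * (3 ^ k * x))) b"
      "(T ^^ n) (tube (H (3 ^ k * x)) 0) = tube (H (3 ^ n * (3 ^ k * x))) c" "b - c = (a - 0) / 8 ^ n"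
      using T_pow_tube[OF a(2), of 0 n "3 ^ k * x"] by auto
    have eq: "(T ^^ (k + n)) ?p = (T ^^ n) (tube (H (3 ^ k * x)) a)"
      unfolding a(1)[symmetric] by (simp add: add.commute[of k] funpow_add)
    have "dist ((T ^^ n) (tube (H (3 ^ k * x)) a)) ((T ^^ n) (tube (H (3 ^ k * x)) 0)) = cmod a / 8 ^ n"
      unfolding bc(1,2) dist_tube_same_angle bc(3) by (simp add: norm_divide norm_power)
    also have "\<dots> \<le> 1 / 8 ^ n" using a(2) by (intro divide_right_mono) auto
    also have "\<dots> < d" using n(1) by (simp add: power_one_over)
    finally have "dist (f ((T ^^ n) (tube (H (3 ^ k * x)) a))) (f ((T ^^ n) (tube (H (3 ^ k * x)) 0))) < e"
      using a(2) by (intro d(2) Kn tube_in_torus) auto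
    then show ?thesis unfolding eq G_def by (simp add: dist_real_def)
  qed
  have shifted: "averages_to (\<lambda>k. if k < n then f ((T ^^ k) ?p) else G (3 ^ (k - n) * x)) (integral\<^sup>L ui G)"
    by (rule averages_to_unshift[where n = n]) (simp add: av)
  have "\<bar>integral\<^sup>L phys f - integral\<^sup>L ui G\<bar> \<le> e"
  proof -
    have Gint: "integral\<^sup>L ui G = (\<integral>q. f (lift_approx n q) \<partial>square)"
      unfolding lift_approx_eq G_def[symmetric] by (rule integral_fst_baker_inv_pow[OF bG, symmetric])
    have i: "integrable square (\<lambda>q. f (h q))" if h: "h \<in> borel_measurable borel" "\<And>q. h q \<in> ?K" for h
    proof (rule sq.P.integrable_const_bound[where B = B])
      show "AE q in square. norm (f (h q)) \<le> B"
      proof (rule AE_I2)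
        fix q
        have "h q \<in> torus" using h(2)[of q] compact_inner_tube(2) by blast
        then show "norm (f (h q)) \<le> B" using B by simp
      qed
      have "h \<in> measurable square (restrict_space borel torus)"
        using h compact_inner_tube(2) measurable_square[OF h(1)] by (intro measurable_restrict_space2) auto
      then show "(\<lambda>q. f (h q)) \<in> borel_measurable square"
        by (rule measurable_compose[OF _ measurable_continuous_restrict[OF assms(3) refl]])
    qed
    have i1: "integrable square (\<lambda>q. f (lift_pt q))" by (rule i[OF lift_pt_measurable lift_in(1)])
    have i2: "integrable square (\<lambda>q. f (lift_approx n q))" by (rule i[OF lift_approx_measurable lift_in(2)])
    have pt: "\<bar>f (lift_pt q) - f (lift_approx n q)\<bar> \<le> e" for q
      using d(2)[OF lift_in(2)[of n q] lift_in(1)[of q] le_less_trans[OF lift_approx_close n(1)]]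
      by (simp add: dist_real_def)
    have "\<bar>integral\<^sup>L phys f - integral\<^sup>L ui G\<bar> = \<bar>\<integral>q. f (lift_pt q) - f (lift_approx n q) \<partial>square\<bar>"
      unfolding Gint integral_phys[OF assms(3)] by (simp add: i1 i2)
    also have "\<dots> \<le> (\<integral>q. \<bar>f (lift_pt q) - f (lift_approx n q)\<bar> \<partial>square)" by (rule integral_abs_bound)
    also have "\<dots> \<le> (\<integral>q. e \<partial>square)"
      by (intro integral_mono integrable_abs Bochner_Integration.integrable_diff i1 i2 pt) simp
    also have "\<dots> = e" using sq.P.prob_space by simp
    finally show ?thesis .
  qed
  moreover have "\<bar>f ((T ^^ k) ?p) - (if k < n then f ((T ^^ k) ?p) else G (3 ^ (k - n) * x))\<bar> \<le> e" for k
    using close[of "k - n"] e by auto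
  ultimately show "\<exists>y b. averages_to y b \<and> (\<forall>k. \<bar>f ((T ^^ k) ?p) - y k\<bar> \<le> e) \<and> \<bar>integral\<^sup>L phys f - b\<bar> \<le> e"
    using shifted by blast
qed

lemma weak_star_phys:
  assumes "p \<in> torus" "equidistributed (X (angle p))"
  shows "weak_star_converges torus (empirical_measure T torus p) phys"
proof -
  have p: "tube (H (X (angle p))) (slice p) = p" by (simp add: tube_angle_slice)
  have "cmod (slice p) < 1" using assms(1) by (simp add: torus_def)
  from equidistributed_orbit[OF assms(2) this] show ?thesis
    unfolding weak_star_converges_iff[OF T_image assms(1)] p by blast
qed

text \<open>An orbit and its image under \<open>T\<close> have the same time averages.\<close>

lemma invariant_phys:
  assumes "equidistributed x" shows "invariant_probability T torus phys"
proof -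
  let ?p = "tube (H x) 0"
  have meas: "T \<in> measurable phys phys"
  proof -
    have "T \<in> measurable (restrict_space borel torus) borel"
      by (rule borel_measurable_continuous_on_restrict[OF continuous_T])
    then have "T \<in> measurable phys borel" unfolding measurable_cong_sets[OF phys_space(2) refl] .
    then have "T \<in> measurable phys (restrict_space borel torus)"
      using T_torus(2) phys_space(1) by (intro measurable_restrict_space2) auto
    then show ?thesis unfolding measurable_cong_sets[OF refl phys_space(2)] .
  qed
  have "distr phys phys T = phys"
  proof (rule measure_eq_of_continuous_integrals[where U = torus])
    show "prob_space (distr phys phys T)" by (rule prob_space.prob_space_distr[OF phys_space(3) meas])
    fix f :: "real^3 \<Rightarrow> real" assume f: "continuous_on torus f" "bounded (f ` torus)"
    have fT: "continuous_on torus (\<lambda>p. f (T p))"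
      by (rule continuous_on_compose2[OF f(1) continuous_T T_image])
    have bT: "bounded ((\<lambda>p. f (T p)) ` torus)"
      by (rule bounded_subset[OF f(2)]) (use T_torus(2) in auto)
    have "averages_to (\<lambda>k. f (T ((T ^^ k) ?p))) (integral\<^sup>L phys (\<lambda>p. f (T p)))"
      by (rule equidistributed_orbit[OF assms _ fT bT]) simp
    moreover have "averages_to (\<lambda>k. f ((T ^^ Suc k) ?p)) (integral\<^sup>L phys f)"
      by (rule averages_to_Suc[OF equidistributed_orbit[OF assms _ f]]) simp
    ultimately have "integral\<^sup>L phys (\<lambda>p. f (T p)) = integral\<^sup>L phys f"
      using averages_to_unique by simp
    then show "integral\<^sup>L (distr phys phys T) f = integral\<^sup>L phys f"
      using integral_distr[OF meas measurable_continuous_restrict[OF f(1) phys_space(2)]] by simp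
  qed (use phys_space in auto)
  then show ?thesis using phys_space meas by (simp add: invariant_probability_def)
qed

lemma invariant_probabilityD:
  assumes "invariant_probability T torus \<mu>"
  shows "prob_space \<mu>" "space \<mu> = torus" "sets \<mu> = sets (restrict_space borel torus)"
    "T \<in> measurable \<mu> \<mu>" "distr \<mu> \<mu> T = \<mu>"
  using assms by (simp_all add: invariant_probability_def)

lemma integral_T_pow:
  fixes f :: "real^3 \<Rightarrow> real"
  assumes "invariant_probability T torus \<mu>" "f \<in> borel_measurable \<mu>"
  shows "(\<integral>p. f ((T ^^ k) p) \<partial>\<mu>) = (\<integral>p. f p \<partial>\<mu>)" "(\<lambda>p. f ((T ^^ k) p)) \<in> borel_measurable \<mu>"
proof -
  note inv = invariant_probabilityD[OF assms(1)]
  have m: "(T ^^ k) \<in> measurable \<mu> \<mu>" for k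
  proof (induction k)
    case (Suc k)
    from measurable_compose[OF Suc inv(4)] show ?case by (simp add: o_def)
  qed simp
  show mf: "(\<lambda>p. f ((T ^^ k) p)) \<in> borel_measurable \<mu>" for k
    by (rule measurable_compose[OF m assms(2)])
  show "(\<integral>p. f ((T ^^ k) p) \<partial>\<mu>) = (\<integral>p. f p \<partial>\<mu>)"
  proof (induction k)
    case (Suc k)
    have "(\<integral>p. f ((T ^^ k) (T p)) \<partial>\<mu>) = (\<integral>p. f ((T ^^ k) p) \<partial>distr \<mu> \<mu> T)"
      by (rule integral_distr[OF inv(4) mf, symmetric])
    then show ?case using Suc inv(5) by (simp add: funpow_swap1)
  qed simp
qed

text \<open>The integral of an observable equals the integral of its time averages, which converge to the constant
  \<open>integral\<^sup>L phys f\<close> at every point with an equidistributed angle.\<close>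

lemma invariant_eq_phys:
  assumes inv: "invariant_probability T torus \<mu>" and ae: "AE p in \<mu>. equidistributed (X (angle p))"
  shows "\<mu> = phys"
proof (rule measure_eq_of_continuous_integrals[where U = torus])
  note i = invariant_probabilityD[OF inv]
  interpret \<mu>: prob_space \<mu> by (rule i(1))
  fix f :: "real^3 \<Rightarrow> real" assume f: "continuous_on torus f" "bounded (f ` torus)"
  obtain B where B: "\<And>p. p \<in> torus \<Longrightarrow> \<bar>f p\<bar> \<le> B" using f(2) by (auto simp: bounded_iff)
  have mf: "f \<in> borel_measurable \<mu>" by (rule measurable_continuous_restrict[OF f(1) i(3)])
  let ?A = "\<lambda>n p. (\<Sum>k<n. f ((T ^^ k) p)) / real n"
  have B0: "0 \<le> B" using B[OF tube_in_torus[of 0 0]] by (simp add: order_trans[OF abs_ge_zero])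
  have bA: "\<bar>?A n p\<bar> \<le> B" if "p \<in> torus" for n p
  proof (cases "n = 0")
    case False
    have "\<bar>\<Sum>k<n. f ((T ^^ k) p)\<bar> \<le> (\<Sum>k<n. B)"
      by (rule order_trans[OF sum_abs]) (intro sum_mono B T_pow_torus that)
    then show ?thesis using False by (simp add: abs_divide divide_le_eq mult.commute)
  qed (simp add: B0)
  have "(\<lambda>n. integral\<^sup>L \<mu> (?A n)) \<longlonglongrightarrow> integral\<^sup>L \<mu> (\<lambda>_. integral\<^sup>L phys f)"
  proof (rule integral_dominated_convergence[where w = "\<lambda>_. B"])
    have "AE p in \<mu>. p \<in> torus" using AE_space[of \<mu>] by (simp add: i(2))
    with ae show "AE p in \<mu>. (\<lambda>n. ?A n p) \<longlonglongrightarrow> integral\<^sup>L phys f"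
    proof eventually_elim
      case (elim p)
      from weak_star_phys[OF elim(2,1)] f show ?case
        unfolding weak_star_converges_iff[OF T_image elim(2)] averages_to_def by blast
    qed
    show "?A n \<in> borel_measurable \<mu>" for n
      by (intro borel_measurable_divide borel_measurable_sum integral_T_pow(2)[OF inv mf] borel_measurable_const)
    show "AE p in \<mu>. norm (?A n p) \<le> B" for n
      using bA by (intro AE_I2) (simp add: i(2))
  qed simp_all
  moreover have "integral\<^sup>L \<mu> (?A n) = integral\<^sup>L \<mu> f" if "n > 0" for n
  proof -
    have int: "integrable \<mu> (\<lambda>p. f ((T ^^ k) p))" for k
      using B T_pow_torus integral_T_pow(2)[OF inv mf]
      by (intro \<mu>.integrable_const_bound[where B = B]) (auto simp: i(2))
    have "integral\<^sup>L \<mu> (?A n) = (\<Sum>k<n. \<integral>p. f ((T ^^ k) p) \<partial>\<mu>) / real n"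
      using int by simp
    also have "\<dots> = integral\<^sup>L \<mu> f" unfolding integral_T_pow(1)[OF inv mf] using that by simp
    finally show ?thesis .
  qed
  then have "(\<lambda>n. integral\<^sup>L \<mu> (?A n)) \<longlonglongrightarrow> integral\<^sup>L \<mu> f"
    by (intro tendsto_eventually eventually_mono[OF eventually_gt_at_top[of 0]])
  ultimately have "integral\<^sup>L \<mu> (\<lambda>_. integral\<^sup>L phys f) = integral\<^sup>L \<mu> f" by (rule LIMSEQ_unique)
  then show "integral\<^sup>L \<mu> f = integral\<^sup>L phys f" using \<mu>.prob_space by simp
qed (use invariant_probabilityD[OF inv] phys_space in auto)

text \<open>Fubini in tube coordinates, which are differentiable and hence preserve null sets.\<close>

lemma non_generic_negligible:
  assumes "AE t in ui. equidistributed (X t)"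
  shows "negligible {p \<in> torus. \<not> equidistributed (X (angle p))}"
proof -
  have "AE t in lborel. t \<in> {0..<1} \<longrightarrow> equidistributed (X t)" using assms by (simp only: AE_ui)
  then obtain N where N: "{t \<in> space lborel. \<not> (t \<in> {0..<1} \<longrightarrow> equidistributed (X t))} \<subseteq> N"
    "emeasure lborel N = 0" "N \<in> sets lborel" by (rule AE_E)
  have "emeasure (lborel \<Otimes>\<^sub>M (lborel :: complex measure)) (N \<times> UNIV) = 0"
    using N by (subst lborel.emeasure_pair_measure_Times) auto
  then have "N \<times> (UNIV :: complex set) \<in> null_sets lborel"
    using N(3) by (intro null_setsI) (auto simp: lborel_prod borel_Times)
  then have "negligible (N \<times> (UNIV :: complex set))"
    by (simp add: negligible_iff_null_sets null_sets_completionI)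
  then have neg: "negligible (N \<times> {w :: complex. cmod w < 1})" by (rule negligible_subset) auto
  have "negligible ((\<lambda>q. tube (fst q) (snd q)) ` (N \<times> {w. cmod w < 1}))"
  proof (rule negligible_differentiable_image_negligible[OF _ neg])
    show "(\<lambda>q. tube (fst q) (snd q)) differentiable_on N \<times> {w. cmod w < 1}"
      unfolding differentiable_on_def differentiable_def
    proof
      fix q :: "real \<times> complex" assume "q \<in> N \<times> {w. cmod w < 1}"
      then have "Re (snd q) > -2" by (auto intro: Re_gt_of_small)
      from has_derivative_tube[OF has_derivative_fst[OF has_derivative_ident] has_derivative_snd[OF has_derivative_ident] this]
      show "\<exists>D. ((\<lambda>q. tube (fst q) (snd q)) has_derivative D) (at q within N \<times> {w. cmod w < 1})"
        using has_derivative_at_withinI by blast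
    qed
  qed simp
  then show ?thesis
  proof (rule negligible_subset)
    show "{p \<in> torus. \<not> equidistributed (X (angle p))} \<subseteq> (\<lambda>q. tube (fst q) (snd q)) ` (N \<times> {w. cmod w < 1})"
    proof
      fix p assume "p \<in> {p \<in> torus. \<not> equidistributed (X (angle p))}"
      then have "(angle p, slice p) \<in> N \<times> {w. cmod w < 1}" using N(1) angle_bounds[of p] by (auto simp: torus_def)
      then show "p \<in> (\<lambda>q. tube (fst q) (snd q)) ` (N \<times> {w. cmod w < 1})"
        by (rule image_eqI[rotated]) (simp add: tube_angle_slice)
    qed
  qed
qed

text \<open>The basin of \<open>phys\<close> has full measure, so it meets the basin of any other physical measure, and the limit of
  empirical measures at a common point is unique.\<close>

lemma unique_physical:
  assumes ae: "AE t in ui. equidistributed (X t)"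
  shows "\<exists>!\<mu>. physical_measure T torus \<mu>"
proof
  let ?bad = "{p \<in> torus. \<not> equidistributed (X (angle p))}"
  have bad: "negligible ?bad" by (rule non_generic_negligible[OF ae])
  have nt: "\<not> negligible torus" by (rule open_not_negligible[OF open_torus]) (use tube_in_torus[of 0 0] in auto)
  have "\<exists>x. equidistributed x"
  proof (rule ccontr)
    assume "\<not> ?thesis"
    then have "?bad = torus" by auto
    then show False using bad nt by simp
  qed
  then have inv: "invariant_probability T torus phys" using invariant_phys by blast
  let ?basin = "\<lambda>\<mu>. {p \<in> torus. weak_star_converges torus (empirical_measure T torus p) \<mu>}"
  have sub: "torus - ?basin phys \<subseteq> ?bad" using weak_star_phys by blast
  then have neg: "negligible (torus - ?basin phys)" by (rule negligible_subset[OF bad])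
  have tl: "torus \<in> sets lebesgue" using open_torus by simp
  have nl: "torus - ?basin phys \<in> sets lebesgue" by (rule negligible_imp_sets[OF neg])
  have dd: "torus - (torus - ?basin phys) = ?basin phys" by auto
  have bl: "?basin phys \<in> sets lebesgue" using sets.Diff[OF tl nl] unfolding dd .
  have "emeasure lebesgue (?basin phys) > 0"
  proof (rule ccontr)
    assume "\<not> ?thesis"
    then have "?basin phys \<in> null_sets lebesgue" using bl by (intro null_setsI) auto
    then have "negligible (?basin phys)" by (simp add: negligible_iff_null_sets)
    then have "negligible (?basin phys \<union> (torus - ?basin phys))" using neg by (rule negligible_Un)
    moreover have "?basin phys \<union> (torus - ?basin phys) = torus" by auto
    ultimately show False using nt by simp
  qed
  with inv show "physical_measure T torus phys" by (simp add: physical_measure_def)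
  fix \<nu> assume nu: "physical_measure T torus \<nu>"
  then have i: "invariant_probability T torus \<nu>" "emeasure lebesgue (?basin \<nu>) > 0"
    by (simp_all add: physical_measure_def)
  have "\<exists>p. p \<in> ?basin \<nu> \<and> p \<in> ?basin phys"
  proof (rule ccontr)
    assume "\<not> ?thesis"
    then have "?basin \<nu> \<subseteq> torus - ?basin phys" by auto
    then have "negligible (?basin \<nu>)" by (rule negligible_subset[OF neg])
    then have "emeasure lebesgue (?basin \<nu>) = 0" by (simp add: negligible_iff_null_sets null_sets_def)
    with i(2) show False by simp
  qed
  then obtain p where p: "p \<in> torus" "weak_star_converges torus (empirical_measure T torus p) \<nu>"
    "weak_star_converges torus (empirical_measure T torus p) phys" by blast
  show "\<nu> = phys"
  proof (rule measure_eq_of_continuous_integrals[where U = torus])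
    fix f :: "real^3 \<Rightarrow> real" assume "continuous_on torus f" "bounded (f ` torus)"
    then show "integral\<^sup>L \<nu> f = integral\<^sup>L phys f"
      using p(2,3) averages_to_unique unfolding weak_star_converges_iff[OF T_image p(1)] by blast
  qed (use invariant_probabilityD[OF i(1)] phys_space in auto)
qed

end

section \<open>The flow along the unstable leaves\<close>

lemma cis_lipschitz: "cmod (cis a - cis b) \<le> \<bar>a - b\<bar>"
proof -
  have h: "2 * ((a - b) / 2) = a - b" by simp
  have c: "cos (a - b) = 1 - 2 * (sin ((a - b) / 2))\<^sup>2"
    using cos_double_sin[of "(a - b) / 2"] unfolding h .
  have sin_sq: "(sin x)\<^sup>2 \<le> x\<^sup>2" for x :: real
    using abs_sin_x_le_abs_x[of x] by (rule abs_le_square_iff[THEN iffD1])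
  have "(cmod (cis a - cis b))\<^sup>2 = (cos a - cos b)\<^sup>2 + (sin a - sin b)\<^sup>2"
    by (simp add: cmod_power2)
  also have "\<dots> = ((sin a)\<^sup>2 + (cos a)\<^sup>2) + ((sin b)\<^sup>2 + (cos b)\<^sup>2) - 2 * cos (a - b)"
    unfolding cos_diff power2_diff by algebra
  also have "\<dots> = 4 * (sin ((a - b) / 2))\<^sup>2" unfolding c sin_cos_squared_add by simp
  also have "\<dots> \<le> 4 * ((a - b) / 2)\<^sup>2"
    by (rule mult_left_mono[OF sin_sq]) simp
  also have "\<dots> = \<bar>a - b\<bar>\<^sup>2" by (simp add: power_divide)
  finally show ?thesis by (rule power2_le_imp_le) simp
qed

lemma turn_lipschitz: "cmod (turn s - turn t) \<le> 2 * pi * \<bar>s - t\<bar>"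
  using cis_lipschitz[of "2 * pi * s" "2 * pi * t"]
  by (simp add: turn_def right_diff_distrib[symmetric] abs_mult)

lemma norm_mk3_le: "norm (mk3 u z) \<le> cmod u + \<bar>z\<bar>"
proof (rule power2_le_imp_le)
  have "(norm (mk3 u z))\<^sup>2 = (cmod u)\<^sup>2 + \<bar>z\<bar>\<^sup>2" by (simp add: norm_mk3)
  also have "\<dots> \<le> (cmod u + \<bar>z\<bar>)\<^sup>2" by (simp add: power2_sum)
  finally show "(norm (mk3 u z))\<^sup>2 \<le> (cmod u + \<bar>z\<bar>)\<^sup>2" .
qed simp

lemma dist_tube_le:
  assumes "cmod a < 1" shows "dist (tube s a) (tube t b) \<le> 6 * pi * \<bar>s - t\<bar> + 2 * cmod (a - b)"
proof -
  have "tube s a - tube t b = mk3 (of_real (2 + Re a) * (turn s - turn t) + of_real (Re (a - b)) * turn t) (Im (a - b))"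
    by (intro real3_eqI) (simp_all add: tube_def hor_linear algebra_simps)
  then have "dist (tube s a) (tube t b)
      \<le> cmod (of_real (2 + Re a) * (turn s - turn t) + of_real (Re (a - b)) * turn t) + \<bar>Im (a - b)\<bar>"
    unfolding dist_norm by (simp only: norm_mk3_le)
  also have "\<dots> \<le> \<bar>2 + Re a\<bar> * cmod (turn s - turn t) + \<bar>Re (a - b)\<bar> + \<bar>Im (a - b)\<bar>"
    by (intro add_right_mono norm_triangle_le) (simp add: norm_mult del: of_real_add)
  also have "\<bar>2 + Re a\<bar> * cmod (turn s - turn t) \<le> 3 * (2 * pi * \<bar>s - t\<bar>)"
    using abs_Re_le_cmod[of a] assms turn_lipschitz[of s t] by (intro mult_mono) auto
  also have "\<bar>Re (a - b)\<bar> \<le> cmod (a - b)" by (rule abs_Re_le_cmod)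
  also have "\<bar>Im (a - b)\<bar> \<le> cmod (a - b)" by (rule abs_Im_le_cmod)
  finally show ?thesis by simp
qed

context circle_model
begin

definition alpha :: "real^3 \<Rightarrow> real" where "alpha p = X (angle p)"

lemma H_alpha [simp]: "H (alpha p) = angle p"
  by (simp add: alpha_def)

text \<open>Points of the attractor are coded by backward orbits of \<open>x \<mapsto> 3 * x\<close> on the circle, each
  entry of a code being defined up to an integer.\<close>

definition admissible :: "(nat \<Rightarrow> real) \<Rightarrow> bool" where
  "admissible x \<longleftrightarrow> (\<forall>j. \<exists>k :: int. 3 * x (Suc j) = x j + of_int k)"

definition decode :: "(nat \<Rightarrow> real) \<Rightarrow> real^3" where
  "decode x = tube (H (x 0)) (geo_lim (\<lambda>j. x (Suc j)))"

definition code :: "real^3 \<Rightarrow> nat \<Rightarrow> real" where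
  "code p j = alpha ((Tinv ^^ j) p)"

lemma admissible_shift: "admissible x \<Longrightarrow> admissible (\<lambda>j. x (j + n))"
  by (simp add: admissible_def)

lemma decode_torus: "decode x \<in> torus"
  unfolding decode_def by (intro tube_in_torus small_norm(1) geo_bound(2))

lemma T_decode:
  assumes "admissible x" shows "T (decode (\<lambda>j. x (Suc j))) = decode x"
proof -
  obtain k :: int where k: "3 * x (Suc 0) = x 0 + of_int k" using assms unfolding admissible_def by blast
  have F1: "F (H (x (Suc 0))) = H (x 0) + of_int k" by (simp add: F_H k H_int)
  show ?thesis
    unfolding decode_def T_tube[OF small_norm(2)[OF geo_bound(2)]] F1 tube_shift_int
    using geo_lim_Suc[of "\<lambda>j. x (Suc j)"] by (simp add: add.commute)
qed

lemma decode_Lam: "admissible x \<Longrightarrow> decode x \<in> Lam"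
proof -
  have "decode x \<in> (T ^^ n) ` torus" if "admissible x" for n x
    using that
  proof (induction n arbitrary: x)
    case 0
    then show ?case by (simp add: decode_torus)
  next
    case (Suc n)
    have "decode (\<lambda>j. x (Suc j)) \<in> (T ^^ n) ` torus"
      using Suc.IH[of "\<lambda>j. x (Suc j)"] admissible_shift[OF Suc.prems, of 1] by simp
    then obtain q where q: "q \<in> torus" "decode (\<lambda>j. x (Suc j)) = (T ^^ n) q" by blast
    have "decode x = (T ^^ Suc n) q" using T_decode[OF Suc.prems] q(2) by simp
    then show ?case using q(1) by blast
  qed
  then show "admissible x \<Longrightarrow> decode x \<in> Lam" by (simp add: attractor_def)
qed

lemma Tinv_pow_decode: "admissible x \<Longrightarrow> (Tinv ^^ n) (decode x) = decode (\<lambda>j. x (j + n))"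
proof (induction n)
  case (Suc n)
  have "T (decode (\<lambda>j. x (Suc j + n))) = decode (\<lambda>j. x (j + n))"
    by (rule T_decode[OF admissible_shift[OF Suc.prems]])
  then have "Tinv (decode (\<lambda>j. x (j + n))) = decode (\<lambda>j. x (Suc j + n))"
    using Tinv_T[OF decode_torus[of "\<lambda>j. x (Suc j + n)"]] by simp
  then show ?case using Suc by simp
qed simp

lemma alpha_decode: obtains k :: int where "alpha (decode x) = x 0 + of_int k"
proof -
  obtain k where "angle (decode x) = H (x 0) + of_int k"
    unfolding decode_def by (rule angle_tube[OF small_norm(2)[OF geo_bound(2)]])
  then have "alpha (decode x) = x 0 + of_int k" by (simp add: alpha_def X_int)
  then show thesis by (rule that)
qed

lemma turn_H_cong: "x = y + of_int k \<Longrightarrow> turn (H x) = turn (H y)"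
  by (simp add: H_int)

lemma decode_cong:
  assumes "\<And>j. \<exists>k :: int. x j = y j + of_int k" shows "decode x = decode y"
proof -
  have t: "turn (H (x j)) = turn (H (y j))" for j
    using assms[of j] turn_H_cong by blast
  show ?thesis by (simp only: decode_def tube_def geo_lim_def t)
qed

lemma slice_T: "p \<in> torus \<Longrightarrow> slice (T p) = slice p / 8 + turn (angle p) / 2"
  unfolding T_def by (rule slice_tube[OF next_slice_Re]) (simp add: torus_def)

lemma alpha_T:
  assumes "p \<in> torus" obtains k :: int where "alpha (T p) = 3 * alpha p + of_int k"
proof -
  have w: "cmod (slice p) < 1" using assms by (simp add: torus_def)
  obtain k where "angle (T p) = F (angle p) + of_int k"
    unfolding T_def by (rule angle_tube[OF next_slice_Re[OF w]])
  then have "alpha (T p) = 3 * alpha p + of_int k" by (simp add: alpha_def X_int F_def)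
  then show thesis by (rule that)
qed

lemma code_0: "code p 0 = alpha p"
  by (simp add: code_def)

lemma code_Tinv_pow: "code ((Tinv ^^ n) p) j = code p (j + n)"
  by (simp add: code_def funpow_add)

lemma admissible_code:
  assumes "p \<in> Lam" shows "admissible (code p)"
  unfolding admissible_def
proof
  fix j
  let ?q = "(Tinv ^^ Suc j) p"
  have q: "?q \<in> Lam" by (rule Tinv_pow_Lam[OF assms])
  have Tq: "T ?q = (Tinv ^^ j) p" using Tinv_Lam(2)[OF Tinv_pow_Lam[OF assms, of j]] by simp
  obtain k where "alpha (T ?q) = 3 * alpha ?q + of_int k" by (rule alpha_T[OF Lam_torus[OF q]])
  then have "3 * code p (Suc j) = code p j + of_int (- k)" unfolding Tq code_def by simp
  then show "\<exists>k :: int. 3 * code p (Suc j) = code p j + of_int k" by blast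
qed

text \<open>The slice of \<open>p\<close> is an affine function of the slice of its \<open>n\<close>-th preimage with factor \<open>1 / 8 ^ n\<close>, so it is
  determined by the angles along the backward orbit.\<close>

lemma decode_code:
  assumes "p \<in> Lam" shows "decode (code p) = p"
proof -
  have expand: "slice p = geo (\<lambda>j. code p (Suc j)) n + slice ((Tinv ^^ n) p) / 8 ^ n" if "p \<in> Lam" for p n
    using that
  proof (induction n arbitrary: p)
    case 0
    show ?case by (simp add: geo_def)
  next
    case (Suc n)
    let ?q = "Tinv p"
    have q: "?q \<in> Lam" "T ?q = p" using Tinv_Lam[OF Suc.prems] by auto
    have "slice p = slice ?q / 8 + turn (angle ?q) / 2"
      using slice_T[OF Lam_torus[OF q(1)]] unfolding q(2) .
    also have "slice ?q = geo (\<lambda>j. code ?q (Suc j)) n + slice ((Tinv ^^ n) ?q) / 8 ^ n"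
      by (rule Suc.IH[OF q(1)])
    also have "(\<lambda>j. code ?q (Suc j)) = (\<lambda>j. code p (Suc (Suc j)))"
      using code_Tinv_pow[of 1 p] by simp
    also have "angle ?q = H (code p (Suc 0))" by (simp add: code_def)
    finally show ?case
      unfolding geo_Suc by (simp add: add_divide_distrib funpow_swap1 mult.commute)
  qed
  have "cmod (slice p - geo_lim (\<lambda>j. code p (Suc j))) \<le> 2 * (1 / 8) ^ n" for n
  proof -
    let ?g = "geo (\<lambda>j. code p (Suc j)) n" and ?l = "geo_lim (\<lambda>j. code p (Suc j))"
    have "cmod (slice p - ?g) = cmod (slice ((Tinv ^^ n) p)) / 8 ^ n"
      using expand[OF assms, of n] by (simp add: norm_divide norm_power)
    also have "\<dots> \<le> 1 / 8 ^ n"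
      using Lam_torus[OF Tinv_pow_Lam[OF assms, of n]] by (intro divide_right_mono) (auto simp: torus_def)
    finally have "cmod (slice p - ?g) \<le> (1 / 8) ^ n" by (simp add: power_one_over)
    moreover have "cmod (?l - ?g) \<le> (1 / 8) ^ n" by (rule geo_bound(3))
    ultimately show ?thesis using norm_triangle_ineq4[of "slice p - ?g" "?l - ?g"] by simp
  qed
  moreover have "(\<lambda>n. 2 * (1 / 8) ^ n :: real) \<longlonglongrightarrow> 2 * 0"
    by (intro tendsto_mult tendsto_const LIMSEQ_power_zero) simp
  ultimately have "cmod (slice p - geo_lim (\<lambda>j. code p (Suc j))) \<le> 2 * 0"
    by (intro LIMSEQ_le_const[of "\<lambda>n. 2 * (1 / 8) ^ n"]) auto
  then have "slice p = geo_lim (\<lambda>j. code p (Suc j))" by simp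
  then show ?thesis unfolding decode_def code_0 using tube_angle_slice[of p] by simp
qed

text \<open>Moving along the unstable leaf by \<open>\<xi>\<close> in the conjugate angle moves the \<open>j\<close>-th preimage by \<open>\<xi> / 3 ^ j\<close>.\<close>

definition flow :: "real \<Rightarrow> real^3 \<Rightarrow> real^3" where
  "flow \<xi> p = decode (\<lambda>j. code p j + \<xi> / 3 ^ j)"

lemma admissible_flow:
  assumes "p \<in> Lam" shows "admissible (\<lambda>j. code p j + \<xi> / 3 ^ j)"
  unfolding admissible_def
proof
  fix j
  obtain k :: int where "3 * code p (Suc j) = code p j + of_int k"
    using admissible_code[OF assms] unfolding admissible_def by blast
  then have "3 * (code p (Suc j) + \<xi> / 3 ^ Suc j) = code p j + \<xi> / 3 ^ j + of_int k" by simp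
  then show "\<exists>k :: int. 3 * (code p (Suc j) + \<xi> / 3 ^ Suc j) = code p j + \<xi> / 3 ^ j + of_int k" by blast
qed

lemma flow_Lam: "p \<in> Lam \<Longrightarrow> flow \<xi> p \<in> Lam"
  unfolding flow_def by (rule decode_Lam[OF admissible_flow])

lemma flow_0: "p \<in> Lam \<Longrightarrow> flow 0 p = p"
  by (simp add: flow_def decode_code)

lemma code_flow:
  assumes "p \<in> Lam" obtains k :: int where "code (flow \<xi> p) j = code p j + \<xi> / 3 ^ j + of_int k"
proof -
  have e: "(Tinv ^^ j) (flow \<xi> p) = decode (\<lambda>i. code p (i + j) + \<xi> / 3 ^ (i + j))"
    unfolding flow_def by (rule Tinv_pow_decode[OF admissible_flow[OF assms]])
  obtain k where "alpha (decode (\<lambda>i. code p (i + j) + \<xi> / 3 ^ (i + j))) = code p (0 + j) + \<xi> / 3 ^ (0 + j) + of_int k"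
    by (rule alpha_decode)
  then have "code (flow \<xi> p) j = code p j + \<xi> / 3 ^ j + of_int k" unfolding code_def e by simp
  then show thesis by (rule that)
qed

lemma flow_flow:
  assumes "p \<in> Lam" shows "flow \<eta> (flow \<xi> p) = flow (\<xi> + \<eta>) p"
  unfolding flow_def[of \<eta>] flow_def[of "\<xi> + \<eta>"]
proof (rule decode_cong)
  fix j
  obtain k where "code (flow \<xi> p) j = code p j + \<xi> / 3 ^ j + of_int k" by (rule code_flow[OF assms])
  then have "code (flow \<xi> p) j + \<eta> / 3 ^ j = code p j + (\<xi> + \<eta>) / 3 ^ j + of_int k"
    by (simp add: add_divide_distrib)
  then show "\<exists>k :: int. code (flow \<xi> p) j + \<eta> / 3 ^ j = code p j + (\<xi> + \<eta>) / 3 ^ j + of_int k" by blast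
qed

lemma Tinv_pow_flow:
  assumes "p \<in> Lam" shows "(Tinv ^^ n) (flow \<xi> p) = flow (\<xi> / 3 ^ n) ((Tinv ^^ n) p)"
proof -
  have "(Tinv ^^ n) (flow \<xi> p) = decode (\<lambda>j. code p (j + n) + \<xi> / 3 ^ (j + n))"
    unfolding flow_def by (rule Tinv_pow_decode[OF admissible_flow[OF assms]])
  then show ?thesis by (simp add: flow_def code_Tinv_pow power_add mult.commute)
qed

lemma turn_alpha_flow: "p \<in> Lam \<Longrightarrow> turn (alpha (flow \<xi> p)) = turn (alpha p) * turn \<xi>"
proof -
  assume "p \<in> Lam"
  then obtain k where "code (flow \<xi> p) 0 = code p 0 + \<xi> / 3 ^ 0 + of_int k" by (rule code_flow)
  then show ?thesis by (simp add: code_0 turn_add[symmetric])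
qed

lemma H_contract: "\<bar>H u - H v\<bar> \<le> \<bar>H (3 * u) - H (3 * v)\<bar> / 2"
proof -
  have *: "\<bar>H u - H v\<bar> \<le> \<bar>H (3 * u) - H (3 * v)\<bar> / 2" if "v \<le> u" for u v
  proof -
    have sm: "strict_mono H" using lift by (simp add: circle_lift_def)
    then have "H v \<le> H u" using that by (simp add: strict_mono_less_eq)
    from F_expand(1)[OF this] show ?thesis unfolding F_H using \<open>H v \<le> H u\<close> by simp
  qed
  show ?thesis using *[of v u] *[of u v] by (cases "v \<le> u") (auto simp: abs_minus_commute)
qed

lemma flow_angles_contract:
  assumes "p \<in> Lam"
  shows "\<bar>H (code p n + \<xi> / 3 ^ n) - H (code p n + \<eta> / 3 ^ n)\<bar> \<le> (1 / 2) ^ n * \<bar>H (alpha p + \<xi>) - H (alpha p + \<eta>)\<bar>"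
proof (induction n)
  case 0
  show ?case by (simp add: code_0)
next
  case (Suc n)
  obtain k :: int where k: "3 * code p (Suc n) = code p n + of_int k"
    using admissible_code[OF assms] unfolding admissible_def by blast
  have e: "H (3 * (code p (Suc n) + \<zeta> / 3 ^ Suc n)) = H (code p n + \<zeta> / 3 ^ n) + of_int k" for \<zeta>
  proof -
    have "3 * (code p (Suc n) + \<zeta> / 3 ^ Suc n) = code p n + \<zeta> / 3 ^ n + of_int k" using k by simp
    then show ?thesis by (simp only: H_int)
  qed
  show ?case using H_contract[of "code p (Suc n) + \<xi> / 3 ^ Suc n" "code p (Suc n) + \<eta> / 3 ^ Suc n"] Suc
    unfolding e by simp
qed

lemma geo_lim_lipschitz:
  assumes "\<And>j. \<bar>H (x j) - H (y j)\<bar> \<le> D" shows "cmod (geo_lim x - geo_lim y) \<le> 2 * pi * D"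
proof -
  have D: "0 \<le> D" using assms[of 0] by (rule order_trans[OF abs_ge_zero])
  have b: "cmod ((1 / 8) ^ j * (turn (H (x j)) / 2) - (1 / 8) ^ j * (turn (H (y j)) / 2)) \<le> pi * D * (1 / 8) ^ j" for j
  proof -
    have "(1 / 8) ^ j * (turn (H (x j)) / 2) - (1 / 8) ^ j * (turn (H (y j)) / 2)
        = (1 / 8) ^ j * ((turn (H (x j)) - turn (H (y j))) / 2)" by (simp add: diff_divide_distrib right_diff_distrib)
    then have "cmod ((1 / 8) ^ j * (turn (H (x j)) / 2) - (1 / 8) ^ j * (turn (H (y j)) / 2))
        = (1 / 8) ^ j * (cmod (turn (H (x j)) - turn (H (y j))) / 2)"
      by (simp only: norm_mult norm_power norm_divide) simp
    also have "\<dots> \<le> (1 / 8) ^ j * (2 * pi * D / 2)"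
    proof (intro mult_left_mono divide_right_mono)
      have "2 * pi * \<bar>H (x j) - H (y j)\<bar> \<le> 2 * pi * D" using assms by (intro mult_left_mono) auto
      with turn_lipschitz show "cmod (turn (H (x j)) - turn (H (y j))) \<le> 2 * pi * D" by (rule order_trans)
    qed auto
    finally show ?thesis by (simp add: mult_ac)
  qed
  have s: "summable (\<lambda>j. pi * D * (1 / 8) ^ j)" by (intro summable_mult summable_geometric) simp
  have "geo_lim x - geo_lim y = (\<Sum>j. (1 / 8) ^ j * (turn (H (x j)) / 2) - (1 / 8) ^ j * (turn (H (y j)) / 2))"
    unfolding geo_lim_def by (rule suminf_diff[OF summable_geo summable_geo])
  then have "cmod (geo_lim x - geo_lim y) \<le> (\<Sum>j. pi * D * (1 / 8) ^ j)"
    using norm_suminf_le[OF b s] by simp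
  also have "\<dots> = pi * D * (8 / 7)"
    using suminf_geometric[of "1 / 8 :: real"] by (subst suminf_mult) (auto intro: summable_geometric)
  also have "\<dots> \<le> pi * D * 2" by (rule mult_left_mono[OF _ mult_nonneg_nonneg[OF pi_ge_zero D]]) simp
  finally show ?thesis by (simp add: mult_ac)
qed

text \<open>The leaves are Lipschitz graphs over the smooth angle \<open>H\<close>, although the flow is parametrized by
  the conjugate angle, which is only a topological parameter.\<close>

lemma flow_lipschitz:
  assumes "p \<in> Lam"
  shows "dist (flow \<xi> p) (flow \<eta> p) \<le> 10 * pi * \<bar>H (alpha p + \<xi>) - H (alpha p + \<eta>)\<bar>"
proof -
  let ?D = "\<bar>H (alpha p + \<xi>) - H (alpha p + \<eta>)\<bar>"
  let ?x = "\<lambda>\<xi> j. code p j + \<xi> / 3 ^ j"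
  have c: "\<bar>H (?x \<xi> (Suc j)) - H (?x \<eta> (Suc j))\<bar> \<le> ?D" for j
  proof (rule order_trans[OF flow_angles_contract[OF assms]])
    show "(1 / 2) ^ Suc j * ?D \<le> ?D" by (intro mult_left_le_one_le power_le_one) auto
  qed
  have "dist (flow \<xi> p) (flow \<eta> p) \<le> 6 * pi * \<bar>H (?x \<xi> 0) - H (?x \<eta> 0)\<bar>
      + 2 * cmod (geo_lim (\<lambda>j. ?x \<xi> (Suc j)) - geo_lim (\<lambda>j. ?x \<eta> (Suc j)))"
    unfolding flow_def decode_def by (rule dist_tube_le[OF small_norm(1)[OF geo_bound(2)]])
  also have "\<dots> \<le> 6 * pi * ?D + 2 * (2 * pi * ?D)"
    by (intro add_mono mult_left_mono geo_lim_lipschitz c) (simp_all add: code_0)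
  finally show ?thesis by simp
qed

lemma flow_unstable:
  assumes "p \<in> Lam" shows "flow \<xi> p \<in> unstable_leaf T torus (flow \<eta> p)"
proof -
  let ?D = "\<bar>H (alpha p + \<xi>) - H (alpha p + \<eta>)\<bar>"
  have "dist ((Tinv ^^ n) (flow \<xi> p)) ((Tinv ^^ n) (flow \<eta> p)) \<le> 10 * pi * ((1 / 2) ^ n * ?D)" for n
  proof -
    have "dist ((Tinv ^^ n) (flow \<xi> p)) ((Tinv ^^ n) (flow \<eta> p))
        \<le> 10 * pi * \<bar>H (code p n + \<xi> / 3 ^ n) - H (code p n + \<eta> / 3 ^ n)\<bar>"
      using flow_lipschitz[OF Tinv_pow_Lam[OF assms, of n], of "\<xi> / 3 ^ n" "\<eta> / 3 ^ n"]
      unfolding Tinv_pow_flow[OF assms] by (simp add: code_def)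
    also have "\<dots> \<le> 10 * pi * ((1 / 2) ^ n * ?D)" by (intro mult_left_mono flow_angles_contract[OF assms]) simp
    finally show ?thesis .
  qed
  then have b: "\<forall>n. dist ((Tinv ^^ n) (flow \<xi> p)) ((Tinv ^^ n) (flow \<eta> p)) \<le> 10 * pi * ((1 / 2) ^ n * ?D)" ..
  have z: "(\<lambda>n. (1 / 2 :: real) ^ n) \<longlonglongrightarrow> 0" by (rule LIMSEQ_power_zero) simp
  have u: "(\<lambda>n. 10 * pi * ((1 / 2) ^ n * ?D)) \<longlonglongrightarrow> 0"
    by (rule tendsto_mult_right_zero[OF tendsto_mult_left_zero[OF z]])
  have l: "\<forall>n. 0 \<le> dist ((Tinv ^^ n) (flow \<xi> p)) ((Tinv ^^ n) (flow \<eta> p))" by (rule allI) (rule zero_le_dist)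
  have "(\<lambda>n. dist ((Tinv ^^ n) (flow \<xi> p)) ((Tinv ^^ n) (flow \<eta> p))) \<longlonglongrightarrow> 0"
    by (rule tendsto_sandwich[OF always_eventually[OF l] always_eventually[OF b] tendsto_const u])
  then show ?thesis using flow_Lam[OF assms] by (simp add: unstable_leaf_def)
qed

lemma same_angle_stable:
  assumes "p \<in> torus" "q \<in> torus" "turn (alpha p) = turn (alpha q)"
  shows "q \<in> stable_leaf T torus p"
proof -
  obtain k where k: "alpha q = alpha p + of_int k" using assms(3)[symmetric] unfolding turn_eq_iff by blast
  have "angle q = angle p + of_int k" using H_int[of "alpha p" k] k by (metis H_alpha)
  then have q: "q = tube (H (alpha p)) (slice q)" using tube_angle_slice[of q] by simp
  have p: "p = tube (H (alpha p)) (slice p)" by (simp add: tube_angle_slice)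
  have w: "cmod (slice q) < 1" "cmod (slice p) < 1" using assms by (auto simp: torus_def)
  have "dist ((T ^^ n) q) ((T ^^ n) p) = cmod (slice q - slice p) * (1 / 8) ^ n" for n
  proof -
    obtain a b where ab: "(T ^^ n) (tube (H (alpha p)) (slice q)) = tube (H (3 ^ n * alpha p)) a"
      "(T ^^ n) (tube (H (alpha p)) (slice p)) = tube (H (3 ^ n * alpha p)) b"
      "a - b = (slice q - slice p) / 8 ^ n"
      using T_pow_tube[OF w, of n "alpha p"] by blast
    have "dist ((T ^^ n) q) ((T ^^ n) p) = cmod (a - b)"
      using ab(1,2) q p dist_tube_same_angle by metis
    then show ?thesis unfolding ab(3) by (simp add: norm_divide norm_power power_one_over)
  qed
  then have e: "(\<lambda>n. dist ((T ^^ n) q) ((T ^^ n) p)) = (\<lambda>n. cmod (slice q - slice p) * (1 / 8) ^ n)" by (rule ext)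
  have z: "(\<lambda>n. (1 / 8 :: real) ^ n) \<longlonglongrightarrow> 0" by (rule LIMSEQ_power_zero) simp
  have "(\<lambda>n. cmod (slice q - slice p) * (1 / 8) ^ n) \<longlonglongrightarrow> 0" by (rule tendsto_mult_right_zero[OF z])
  then show ?thesis using assms(2) unfolding stable_leaf_def e[symmetric] by blast
qed

section \<open>Continuity of the flow and product boxes\<close>

lemma continuous_X: "continuous_on UNIV X"
  using circle_lift_inv_lift[OF lift] by (simp add: circle_lift_def)

text \<open>As for the angle itself, the integer jumps of \<open>alpha\<close> are not seen by a periodic function.\<close>

lemma continuous_on_alpha_shift:
  fixes g :: "real \<Rightarrow> 'b::topological_space" and f :: "'c::t2_space \<Rightarrow> real^3"
  assumes g: "continuous_on UNIV g" "\<And>t. g (t + 1) = g t"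
    and f: "continuous_on A f" "\<And>z. z \<in> A \<Longrightarrow> f z \<in> torus" and u: "continuous_on A u"
  shows "continuous_on A (\<lambda>z. g (alpha (f z) + u z))"
  unfolding continuous_on_def
proof
  fix z assume z: "z \<in> A"
  obtain \<theta> where \<theta>: "\<theta> (f z) = angle (f z)" "(\<theta> has_derivative (\<lambda>v. Im (hor v / hor (f z)) / (2 * pi))) (at (f z))"
    "\<forall>\<^sub>F q in nhds (f z). hor q \<noteq> 0 \<and> (\<exists>k. angle q = \<theta> q + of_int k)"
    by (rule local_angle[OF torus_hor(3)[OF f(2)[OF z]]])
  have ft: "(f \<longlongrightarrow> f z) (at z within A)" and ut: "(u \<longlongrightarrow> u z) (at z within A)"
    using f(1) u z by (auto simp: continuous_on_def)
  have "isCont \<theta> (f z)" by (rule has_derivative_continuous[OF \<theta>(2)])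
  then have "((\<lambda>z. \<theta> (f z)) \<longlongrightarrow> angle (f z)) (at z within A)"
    using isCont_tendsto_compose[OF _ ft] \<theta>(1) by metis
  moreover have "isCont X (angle (f z))" "isCont g (alpha (f z) + u z)"
    using continuous_X g(1) by (auto simp: continuous_on_eq_continuous_at)
  ultimately have "((\<lambda>z. g (X (\<theta> (f z)) + u z)) \<longlongrightarrow> g (alpha (f z) + u z)) (at z within A)"
    by (intro isCont_tendsto_compose[of _ g] tendsto_add ut) (auto simp: alpha_def intro: isCont_tendsto_compose)
  moreover have "\<forall>\<^sub>F z in at z within A. g (X (\<theta> (f z)) + u z) = g (alpha (f z) + u z)"
    using eventually_compose_filterlim[OF \<theta>(3) ft]
  proof eventually_elim
    case (elim z)
    then obtain k where "angle (f z) = \<theta> (f z) + of_int k" by blast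
    then have "alpha (f z) + u z = (X (\<theta> (f z)) + u z) + of_int k" by (simp add: alpha_def X_int)
    then show ?case by (simp only: periodic_shift_int[of g, OF g(2)])
  qed
  ultimately show "((\<lambda>z. g (alpha (f z) + u z)) \<longlongrightarrow> g (alpha (f z) + u z)) (at z within A)"
    by (rule Lim_transform_eventually)
qed

lemma turn_H_periodic: "turn (H (t + 1)) = turn (H t)"
  using H_int[of t 1] turn_shift_int[of "H t" 1] by simp

lemma continuous_on_flow:
  fixes f :: "'c::t2_space \<Rightarrow> real^3"
  assumes f: "continuous_on A f" "\<And>z. z \<in> A \<Longrightarrow> f z \<in> Lam" and u: "continuous_on A u"
  shows "continuous_on A (\<lambda>z. flow (u z) (f z))"
proof -
  have t: "continuous_on A (\<lambda>z. turn (H (code (f z) j + u z / 3 ^ j)))" for j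
    unfolding code_def
  proof (rule continuous_on_alpha_shift[where g = "\<lambda>t. turn (H t)" and f = "\<lambda>z. (Tinv ^^ j) (f z)" and u = "\<lambda>z. u z / 3 ^ j"])
    show "continuous_on UNIV (\<lambda>t. turn (H t))" by (intro continuous_on_turn continuous_H)
    show "continuous_on A (\<lambda>z. (Tinv ^^ j) (f z))"
      by (rule continuous_on_compose2[OF continuous_Tinv_pow f(1)]) (use f(2) in auto)
    show "continuous_on A (\<lambda>z. u z / 3 ^ j)" by (intro continuous_intros u) auto
  qed (use turn_H_periodic Lam_torus Tinv_pow_Lam f(2) in auto)
  have c: "continuous_on A (\<lambda>z. \<Sum>j<n. (1 / 8) ^ j * (turn (H (code (f z) (Suc j) + u z / 3 ^ Suc j)) / 2))" for n
    by (intro continuous_on_sum continuous_on_mult continuous_on_divide continuous_on_const t) simp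
  have ul: "uniform_limit A (\<lambda>n z. \<Sum>j<n. (1 / 8) ^ j * (turn (H (code (f z) (Suc j) + u z / 3 ^ Suc j)) / 2))
     (\<lambda>z. geo_lim (\<lambda>j. code (f z) (Suc j) + u z / 3 ^ Suc j)) sequentially"
    unfolding geo_lim_def by (rule Weierstrass_m_test[OF geo_term summable_half_geometric])
  have g: "continuous_on A (\<lambda>z. geo_lim (\<lambda>j. code (f z) (Suc j) + u z / 3 ^ Suc j))"
    by (rule uniform_limit_theorem[OF always_eventually[OF allI[OF c]] ul trivial_limit_sequentially])
  show ?thesis
    unfolding flow_def decode_def tube_def
    by (intro continuous_on_mk3 continuous_on_mult continuous_on_of_real continuous_on_add continuous_on_const
          continuous_on_Re continuous_on_Im g t)
qed

text \<open>The representative of the conjugate angle in \<open>{c..<c + 1}\<close>.\<close>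

definition rep :: "real \<Rightarrow> real^3 \<Rightarrow> real" where "rep c p = c + frac (alpha p - c)"

lemma rep_bounds: "c \<le> rep c p" "rep c p < c + 1"
  by (simp_all add: rep_def frac_lt_1)

lemma turn_rep: "turn (rep c p) = turn (alpha p)"
proof -
  have "alpha p = rep c p + of_int \<lfloor>alpha p - c\<rfloor>" by (simp add: rep_def frac_def)
  then show ?thesis by (metis turn_shift_int)
qed

lemma rep_unique:
  assumes "turn (alpha p) = turn a" "c \<le> a" "a < c + 1" shows "rep c p = a"
proof -
  obtain k :: int where k: "rep c p = a + of_int k"
    using assms(1) turn_rep[of c p] turn_eq_iff[of "rep c p" a] by auto
  then have "\<bar>real_of_int k\<bar> < 1" using rep_bounds[of c p] assms(2,3) by (simp add: abs_less_iff)
  then have "k = 0" by simp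
  with k show ?thesis by simp
qed

lemma rep_interior: "turn (alpha p) \<noteq> turn c \<Longrightarrow> c < rep c p"
  using rep_bounds(1)[of c p] turn_rep[of c p] by (cases "rep c p = c") auto

text \<open>The conjugate angle is merely continuous, but \<open>H\<close> turns it back into a branch of the angle, which is smooth.\<close>

lemma rep_deriv:
  assumes "p \<in> torus" "turn (alpha p) \<noteq> turn c"
  shows "((\<lambda>q. H (rep c q)) has_derivative frame_ang p) (at p)"
proof -
  obtain \<theta> where \<theta>: "\<theta> p = angle p" "(\<theta> has_derivative (\<lambda>v. Im (hor v / hor p) / (2 * pi))) (at p)"
    "\<forall>\<^sub>F q in nhds p. hor q \<noteq> 0 \<and> (\<exists>k. angle q = \<theta> q + of_int k)"
    by (rule local_angle[OF torus_hor(3)[OF assms(1)]])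
  obtain m where m: "rep c p = alpha p + of_int m"
    using turn_rep[of c p] unfolding turn_eq_iff by blast
  have "isCont X (\<theta> p)" using continuous_X by (simp add: continuous_on_eq_continuous_at)
  then have "isCont (\<lambda>q. X (\<theta> q)) p" by (rule isCont_o2[OF has_derivative_continuous[OF \<theta>(2)]])
  then have "((\<lambda>q. X (\<theta> q)) \<longlongrightarrow> X (\<theta> p)) (nhds p)" by (simp only: isCont_def tendsto_at_iff_tendsto_nhds[where g = "\<lambda>q. X (\<theta> q)"])
  then have "((\<lambda>q. X (\<theta> q)) \<longlongrightarrow> alpha p) (nhds p)" unfolding \<theta>(1) alpha_def .
  then have "((\<lambda>q. X (\<theta> q) + of_int m) \<longlongrightarrow> rep c p) (nhds p)"
    unfolding m by (rule tendsto_add[OF _ tendsto_const])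
  then have "\<forall>\<^sub>F q in nhds p. c < X (\<theta> q) + of_int m \<and> X (\<theta> q) + of_int m < c + 1"
    using rep_interior[OF assms(2)] rep_bounds(2)[of c p] by (intro eventually_conj order_tendstoD)
  with \<theta>(3) have "\<forall>\<^sub>F q in nhds p. \<theta> q + of_int m = H (rep c q)"
  proof eventually_elim
    case (elim q)
    then obtain k where "angle q = \<theta> q + of_int k" by blast
    then have "alpha q = X (\<theta> q) + of_int k" by (simp add: alpha_def X_int)
    then have "turn (alpha q) = turn (X (\<theta> q) + of_int m)" by simp
    then have "rep c q = X (\<theta> q) + of_int m" using elim(2) by (intro rep_unique) auto
    then show ?case by (simp add: H_int)
  qed
  then obtain S where S: "open S" "p \<in> S" "\<forall>q\<in>S. \<theta> q + of_int m = H (rep c q)"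
    unfolding eventually_nhds by (elim exE conjE) (rule that)
  have "((\<lambda>q. \<theta> q + of_int m) has_derivative frame_ang p) (at p)"
    using has_derivative_add[OF \<theta>(2) has_derivative_const[of "of_int m"]] by (simp add: frame_ang_def[abs_def])
  then show ?thesis by (rule has_derivative_transform_within_open[OF _ S(1,2) S(3)[rule_format]])
qed

text \<open>The box is the attractor cut open along the disc of conjugate angle \<open>c\<close>. Its fibre is the part of the attractor in
  the opposite disc, and the leaves are the flow lines through the fibre.\<close>

definition box_base :: "real \<Rightarrow> (real^1) set" where "box_base c = {v. c < v $ 1 \<and> v $ 1 < c + 1}"

definition box_fibre :: "real \<Rightarrow> (real^3) set" where "box_fibre c = {p \<in> Lam. turn (alpha p) = turn (c + 1 / 2)}"

definition box :: "real \<Rightarrow> (real^3) set" where "box c = {p \<in> Lam. turn (alpha p) \<noteq> turn c}"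

definition box_chart :: "real \<Rightarrow> (real^1) \<times> (real^3) \<Rightarrow> real^3" where
  "box_chart c z = flow (fst z $ 1 - (c + 1 / 2)) (snd z)"

definition box_inv :: "real \<Rightarrow> real^3 \<Rightarrow> (real^1) \<times> (real^3)" where
  "box_inv c p = (vec (rep c p), flow (c + 1 / 2 - rep c p) p)"

lemma continuous_on_rep: "continuous_on (box c) (rep c)"
proof (rule continuous_at_imp_continuous_on, rule ballI)
  fix p assume "p \<in> box c"
  then have "((\<lambda>q. H (rep c q)) has_derivative frame_ang p) (at p)"
    by (intro rep_deriv) (auto simp: box_def intro: Lam_torus)
  then have "isCont (\<lambda>q. H (rep c q)) p" by (rule has_derivative_continuous)
  moreover have "isCont X (H (rep c p))" using continuous_X by (simp add: continuous_on_eq_continuous_at)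
  ultimately have "isCont (\<lambda>q. X (H (rep c q))) p" by (rule isCont_o2)
  then show "isCont (rep c) p" by simp
qed

lemma box_chart_alpha:
  assumes "b \<in> box_fibre c" shows "turn (alpha (flow (a - (c + 1 / 2)) b)) = turn a"
proof -
  have "turn (alpha (flow (a - (c + 1 / 2)) b)) = turn (c + 1 / 2) * turn (a - (c + 1 / 2))"
    using assms turn_alpha_flow[of b] by (simp add: box_fibre_def)
  also have "\<dots> = turn (c + 1 / 2 + (a - (c + 1 / 2)))" by (rule turn_add[symmetric])
  finally show ?thesis by simp
qed

lemma rep_box_chart:
  assumes "a \<in> box_base c" "b \<in> box_fibre c"
  shows "rep c (box_chart c (a, b)) = a $ 1" "box_chart c (a, b) \<in> box c"
proof -
  have a: "c < a $ 1" "a $ 1 < c + 1" using assms(1) by (auto simp: box_base_def)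
  have t: "turn (alpha (box_chart c (a, b))) = turn (a $ 1)"
    using box_chart_alpha[OF assms(2)] by (simp add: box_chart_def)
  then show r: "rep c (box_chart c (a, b)) = a $ 1" using a by (intro rep_unique) auto
  have "turn (a $ 1) \<noteq> turn c"
  proof
    assume "turn (a $ 1) = turn c"
    then have "rep c (box_chart c (a, b)) = c" using t by (intro rep_unique) auto
    then show False using r a by simp
  qed
  then show "box_chart c (a, b) \<in> box c"
    using t assms(2) by (auto simp: box_def box_chart_def box_fibre_def intro: flow_Lam)
qed

lemma box_homeomorphism: "homeomorphism (box_base c \<times> box_fibre c) (box c) (box_chart c) (box_inv c)"
proof (rule homeomorphismI)
  show "continuous_on (box_base c \<times> box_fibre c) (box_chart c)"
    unfolding box_chart_def
    by (rule continuous_on_flow) (auto simp: box_fibre_def intro!: continuous_intros)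
  show "continuous_on (box c) (box_inv c)"
    unfolding box_inv_def
  proof (rule continuous_on_Pair)
    have "continuous_on (box c) (\<lambda>p. \<chi> i. rep c p)" by (intro continuous_on_vec_lambda continuous_on_rep)
    then show "continuous_on (box c) (\<lambda>p. vec (rep c p) :: real^1)" by (simp add: vec_def)
    show "continuous_on (box c) (\<lambda>p. flow (c + 1 / 2 - rep c p) p)"
      by (rule continuous_on_flow) (auto simp: box_def intro!: continuous_intros continuous_on_rep[unfolded box_def])
  qed
  show "box_chart c ` (box_base c \<times> box_fibre c) \<subseteq> box c" using rep_box_chart(2) by auto
  show "box_inv c ` box c \<subseteq> box_base c \<times> box_fibre c"
  proof
    fix z assume "z \<in> box_inv c ` box c"
    then obtain p where p: "p \<in> box c" "z = box_inv c p" by blast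
    then have L: "p \<in> Lam" "turn (alpha p) \<noteq> turn c" by (auto simp: box_def)
    have "turn (alpha (flow (c + 1 / 2 - rep c p) p)) = turn (rep c p) * turn (c + 1 / 2 - rep c p)"
      using turn_alpha_flow[OF L(1)] by (simp add: turn_rep)
    also have "\<dots> = turn (c + 1 / 2)" unfolding turn_add[symmetric] by simp
    finally show "z \<in> box_base c \<times> box_fibre c"
      using p L rep_interior[OF L(2)] rep_bounds(2)[of c p] flow_Lam[OF L(1)]
      by (simp add: box_inv_def box_base_def box_fibre_def)
  qed
  show "box_inv c (box_chart c z) = z" if zin: "z \<in> box_base c \<times> box_fibre c" for z
  proof -
    obtain a b where z: "z = (a, b)" "a \<in> box_base c" "b \<in> box_fibre c" using zin by (rule SigmaE)
    have bL: "b \<in> Lam" using z(3) by (simp add: box_fibre_def)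
    have "flow (c + 1 / 2 - a $ 1) (box_chart c (a, b)) = flow (a $ 1 - (c + 1 / 2) + (c + 1 / 2 - a $ 1)) b"
      unfolding box_chart_def fst_conv snd_conv by (rule flow_flow[OF bL])
    also have "\<dots> = b" using flow_0[OF bL] by simp
    finally show ?thesis
      unfolding z(1) box_inv_def rep_box_chart(1)[OF z(2,3)] by (simp add: vec_eq_iff forall_1)
  qed
  show "box_chart c (box_inv c p) = p" if "p \<in> box c" for p
  proof -
    have L: "p \<in> Lam" using that by (simp add: box_def)
    show ?thesis unfolding box_chart_def box_inv_def
      using flow_flow[OF L, of "rep c p - (c + 1 / 2)" "c + 1 / 2 - rep c p"] flow_0[OF L] by simp
  qed
qed

lemma box_product: "product_box T torus (box_base c) (box_fibre c) (box c) (box_chart c) (box_inv c)"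
  unfolding product_box_def
proof (intro conjI ballI)
  have "box_base c = {v. c < v $ 1} \<inter> {v. v $ 1 < c + 1}" by (auto simp: box_base_def)
  then show "open (box_base c)"
    by (auto intro!: open_Int open_Collect_less continuous_intros)
  have "box_base c = (\<lambda>t. \<chi> i. t) ` {c<..<c + 1}"
  proof (intro subset_antisym subsetI)
    fix v assume "v \<in> box_base c"
    then show "v \<in> (\<lambda>t. \<chi> i. t) ` {c<..<c + 1}"
      by (intro image_eqI[of _ _ "v $ 1"]) (auto simp: box_base_def vec_eq_iff forall_1)
  qed (auto simp: box_base_def)
  then show "connected (box_base c)"
    by (auto intro!: connected_continuous_image continuous_on_vec_lambda continuous_on_id)
  have "(vec (c + 1 / 2) :: real^1) \<in> box_base c" by (simp add: box_base_def)
  then show "box_base c \<noteq> {}" by blast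
  have "continuous_on Lam (\<lambda>p. turn (alpha p + 0))"
    by (rule continuous_on_alpha_shift[where g = turn and f = "\<lambda>p. p" and u = "\<lambda>_. 0"])
       (use turn_shift_int[of _ 1] in \<open>auto intro: continuous_on_turn continuous_on_id Lam_torus\<close>)
  then have "openin (top_of_set Lam) (Lam \<inter> (\<lambda>p. turn (alpha p)) -` (- {turn c}))"
    by (intro continuous_openin_preimage_gen) auto
  moreover have "Lam \<inter> (\<lambda>p. turn (alpha p)) -` (- {turn c}) = box c" by (auto simp: box_def)
  ultimately show "openin (top_of_set Lam) (box c)" by simp
  show "homeomorphism (box_base c \<times> box_fibre c) (box c) (box_chart c) (box_inv c)" by (rule box_homeomorphism)
next
  fix b a a' assume "b \<in> box_fibre c"
  then show "box_chart c (a', b) \<in> unstable_leaf T torus (box_chart c (a, b))"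
    unfolding box_chart_def fst_conv snd_conv by (intro flow_unstable) (simp add: box_fibre_def)
next
  fix a b b' assume *: "a \<in> box_base c" "b \<in> box_fibre c" "b' \<in> box_fibre c"
  have "turn (alpha (box_chart c (a, b))) = turn (alpha (box_chart c (a, b')))"
    unfolding box_chart_def fst_conv snd_conv box_chart_alpha[OF *(2)] box_chart_alpha[OF *(3)] ..
  moreover have "box_chart c (a, b) \<in> torus" "box_chart c (a, b') \<in> torus"
    using rep_box_chart(2)[OF *(1,2)] rep_box_chart(2)[OF *(1,3)] Lam_torus by (auto simp: box_def)
  ultimately show "box_chart c (a, b') \<in> stable_leaf T torus (box_chart c (a, b))"
    by (intro same_angle_stable)
qed

end

section \<open>Null sets of angles on smooth leaves\<close>

text \<open>A function that is Lipschitz in terms of \<open>g\<close> has a derivative controlled by that of \<open>g\<close>. Applied to a parametrization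
  of a leaf, with \<open>g\<close> the angle, this shows that the leaf is nowhere tangent to the discs.\<close>

lemma derivative_lipschitz_compare:
  fixes f :: "'a::real_normed_vector \<Rightarrow> 'b::real_normed_vector" and g :: "'a \<Rightarrow> real"
  assumes f: "(f has_derivative f') (at x)" and g: "(g has_derivative g') (at x)"
    and V: "open V" "x \<in> V" and C: "0 \<le> C" and lip: "\<And>y. y \<in> V \<Longrightarrow> norm (f y - f x) \<le> C * \<bar>g y - g x\<bar>"
  shows "norm (f' e) \<le> C * \<bar>g' e\<bar>"
proof (rule field_le_epsilon)
  fix d :: real assume d: "0 < d"
  define \<epsilon> where "\<epsilon> = d / ((1 + C) * (norm e + 1))"
  have pos: "0 < (1 + C) * (norm e + 1)" using C norm_ge_zero[of e] by (intro mult_pos_pos) linarith+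
  then have eps: "0 < \<epsilon>" using d by (simp add: \<epsilon>_def)
  obtain d1 where d1: "0 < d1" "\<forall>y. norm (y - x) < d1 \<longrightarrow> norm (f y - f x - f' (y - x)) \<le> \<epsilon> * norm (y - x)"
    using f eps unfolding has_derivative_at_alt by meson
  obtain d2 where d2: "0 < d2" "\<forall>y. norm (y - x) < d2 \<longrightarrow> norm (g y - g x - g' (y - x)) \<le> \<epsilon> * norm (y - x)"
    using g eps unfolding has_derivative_at_alt by meson
  obtain d3 where d3: "0 < d3" "ball x d3 \<subseteq> V" using V by (rule openE)
  define s where "s = min d1 (min d2 d3) / 2 / (norm e + 1)"
  have e1: "0 < norm e + 1" using norm_ge_zero[of e] by linarith
  have s: "0 < s" unfolding s_def using d1(1) d2(1) d3(1) by (intro divide_pos_pos e1) simp_all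
  define y where "y = x + s *\<^sub>R e"
  have yx: "y - x = s *\<^sub>R e" by (simp add: y_def)
  have n: "norm (y - x) = s * norm e" using s by (simp add: yx)
  have "s * norm e \<le> s * (norm e + 1)" using s by simp
  also have "\<dots> = min d1 (min d2 d3) / 2" unfolding s_def using e1 by (intro nonzero_eq_divide_eq[THEN iffD1] refl) linarith
  finally have small: "norm (y - x) < d1" "norm (y - x) < d2" "norm (y - x) < d3"
    unfolding n using d1(1) d2(1) d3(1) by auto
  have "y \<in> V" using small(3) d3(2) by (auto simp: dist_norm norm_minus_commute)
  then have l: "norm (f y - f x) \<le> C * \<bar>g y - g x\<bar>" by (rule lip)
  have lin: "f' (y - x) = s *\<^sub>R f' e" "g' (y - x) = s * g' e"
    unfolding yx using has_derivative_linear[OF f] has_derivative_linear[OF g] by (simp_all add: linear_cmul)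
  have a: "norm (f y - f x - s *\<^sub>R f' e) \<le> \<epsilon> * (s * norm e)" using d1(2) small(1) unfolding lin(1)[symmetric] n[symmetric] by blast
  have b: "\<bar>g y - g x - s * g' e\<bar> \<le> \<epsilon> * (s * norm e)"
    using d2(2) small(2) unfolding lin(2)[symmetric] n[symmetric] real_norm_def by blast
  have "s * norm (f' e) = norm (s *\<^sub>R f' e)" using s by simp
  also have "\<dots> = norm ((f y - f x) - (f y - f x - s *\<^sub>R f' e))" by simp
  also have "\<dots> \<le> norm (f y - f x) + norm (f y - f x - s *\<^sub>R f' e)" by (rule norm_triangle_ineq4)
  also have "\<dots> \<le> C * \<bar>g y - g x\<bar> + \<epsilon> * (s * norm e)" using l a by (rule add_mono)
  also have "\<bar>g y - g x\<bar> \<le> \<bar>s * g' e\<bar> + \<epsilon> * (s * norm e)" using b by linarith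
  also have "\<bar>s * g' e\<bar> = s * \<bar>g' e\<bar>" using s by (simp add: abs_mult)
  finally have "s * norm (f' e) \<le> C * (s * \<bar>g' e\<bar> + \<epsilon> * (s * norm e)) + \<epsilon> * (s * norm e)"
    using C by (simp add: mult_left_mono)
  also have "\<dots> = s * (C * \<bar>g' e\<bar> + \<epsilon> * ((1 + C) * norm e))" by (simp add: algebra_simps)
  finally have "norm (f' e) \<le> C * \<bar>g' e\<bar> + \<epsilon> * ((1 + C) * norm e)" using s by simp
  also have "\<epsilon> * ((1 + C) * norm e) \<le> \<epsilon> * ((1 + C) * (norm e + 1))"
    using eps C by (intro mult_left_mono) auto
  also have "\<dots> = d" unfolding \<epsilon>_def using pos by (intro nonzero_eq_divide_eq[THEN iffD1] refl) linarith
  finally show "norm (f' e) \<le> C * \<bar>g' e\<bar> + d" by simp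
qed

lemma riemannian_volume_zero:
  fixes \<gamma> :: "real^'d \<Rightarrow> real^'n"
  assumes V: "open V" and \<gamma>: "continuous_on V \<gamma>" and A: "A \<in> sets borel" and null: "negligible {v \<in> V. \<gamma> v \<in> A}"
  shows "emeasure (riemannian_volume V \<gamma>) A = 0"
proof -
  let ?f = "\<lambda>v. let J = matrix (frechet_derivative \<gamma> (at v)) in ennreal (sqrt (det (transpose J ** J)))"
  let ?R = "restrict_space lborel V"
  have sp: "space ?R = V" by (simp add: space_restrict_space)
  have sR: "sets ?R = sets (restrict_space borel V)" by (rule sets_restrict_space_cong) simp
  have m: "\<gamma> \<in> measurable (density ?R ?f) borel"
    using borel_measurable_continuous_on_restrict[OF \<gamma>] sR
    by (simp add: measurable_def space_restrict_space)
  let ?S = "{v \<in> V. \<gamma> v \<in> A}"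
  have "?S \<in> null_sets lebesgue" using null by (simp add: negligible_iff_null_sets)
  then have "AE v in lebesgue. v \<notin> ?S" by (rule AE_not_in)
  then have "AE v in lborel. v \<notin> ?S" by (simp only: AE_completion_iff)
  then have ae: "AE v in ?R. v \<notin> ?S" using V by (subst AE_restrict_space_iff) auto
  have "emeasure (riemannian_volume V \<gamma>) A = emeasure (density ?R ?f) (\<gamma> -` A \<inter> V)"
    unfolding riemannian_volume_def by (subst emeasure_distr[OF m A]) (simp add: sp)
  also have "\<dots> = 0"
  proof -
    have "(\<integral>\<^sup>+ v. ?f v * indicator (\<gamma> -` A \<inter> V) v \<partial>?R) = (\<integral>\<^sup>+ v. 0 \<partial>?R)"
      by (rule nn_integral_cong_AE, use ae in eventually_elim) (auto simp: indicator_def)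
    then show ?thesis unfolding density_def emeasure_measure_of_conv by simp
  qed
  finally show ?thesis .
qed

context circle_model
begin

lemma angle_measurable: "angle \<in> borel_measurable borel"
proof (rule borel_measurable_iff_greater[THEN iffD2, rule_format])
  fix t
  have "open {z. 2 * pi * t < Arg2pi z}" by (rule open_Arg2pi2pi_gt)
  then have "open (hor -` {z. 2 * pi * t < Arg2pi z})"
    by (rule open_vimage) (rule continuous_on_hor[OF continuous_on_id])
  moreover have "hor -` {z. 2 * pi * t < Arg2pi z} = {p \<in> space borel. t < angle p}"
    by (auto simp: angle_def field_simps)
  ultimately show "{p \<in> space borel. t < angle p} \<in> sets borel" by simp
qed

lemma H_less: "H x < H y \<longleftrightarrow> x < y"
  using lift by (intro strict_mono_less) (simp add: circle_lift_def)

text \<open>On a smooth parametrization \<open>\<gamma>\<close> of a leaf the function \<open>t = H \<circ> rep c \<circ> \<gamma>\<close> is differentiable. Since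
  the leaf is Lipschitz over \<open>t\<close> and \<open>\<gamma>\<close> is an immersion, the derivative of \<open>t\<close> does not vanish, so the
  inverse of \<open>t\<close> is differentiable and carries null sets to null sets.\<close>

lemma leaf_null:
  fixes \<gamma> :: "real^1 \<Rightarrow> real^3"
  assumes b: "b \<in> box_fibre c" and par: "C1_parametrization V \<gamma> (box_chart c ` (box_base c \<times> {b}))"
    and N: "negligible N"
  shows "negligible {v \<in> V. angle (\<gamma> v) \<in> N}"
proof -
  let ?L = "box_chart c ` (box_base c \<times> {b})"
  let ?h = "\<lambda>y. flow (X y - (c + 1 / 2)) b"
  define t where "t v = H (rep c (\<gamma> v))" for v
  obtain \<gamma>i where hom: "homeomorphism V ?L \<gamma> \<gamma>i" using par by (auto simp: C1_parametrization_def)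
  have oV: "open V" and inj: "\<And>v. v \<in> V \<Longrightarrow> inj (frechet_derivative \<gamma> (at v))" and C1: "C1_on \<gamma> V"
    using par by (auto simp: C1_parametrization_def)
  obtain G where G: "\<And>v. v \<in> V \<Longrightarrow> (\<gamma> has_derivative blinfun_apply (G v)) (at v)"
    using C1 unfolding C1_on_def by blast
  have bL: "b \<in> Lam" and bt: "turn (alpha b) = turn (c + 1 / 2)" using b by (auto simp: box_fibre_def)
  obtain k :: int where k: "alpha b = c + 1 / 2 + of_int k" using bt unfolding turn_eq_iff by blast
  have on_leaf: "\<gamma> v = ?h (t v)" "\<gamma> v \<in> box c" "t v \<in> {H c<..<H (c + 1)}" if v: "v \<in> V" for v
  proof -
    have "\<gamma> v \<in> ?L" using v hom by (auto simp: homeomorphism_def)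
    then obtain a where a: "a \<in> box_base c" "\<gamma> v = box_chart c (a, b)" by blast
    have r: "rep c (\<gamma> v) = a $ 1" unfolding a(2) by (rule rep_box_chart(1)[OF a(1) b])
    show "\<gamma> v = ?h (t v)" unfolding t_def HX r unfolding a(2) box_chart_def fst_conv snd_conv ..
    show "\<gamma> v \<in> box c" unfolding a(2) by (rule rep_box_chart(2)[OF a(1) b])
    show "t v \<in> {H c<..<H (c + 1)}" using a(1) unfolding t_def r by (simp add: box_base_def H_less)
  qed
  have lip: "norm (\<gamma> u - \<gamma> v) \<le> 10 * pi * \<bar>t u - t v\<bar>" if "v \<in> V" "u \<in> V" for u v
  proof -
    have e: "H (alpha b + (X y - (c + 1 / 2))) = y + of_int k" for y
    proof -
      have "alpha b + (X y - (c + 1 / 2)) = X y + of_int k" unfolding k by simp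
      then show ?thesis by (simp only: H_int HX)
    qed
    show ?thesis
      using flow_lipschitz[OF bL, of "X (t u) - (c + 1 / 2)" "X (t v) - (c + 1 / 2)"]
      unfolding on_leaf(1)[OF that(1), symmetric] on_leaf(1)[OF that(2), symmetric] e by (simp add: dist_norm)
  qed
  have td: "(t has_derivative (\<lambda>e. frame_ang (\<gamma> v) (G v e))) (at v)" if v: "v \<in> V" for v
  proof -
    have "\<gamma> v \<in> torus" "turn (alpha (\<gamma> v)) \<noteq> turn c"
      using on_leaf(2)[OF v] Lam_torus by (auto simp: box_def)
    then have "((\<lambda>q. H (rep c q)) has_derivative frame_ang (\<gamma> v)) (at (\<gamma> v))" by (rule rep_deriv)
    from has_derivative_compose[OF G[OF v] this] show ?thesis unfolding t_def[abs_def] .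
  qed
  define s where "s y = \<gamma>i (?h y)" for y
  have h_leaf: "?h y \<in> ?L" "rep c (?h y) = X y" if y: "y \<in> {H c<..<H (c + 1)}" for y
  proof -
    have "H c < H (X y)" "H (X y) < H (c + 1)" using y by simp_all
    then have "c < X y" "X y < c + 1" by (simp_all only: H_less)
    then have a: "(vec (X y) :: real^1) \<in> box_base c" by (simp add: box_base_def)
    have h: "?h y = box_chart c (vec (X y), b)" by (simp add: box_chart_def)
    show "?h y \<in> ?L" unfolding h using a by blast
    show "rep c (?h y) = X y" unfolding h rep_box_chart(1)[OF a b] by simp
  qed
  have sV: "s y \<in> V" "t (s y) = y" if y: "y \<in> {H c<..<H (c + 1)}" for y
  proof -
    show "s y \<in> V" using h_leaf(1)[OF y] hom unfolding s_def homeomorphism_def by blast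
    have "\<gamma> (s y) = ?h y" using h_leaf(1)[OF y] hom unfolding s_def homeomorphism_def by blast
    then show "t (s y) = y" unfolding t_def by (simp add: h_leaf(2)[OF y])
  qed
  have st: "s (t v) = v" if "v \<in> V" for v
    unfolding s_def on_leaf(1)[OF that, symmetric] using hom that by (simp add: homeomorphism_def)
  have cs: "continuous_on {H c<..<H (c + 1)} s"
    unfolding s_def
  proof (rule continuous_on_compose2[of ?L \<gamma>i])
    show "continuous_on ?L \<gamma>i" using hom by (simp add: homeomorphism_def)
    have "continuous_on {H c<..<H (c + 1)} (\<lambda>y. X y - (c + 1 / 2))"
      by (intro continuous_on_diff continuous_on_const continuous_on_subset[OF continuous_X]) simp
    then show "continuous_on {H c<..<H (c + 1)} ?h" by (rule continuous_on_flow[OF continuous_on_const bL])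
    show "?h ` {H c<..<H (c + 1)} \<subseteq> ?L" using h_leaf(1) by (rule image_subsetI)
  qed
  have sd: "s differentiable (at y)" if y: "y \<in> {H c<..<H (c + 1)}" for y
  proof -
    let ?v = "s y" let ?e = "vec 1 :: real^1"
    define m where "m = frame_ang (\<gamma> ?v) (G ?v ?e)"
    have v: "?v \<in> V" by (rule sV(1)[OF y])
    have vec1: "w = (w $ 1) *\<^sub>R ?e" for w :: "real^1" by (simp add: vec_eq_iff forall_1)
    have "frechet_derivative \<gamma> (at ?v) = G ?v" by (rule frechet_derivative_at[symmetric, OF G[OF v]])
    then have "G ?v ?e \<noteq> G ?v 0" using inj[OF v] injD[of "G ?v" ?e 0] by (auto simp: vec_eq_iff)
    then have "0 < norm (G ?v ?e)" by (simp add: blinfun.zero_right)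
    also have "\<dots> \<le> 10 * pi * \<bar>m\<bar>"
      unfolding m_def by (rule derivative_lipschitz_compare[OF G[OF v] td[OF v] oV v _ lip[OF v]]) simp_all
    finally have m: "m \<noteq> 0" by auto
    have D: "frame_ang (\<gamma> ?v) (G ?v w) = (w $ 1) * m" for w
    proof -
      have "frame_ang (\<gamma> ?v) (G ?v w) = frame_ang (\<gamma> ?v) (G ?v ((w $ 1) *\<^sub>R ?e))" using vec1[of w] by simp
      also have "\<dots> = (w $ 1) * m"
        unfolding m_def using linear_cmul[OF has_derivative_linear[OF td[OF v]], of "w $ 1" ?e] by simp
      finally show ?thesis .
    qed
    have "(s has_derivative (\<lambda>x. (x / m) *\<^sub>R ?e)) (at y)"
    proof (rule has_derivative_inverse_basic[where f = t and T = "{H c<..<H (c + 1)}" and g = s and y = y, OF td[OF v]])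
      show "bounded_linear (\<lambda>x. (x / m) *\<^sub>R ?e)"
        by (rule bounded_linear_compose[OF bounded_linear_scaleR_left bounded_linear_divide])
      show "(\<lambda>x. (x / m) *\<^sub>R ?e) \<circ> (\<lambda>e. frame_ang (\<gamma> ?v) (G ?v e)) = id"
        unfolding D using m vec1 by (auto simp: fun_eq_iff)
      show "continuous (at y) s" using cs y by (simp add: continuous_on_eq_continuous_at)
    qed (use y sV(2) in auto)
    then show ?thesis by (rule differentiableI)
  qed
  define N' where "N' = (\<Union>k::int. (+) (of_int k) ` N)"
  have "negligible N'"
    unfolding N'_def by (rule negligible_countable_Union) (auto intro: negligible_translation N)
  then have neg: "negligible (N' \<inter> {H c<..<H (c + 1)})" by (rule negligible_subset) blast
  have "negligible (s ` (N' \<inter> {H c<..<H (c + 1)}))"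
  proof (rule negligible_differentiable_image_negligible[OF _ neg])
    show "s differentiable_on N' \<inter> {H c<..<H (c + 1)}"
      unfolding differentiable_on_def using sd differentiable_at_withinI by blast
  qed simp
  then show ?thesis
  proof (rule negligible_subset, intro subsetI)
    fix v assume "v \<in> {v \<in> V. angle (\<gamma> v) \<in> N}"
    then have v: "v \<in> V" "angle (\<gamma> v) \<in> N" by auto
    have "turn (rep c (\<gamma> v)) = turn (alpha (\<gamma> v))" by (rule turn_rep)
    then obtain j :: int where j: "rep c (\<gamma> v) = alpha (\<gamma> v) + of_int j" unfolding turn_eq_iff by blast
    have "t v = of_int j + angle (\<gamma> v)" unfolding t_def j by (simp add: H_int)
    then have "t v \<in> N'" using v(2) unfolding N'_def by blast
    then show "v \<in> s ` (N' \<inter> {H c<..<H (c + 1)})"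
      using st[OF v(1)] on_leaf(3)[OF v(1)] by (intro image_eqI[of _ _ "t v"]) auto
  qed
qed

section \<open>There is no SRB measure\<close>

lemma box_borel: "box c \<in> sets borel"
proof -
  have "openin (top_of_set Lam) (box c)" using box_product[of c] by (simp add: product_box_def)
  then obtain W where "open W" "box c = Lam \<inter> W" by (auto simp: openin_open)
  then show ?thesis using compact_imp_closed[OF compact_Lam] by simp
qed

text \<open>The disintegration over the box integrates conditional measures that are absolutely continuous on leaves, and these
  give no mass to a null set of angles.\<close>

lemma SRB_box_null:
  assumes srb: "SRB_measure TYPE(1) T torus \<mu>" and S: "angle -` N \<in> sets borel" and N: "negligible N"
  shows "emeasure \<mu> (angle -` N \<inter> box c) = 0"
proof -
  let ?\<nu> = "transverse_measure \<mu> (box c) (box_fibre c) (snd \<circ> box_inv c)"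
  let ?L = "\<lambda>b. box_chart c ` (box_base c \<times> {b})"
  have "\<exists>\<kappa>. disintegration \<mu> (box c) (box_fibre c) (snd \<circ> box_inv c) \<kappa> \<and>
      (AE b in ?\<nu>. abs_cont_on_leaf TYPE(1) (?L b) (\<kappa> b))"
    using srb box_product[of c] unfolding SRB_measure_def by blast
  then obtain \<kappa> where dis: "disintegration \<mu> (box c) (box_fibre c) (snd \<circ> box_inv c) \<kappa>"
    and ac: "AE b in ?\<nu>. abs_cont_on_leaf TYPE(1) (?L b) (\<kappa> b)" by blast
  have zero: "emeasure (\<kappa> b) (angle -` N) = 0"
    if b: "b \<in> box_fibre c" and a: "abs_cont_on_leaf TYPE(1) (?L b) (\<kappa> b)" for b
  proof -
    obtain V :: "(real^1) set" and \<gamma> where par: "C1_parametrization V \<gamma> (?L b)"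
      and abs: "absolutely_continuous (riemannian_volume V \<gamma>) (\<kappa> b)"
      using a unfolding abs_cont_on_leaf_def by blast
    have V: "open V" "continuous_on V \<gamma>" using par by (auto simp: C1_parametrization_def homeomorphism_def)
    have "{v \<in> V. \<gamma> v \<in> angle -` N} = {v \<in> V. angle (\<gamma> v) \<in> N}" by simp
    then have "emeasure (riemannian_volume V \<gamma>) (angle -` N) = 0"
      using leaf_null[OF b par N] by (intro riemannian_volume_zero[OF V S]) simp
    moreover have "angle -` N \<in> sets (riemannian_volume V \<gamma>)" using S by (simp add: riemannian_volume_def)
    ultimately have "angle -` N \<in> null_sets (riemannian_volume V \<gamma>)" by (rule null_setsI)
    then have "angle -` N \<in> null_sets (\<kappa> b)" using abs unfolding absolutely_continuous_def by (rule subsetD[rotated])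
    then show ?thesis by (rule null_setsD1)
  qed
  have sp: "space ?\<nu> = box_fibre c" by (simp add: transverse_measure_def space_restrict_space)
  have "AE b in ?\<nu>. b \<in> space ?\<nu>" by (rule AE_space)
  with ac have ae: "AE b in ?\<nu>. emeasure (\<kappa> b) (angle -` N) = 0"
    by eventually_elim (use zero sp in simp)
  have "emeasure \<mu> (angle -` N \<inter> box c) = (\<integral>\<^sup>+ b. emeasure (\<kappa> b) (angle -` N) \<partial>?\<nu>)"
    using dis S unfolding disintegration_def by blast
  also have "\<dots> = (\<integral>\<^sup>+ b. 0 \<partial>?\<nu>)" by (rule nn_integral_cong_AE[OF ae])
  finally show ?thesis by simp
qed

lemma open_T_pow_image: "open ((T ^^ k) ` torus)"
proof (induction k)
  case (Suc k)
  have sub: "(T ^^ k) ` torus \<subseteq> torus" using funpow_in[OF T_image] by blast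
  have "open (T ` ((T ^^ k) ` torus))"
    by (rule invariance_of_domain[OF continuous_on_subset[OF continuous_T sub] Suc inj_on_subset[OF T_inj sub]])
  then show ?case by (simp add: image_comp)
qed (simp add: open_torus)

lemma invariant_AE_Lam:
  assumes inv: "invariant_probability T torus \<mu>" shows "AE p in \<mu>. p \<in> Lam"
proof -
  note D = invariant_probabilityD[OF inv]
  have "AE p in \<mu>. p \<in> (T ^^ k) ` torus" for k
  proof (induction k)
    case 0
    have "AE p in \<mu>. p \<in> space \<mu>" by (rule AE_space)
    then show ?case by (simp add: D(2))
  next
    case (Suc k)
    have m: "{p \<in> space \<mu>. p \<in> (T ^^ Suc k) ` torus} \<in> sets \<mu>"
    proof -
      have "{p \<in> space \<mu>. p \<in> (T ^^ Suc k) ` torus} = torus \<inter> (T ^^ Suc k) ` torus" by (auto simp: D(2))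
      then show ?thesis unfolding D(3) using open_T_pow_image[of "Suc k"] by (auto simp: sets_restrict_space)
    qed
    from Suc have "AE p in \<mu>. T p \<in> (T ^^ Suc k) ` torus" by eventually_elim auto
    then have "AE p in distr \<mu> \<mu> T. p \<in> (T ^^ Suc k) ` torus" using AE_distr_iff[OF D(4) m] by (rule iffD2[rotated])
    then show ?case unfolding D(5) .
  qed
  then have "AE p in \<mu>. \<forall>k. p \<in> (T ^^ k) ` torus" by (simp only: AE_all_countable) simp
  then show ?thesis by eventually_elim (simp add: attractor_def)
qed

text \<open>The discs of conjugate angles \<open>0\<close> and \<open>1/2\<close> are disjoint, so every point is off one of them.\<close>

lemma Lam_boxes: "Lam \<subseteq> box 0 \<union> box (1 / 2)"
proof
  fix p assume p: "p \<in> Lam"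
  have "turn 0 \<noteq> turn (1 / 2)"
  proof
    assume "turn 0 = turn (1 / 2)"
    then obtain k :: int where "(0::real) = 1 / 2 + of_int k" unfolding turn_eq_iff by blast
    then have "real_of_int (2 * k + 1) = 0" by simp
    then have "2 * k + 1 = 0" by (simp only: of_int_eq_0_iff)
    then show False by presburger
  qed
  with p show "p \<in> box 0 \<union> box (1 / 2)" by (cases "turn (alpha p) = turn 0") (auto simp: box_def)
qed

lemma SRB_angle_null:
  assumes srb: "SRB_measure TYPE(1) T torus \<mu>" and N: "N \<in> null_sets lborel"
  shows "AE p in \<mu>. angle p \<notin> N"
proof -
  have inv: "invariant_probability T torus \<mu>" using srb by (simp add: SRB_measure_def)
  have neg: "negligible N" using N by (simp add: negligible_iff_null_sets null_sets_completionI)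
  have S: "angle -` N \<in> sets borel" using measurable_sets[OF angle_measurable, of N] N by auto
  have "angle -` N \<inter> box c \<in> null_sets \<mu>" for c
  proof (rule null_setsI[OF SRB_box_null[OF srb S neg]])
    have "angle -` N \<inter> box c \<subseteq> torus" using Lam_torus by (auto simp: box_def)
    moreover have "angle -` N \<inter> box c \<in> sets borel" using S box_borel by (rule sets.Int)
    ultimately show "angle -` N \<inter> box c \<in> sets \<mu>"
      unfolding invariant_probabilityD(3)[OF inv] using open_torus by (subst sets_restrict_space_iff) auto
  qed
  from AE_not_in[OF this[of 0]] AE_not_in[OF this[of "1 / 2"]] invariant_AE_Lam[OF inv]
  show ?thesis
  proof eventually_elim
    case (elim p)
    then show ?case using Lam_boxes by blast
  qed
qed

lemma angle_lift_pt: assumes "q \<in> space square" shows "angle (lift_pt q) = H (fst q)"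
proof -
  obtain k where k: "angle (lift_pt q) = H (fst q) + of_int k"
    unfolding lift_pt_def by (rule angle_tube[OF small_norm(2)[OF geo_bound(2)]])
  have q: "0 \<le> fst q" "fst q < 1" using assms by (auto simp: space_pair_measure)
  have H01: "H 0 = 0" "H 1 = 1" using lift H_int[of 0 1] by (simp_all add: circle_lift_def)
  have "0 \<le> H (fst q)" using q(1) H_less[of "fst q" 0] H01 by linarith
  moreover have "H (fst q) < 1" using q(2) H_less[of "fst q" 1] H01 by simp
  ultimately have "\<bar>real_of_int k\<bar> < 1" using k angle_bounds[of "lift_pt q"] by (simp add: abs_less_iff)
  then have "k = 0" by simp
  with k show ?thesis by simp
qed

text \<open>The first null set, of angles that are not equidistributed, forces an SRB measure to be \<open>phys\<close>; the second one, \<open>Z\<close>,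
  contains the angles of almost all points for \<open>phys\<close>, whose first coordinate in the natural extension is uniform.\<close>

lemma no_SRB:
  assumes ae: "AE t in ui. equidistributed (X t)"
    and Z: "Z \<in> null_sets lborel" "AE x in ui. H x \<in> Z"
  shows "\<not> SRB_measure TYPE(1) T torus \<mu>"
proof
  assume srb: "SRB_measure TYPE(1) T torus \<mu>"
  have inv: "invariant_probability T torus \<mu>" using srb by (simp add: SRB_measure_def)
  have "AE t in lborel. t \<in> {0..<1} \<longrightarrow> equidistributed (X t)" using ae by (simp only: AE_ui)
  then obtain N where N: "{t \<in> space lborel. \<not> (t \<in> {0..<1} \<longrightarrow> equidistributed (X t))} \<subseteq> N"
    "emeasure lborel N = 0" "N \<in> sets lborel" by (rule AE_E)
  have "AE p in \<mu>. angle p \<notin> N" by (rule SRB_angle_null[OF srb null_setsI[OF N(2,3)]])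
  then have "AE p in \<mu>. equidistributed (X (angle p))"
  proof eventually_elim
    case (elim p)
    then show ?case using N(1) angle_bounds[of p] by auto
  qed
  then have eq: "\<mu> = phys" by (rule invariant_eq_phys[OF inv])
  have "AE p in distr square (restrict_space borel torus) lift_pt. angle p \<notin> Z"
    using SRB_angle_null[OF srb Z(1)] unfolding eq phys_def .
  then have out: "AE q in square. angle (lift_pt q) \<notin> Z" by (rule AE_distrD[OF lift_pt_meas])
  have d: "distr square ui fst = ui" by (rule ui.distr_pair_fst)
  then have "AE x in distr square ui fst. H x \<in> Z" using Z(2) by (simp only:)
  then have "AE q in square. H (fst q) \<in> Z" by (rule AE_distrD[OF measurable_fst])
  moreover have "AE q in square. q \<in> space square" by (rule AE_space)
  ultimately have "AE q in square. False" using out by eventually_elim (simp add: angle_lift_pt)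
  then show False by (simp add: sq.P.AE_False)
qed

end

section \<open>The example\<close>

text \<open>Between two parameters \<open>t\<close> and \<open>y\<close> the Jacobian stays close to its value at \<open>amp_quantile t\<close>, by continuity; the
  mean value estimate for the limit then bounds the difference quotient.\<close>

lemma amp_cdf_tripling_deriv:
  "((\<lambda>t. amp_cdf (3 * inv amp_cdf t)) has_real_derivative riesz_jac_lim amp (amp_quantile t)) (at t)"
proof -
  let ?J = "riesz_jac_lim amp" and ?X = "amp_quantile" and ?F = "\<lambda>t. amp_cdf (3 * inv amp_cdf t)"
  have HX: "amp_cdf (?X t) = t" for t
    unfolding amp_quantile_def by (rule circle_lift_inv(1)[OF circle_lift_amp_cdf])
  have mono: "?X s \<le> ?X t \<longleftrightarrow> s \<le> t" for s t
    using circle_lift_inv_lift[OF circle_lift_amp_cdf] unfolding amp_quantile_def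
    by (intro strict_mono_less_eq) (simp add: circle_lift_def)
  have "continuous_on UNIV ?X"
    using circle_lift_inv_lift[OF circle_lift_amp_cdf] by (simp add: amp_quantile_def circle_lift_def)
  then have cont: "continuous_on UNIV (\<lambda>t. ?J (?X t))"
    by (rule continuous_on_compose2[OF continuous_riesz_jac_lim[OF null_coeffs_amp]]) simp
  have incr: "\<bar>(?F v - ?F u) - ?J (?X t) * (v - u)\<bar> \<le> e * (v - u)"
    if "u \<le> v" and c: "\<And>s. u \<le> s \<Longrightarrow> s \<le> v \<Longrightarrow> \<bar>?J (?X s) - ?J (?X t)\<bar> \<le> e" for u v e
  proof -
    have b: "\<bar>?J z - ?J (?X t)\<bar> \<le> e" if z: "?X u \<le> z" "z \<le> ?X v" for z
    proof -
      have "z = ?X (amp_cdf z)" unfolding amp_quantile_def by (rule circle_lift_inv(2)[OF circle_lift_amp_cdf, symmetric])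
      moreover from this have "u \<le> amp_cdf z" "amp_cdf z \<le> v" using z mono[of u "amp_cdf z"] mono[of "amp_cdf z" v] by simp_all
      ultimately show ?thesis using c[of "amp_cdf z"] by simp
    qed
    have uv: "?X u \<le> ?X v" using that(1) by (simp only: mono)
    have "\<bar>(amp_cdf (3 * ?X v) - amp_cdf (3 * ?X u)) - ?J (?X t) * (amp_cdf (?X v) - amp_cdf (?X u))\<bar>
        \<le> e * (amp_cdf (?X v) - amp_cdf (?X u))"
      using riesz_lim_jacobian(2)[OF null_coeffs_amp uv b] unfolding amp_cdf_def .
    then show ?thesis unfolding HX unfolding amp_quantile_def .
  qed
  show ?thesis
    unfolding has_field_derivative_def has_derivative_at_alt
  proof (intro conjI allI impI)
    fix e :: real assume e: "0 < e"
    have "isCont (\<lambda>t. ?J (?X t)) t" using cont by (simp add: continuous_on_eq_continuous_at)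
    then obtain d where d: "0 < d" "\<And>s. dist s t < d \<Longrightarrow> dist (?J (?X s)) (?J (?X t)) < e"
      using e unfolding continuous_at_eps_delta by blast
    have c: "\<bar>?J (?X s) - ?J (?X t)\<bar> \<le> e" if "\<bar>s - t\<bar> < d" for s
      using d(2)[of s] that by (simp add: dist_real_def)
    show "\<exists>d>0. \<forall>y. norm (y - t) < d \<longrightarrow> norm (?F y - ?F t - ?J (?X t) * (y - t)) \<le> e * norm (y - t)"
    proof (intro exI[of _ d] conjI d(1) allI impI)
      fix y assume y: "norm (y - t) < d"
      show "norm (?F y - ?F t - ?J (?X t) * (y - t)) \<le> e * norm (y - t)"
      proof (cases "t \<le> y")
        case True
        then have "\<bar>(?F y - ?F t) - ?J (?X t) * (y - t)\<bar> \<le> e * (y - t)"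
          using y by (intro incr c) auto
        then show ?thesis using True by simp
      next
        case False
        then have "\<bar>(?F t - ?F y) - ?J (?X t) * (t - y)\<bar> \<le> e * (t - y)"
          using y by (intro incr c) auto
        moreover have "(?F t - ?F y) - ?J (?X t) * (t - y) = - ((?F y - ?F t) - ?J (?X t) * (y - t))"
          by (simp add: algebra_simps)
        ultimately show ?thesis using False by simp
      qed
    qed
  qed (rule bounded_linear_mult_right)
qed

interpretation example: circle_model amp_cdf "\<lambda>t. riesz_jac_lim amp (amp_quantile t)"
proof
  show "circle_lift amp_cdf" by (rule circle_lift_amp_cdf)
  show "((\<lambda>t. amp_cdf (3 * inv amp_cdf t)) has_real_derivative riesz_jac_lim amp (amp_quantile t)) (at t)" for t
    by (rule amp_cdf_tripling_deriv)
  have q: "circle_lift amp_quantile" unfolding amp_quantile_def by (rule circle_lift_inv_lift[OF circle_lift_amp_cdf])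
  then show "continuous_on UNIV (\<lambda>t. riesz_jac_lim amp (amp_quantile t))"
    by (intro continuous_on_compose2[OF continuous_riesz_jac_lim[OF null_coeffs_amp]]) (auto simp: circle_lift_def)
  show "riesz_jac_lim amp (amp_quantile (t + 1)) = riesz_jac_lim amp (amp_quantile t)" for t
    using q riesz_jac_lim_periodic by (simp add: circle_lift_def)
  show "2 \<le> riesz_jac_lim amp (amp_quantile t)" "riesz_jac_lim amp (amp_quantile t) \<le> 4" for t
    by (rule riesz_jac_lim_bounds[OF null_coeffs_amp])+
qed

theorem corollary1p11:
  shows "\<exists>(U :: (real^3) set) (T :: real^3 \<Rightarrow> real^3).
           open U \<and> bounded U \<and> T ` U \<subseteq> U \<and> C1_diffeo_onto_image T U \<and>
           compact (attractor T U) \<and>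
           uniformly_hyperbolic_attractor T U 1 \<and>
           (\<exists>!\<mu>. physical_measure T U \<mu>) \<and>
           (\<nexists>\<mu>. SRB_measure TYPE(1) T U \<mu>)"
proof (intro exI conjI)
  let ?T = "example.T"
  have ae: "AE t in ui. equidistributed (inv amp_cdf t)"
    using AE_equidistributed unfolding amp_quantile_def .
  obtain Z where Z: "Z \<in> null_sets lborel" "AE x in ui. amp_cdf x \<in> Z" by (rule amp_cdf_singular)
  show "open torus" by (rule open_torus)
  show "bounded torus" by (rule bounded_torus)
  show "?T ` torus \<subseteq> torus" by (rule example.T_image)
  show "C1_diffeo_onto_image ?T torus" by (rule example.T_diffeo)
  show "compact (attractor ?T torus)" by (rule example.compact_Lam)
  show "uniformly_hyperbolic_attractor ?T torus 1" by (rule example.hyperbolic)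
  show "\<exists>!\<mu>. physical_measure ?T torus \<mu>" by (rule example.unique_physical[OF ae])
  show "\<nexists>\<mu>. SRB_measure TYPE(1) ?T torus \<mu>" using example.no_SRB[OF ae Z] by blast
qed

end
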